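(* Let $d\ge 3$ and let $\mathcal K$ be a finite chiral (abstract) $d$-polytope whose facets are regular. Then there exists a finite chiral $(d+1)$-polytope $\mathcal P$ whose facets are isomorphic to $\mathcal K$.
   Context: An abstract $d$-polytope is a ranked poset with a least face (rank $-1$) and a greatest face (rank $d$), in which every flag (maximal chain) has $d+2$ elements, which satisfies the diamond condition (whenever $F<G$ with $\mathrm{rank}(G)-\mathrm{rank}(F)=2$ there are exactly two faces strictly between them) and is strongly flag-connected. For a flag $\Phi$ and $i\in\{0,\dots,d-1\}$, $\Phi^i$ denotes the unique flag differing from $\Phi$ exactly in its $i$-face. Automorphisms are order-preserving bijections. A polytope is regular if its automorphism group acts transitively on flags, and chiral if the automorphism group has exactly two orbits on flags with adjacent flags always in different orbits. The facets are the sections $F/F_{-1}$ for faces $F$ of rank $d-1$, viewed as $(d-1)$-polytopes. *)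

theory Defs
  imports Main
begin

text \<open>
  Posets are reflexive relations \<open>r :: 'a rel\<close>, with \<open>Field r\<close> as the set of faces.
  The rank function \<open>rk\<close> matters only on \<open>Field r\<close>, and for an abstract polytope it is
  uniquely determined there by \<open>r\<close>.
\<close>

definition interval :: "'a rel \<Rightarrow> 'a \<Rightarrow> 'a \<Rightarrow> 'a set" where
  "interval r F G = {H. (F, H) \<in> r \<and> (H, G) \<in> r}"

text \<open>The section \<open>G/F\<close>, with the induced order.\<close>

definition face_section :: "'a rel \<Rightarrow> 'a \<Rightarrow> 'a \<Rightarrow> 'a rel" where
  "face_section r F G = Restr r (interval r F G)"

definition flags :: "'a rel \<Rightarrow> 'a set set" where
  "flags r = {\<Phi>. pred_on.maxchain (Field r) (\<lambda>F G. (F, G) \<in> r) \<Phi>}"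

text \<open>\<open>\<Psi>\<close> is \<open>\<Phi>\<^sup>i\<close>: it is a flag that differs from the flag \<open>\<Phi>\<close> exactly in its \<open>i\<close>-face.\<close>

definition i_adjacent :: "'a rel \<Rightarrow> ('a \<Rightarrow> int) \<Rightarrow> int \<Rightarrow> 'a set \<Rightarrow> 'a set \<Rightarrow> bool" where
  "i_adjacent r rk i \<Phi> \<Psi> \<longleftrightarrow>
     \<Phi> \<in> flags r \<and> \<Psi> \<in> flags r \<and> \<Phi> \<noteq> \<Psi> \<and> {F \<in> \<Phi>. rk F \<noteq> i} = {F \<in> \<Psi>. rk F \<noteq> i}"

definition adjacent :: "nat \<Rightarrow> 'a rel \<Rightarrow> ('a \<Rightarrow> int) \<Rightarrow> 'a set \<Rightarrow> 'a set \<Rightarrow> bool" where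
  "adjacent d r rk \<Phi> \<Psi> \<longleftrightarrow> (\<exists>i\<in>{0..<int d}. i_adjacent r rk i \<Phi> \<Psi>)"

text \<open>
  Strong flag-connectedness: any two flags \<open>\<Phi>\<close>, \<open>\<Psi>\<close> are joined by a sequence of successively
  adjacent flags, all of which contain \<open>\<Phi> \<inter> \<Psi>\<close>.
\<close>

definition strongly_flag_connected :: "nat \<Rightarrow> 'a rel \<Rightarrow> ('a \<Rightarrow> int) \<Rightarrow> bool" where
  "strongly_flag_connected d r rk \<longleftrightarrow>
     (\<forall>\<Phi>\<in>flags r. \<forall>\<Psi>\<in>flags r.
        (\<lambda>X Y. adjacent d r rk X Y \<and> \<Phi> \<inter> \<Psi> \<subseteq> X \<and> \<Phi> \<inter> \<Psi> \<subseteq> Y)\<^sup>*\<^sup>* \<Phi> \<Psi>)"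

locale ranked_poset =
  fixes r :: "'a rel" and rk :: "'a \<Rightarrow> int"
  assumes partial_order: "Partial_order r"
    and rank_strict_mono: "\<And>F G. (F, G) \<in> r \<Longrightarrow> F \<noteq> G \<Longrightarrow> rk F < rk G"
    and rank_cover:
      "\<And>F G. (F, G) \<in> r \<Longrightarrow> F \<noteq> G \<Longrightarrow> interval r F G = {F, G} \<Longrightarrow> rk G = rk F + 1"

locale abstract_polytope = ranked_poset r rk
  for d :: nat and r :: "'a rel" and rk :: "'a \<Rightarrow> int" +
  assumes least_face: "\<exists>E\<in>Field r. rk E = -1 \<and> (\<forall>F\<in>Field r. (E, F) \<in> r)"
    and greatest_face: "\<exists>G\<in>Field r. rk G = int d \<and> (\<forall>F\<in>Field r. (F, G) \<in> r)"
    and card_flag: "\<And>\<Phi>. \<Phi> \<in> flags r \<Longrightarrow> card \<Phi> = d + 2"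
    and diamond: "\<And>F G. (F, G) \<in> r \<Longrightarrow> rk G - rk F = 2 \<Longrightarrow> card (interval r F G - {F, G}) = 2"
    and strongly_flag_connected: "strongly_flag_connected d r rk"

definition poset_iso :: "'a rel \<Rightarrow> 'b rel \<Rightarrow> ('a \<Rightarrow> 'b) \<Rightarrow> bool" where
  "poset_iso r s f \<longleftrightarrow>
     bij_betw f (Field r) (Field s) \<and>
     (\<forall>F\<in>Field r. \<forall>G\<in>Field r. (F, G) \<in> r \<longleftrightarrow> (f F, f G) \<in> s)"

definition isomorphic :: "'a rel \<Rightarrow> 'b rel \<Rightarrow> bool" where
  "isomorphic r s \<longleftrightarrow> (\<exists>f. poset_iso r s f)"

abbreviation automorphism :: "'a rel \<Rightarrow> ('a \<Rightarrow> 'a) \<Rightarrow> bool" where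
  "automorphism r \<equiv> poset_iso r r"

definition flag_orbit :: "'a rel \<Rightarrow> 'a set \<Rightarrow> 'a set set" where
  "flag_orbit r \<Phi> = {f ` \<Phi> | f. automorphism r f}"

locale regular_polytope = abstract_polytope +
  assumes flag_transitive: "\<And>\<Phi> \<Psi>. \<Phi> \<in> flags r \<Longrightarrow> \<Psi> \<in> flags r \<Longrightarrow> \<Psi> \<in> flag_orbit r \<Phi>"

locale chiral_polytope = abstract_polytope +
  assumes two_flag_orbits: "card (flag_orbit r ` flags r) = 2"
    and adjacent_orbits: "\<And>\<Phi> \<Psi>. adjacent d r rk \<Phi> \<Psi> \<Longrightarrow> flag_orbit r \<Phi> \<noteq> flag_orbit r \<Psi>"

text \<open>
  The facets of a \<open>d\<close>-polytope as posets, i.e. the sections \<open>F/E\<close> with \<open>F\<close> of rank \<open>d - 1\<close> and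
  \<open>E\<close> the least face, which is the only face of rank \<open>-1\<close>.
\<close>

definition facets :: "nat \<Rightarrow> 'a rel \<Rightarrow> ('a \<Rightarrow> int) \<Rightarrow> 'a rel set" where
  "facets d r rk = {face_section r E F | E F.
     E \<in> Field r \<and> F \<in> Field r \<and> rk E = -1 \<and> rk F = int d - 1}"

end

theory Submission imports Defs begin

text \<open>
  The flags of the new polytope are modelled by their adjacency involutions \<open>r\<^sub>0, \<dots>, r\<^sub>d\<close>. On the set
  \<open>\<Omega>\<close> of flags of \<open>K\<close> the involutions \<open>r\<^sub>0, \<dots>, r\<^bsub>d-1\<^esub>\<close> are given and exchange the two flag orbits. Each facet
  \<open>F\<close> is regular, so after choosing a base flag \<open>\<psi>\<close> through \<open>F\<close> there is an automorphism of \<open>F\<close> taking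
  \<open>\<psi>\<close> to its \<open>(d-2)\<close>-adjacent flag. Acting on the flags through \<open>F\<close> it is an involution that
  exchanges the orbits and commutes with \<open>r\<^sub>0, \<dots>, r\<^bsub>d-2\<^esub>\<close>. These reflections, together with a change of
  sheet over one facet, define \<open>r\<^sub>d\<close> on \<open>\<Omega> \<times> {0, 1}\<close>. The flags of the extension are the permutations
  generated by the \<open>r\<^sub>i\<close>, restricted to one orbit colour; the even words act on them by automorphisms
  with two orbits, and the words in \<open>r\<^sub>0, \<dots>, r\<^bsub>d-1\<^esub>\<close> reproduce \<open>K\<close> because the automorphism group of \<open>K\<close> is
  transitive on either colour.

  If the base flags are chosen to share with a given flag \<open>\<phi>\<close> the faces of rank less than \<open>k\<close>
  whenever the facet contains them, then \<open>r\<^sub>k, \<dots>, r\<^sub>d\<close> all preserve these faces. This gives the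
  intersection property that makes the extension a polytope. It cannot be regular, since its facets
  are isomorphic to the chiral polytope \<open>K\<close>.
\<close>

text \<open>The obstacle is polytopality. Commuting facet reflections alone give \<open>r_d\<close>
  the right relations with distant generators, but not the intersection property. The choice of base
  flags that secures it at rank \<open>k\<close> depends on \<open>k\<close> and on the flag
  \<open>\<phi>\<close>. Hence all choices are run in parallel: there is a pair of sheets for each
  \<open>(\<phi>, k)\<close>, and a permutation is recorded by its action on all of them at once.
  The reflections move the \<open>(d - 2)\<close>-face of their base flags, so this device reaches
  only \<open>k \<le> d - 2\<close>. The remaining ranks \<open>d - 1\<close> and \<open>d\<close>
  are the reason for the change of sheet: the old generators never change the sheet, and
  \<open>r_d\<close> does so over exactly one facet, which makes that facet visible to
  words.\<close>

definition conn :: "(int \<Rightarrow> 'm \<Rightarrow> 'm) \<Rightarrow> int set \<Rightarrow> 'm \<Rightarrow> 'm \<Rightarrow> bool" where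
  "conn r I x y \<longleftrightarrow> (\<exists>w. set w \<subseteq> I \<and> y = foldr r w x)"

lemma conn_refl [simp]: "conn r I x x"
  unfolding conn_def by (rule exI[of _ "[]"]) simp

lemma conn_step: "conn r I x y \<Longrightarrow> i \<in> I \<Longrightarrow> conn r I x (r i y)"
  unfolding conn_def by (metis (no_types, lifting) foldr.simps(2) comp_apply insert_subset list.simps(15))

lemma conn_single: "i \<in> I \<Longrightarrow> conn r I x (r i x)"
  by (rule conn_step) simp_all

lemma conn_trans: "conn r I x y \<Longrightarrow> conn r I y z \<Longrightarrow> conn r I x z"
  unfolding conn_def by (metis foldr_append le_sup_iff set_append comp_apply)

lemma conn_mono: "conn r I x y \<Longrightarrow> I \<subseteq> J \<Longrightarrow> conn r J x y"
  unfolding conn_def by blast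

lemma conn_induct [consumes 1, case_names refl step]:
  assumes "conn r I x y" and "P x" and "\<And>z i. conn r I x z \<Longrightarrow> P z \<Longrightarrow> i \<in> I \<Longrightarrow> P (r i z)"
  shows "P y"
proof -
  from assms(1) obtain w where w: "set w \<subseteq> I" "y = foldr r w x" unfolding conn_def by blast
  have "conn r I x (foldr r w x) \<and> P (foldr r w x)" using w(1)
    by (induction w) (auto simp: assms(2) intro: assms(3) conn_step)
  with w show ?thesis by simp
qed

lemma conn_in:
  assumes "conn r I x y" "x \<in> M" "\<And>i x. i \<in> I \<Longrightarrow> x \<in> M \<Longrightarrow> r i x \<in> M"
  shows "y \<in> M"
  using assms by (induction rule: conn_induct) auto

lemma conn_reverse:
  assumes "conn r I x y" "x \<in> M" "\<And>i x. i \<in> I \<Longrightarrow> x \<in> M \<Longrightarrow> r i x \<in> M"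
    "\<And>i x. i \<in> I \<Longrightarrow> x \<in> M \<Longrightarrow> r i (r i x) = x"
  shows "conn r I y x"
  using assms(1)
proof (induction rule: conn_induct)
  case (step z i)
  have "z \<in> M" using conn_in[OF step(1) assms(2,3)] by blast
  then have "conn r I (r i z) z" using assms(4) step conn_single[of i I r "r i z"] by simp
  then show ?case using conn_trans step by metis
qed simp

section \<open>Polytopes from edge-coloured graphs\<close>

text \<open>A graph on flags whose edges are coloured by ranks. The assumption \<open>inter\<close>
  is the path intersection property for initial and final segments of the colours; it separates the
  flag graphs of polytopes from more general ones.\<close>

locale maniplex =
  fixes M :: "'m set" and r :: "int \<Rightarrow> 'm \<Rightarrow> 'm" and D :: nat
  assumes nonempty: "M \<noteq> {}"
    and closed: "\<And>i x. i \<in> {0..<int D} \<Longrightarrow> x \<in> M \<Longrightarrow> r i x \<in> M"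
    and invol: "\<And>i x. i \<in> {0..<int D} \<Longrightarrow> x \<in> M \<Longrightarrow> r i (r i x) = x"
    and nofix: "\<And>i x. i \<in> {0..<int D} \<Longrightarrow> x \<in> M \<Longrightarrow> r i x \<noteq> x"
    and commute: "\<And>i j x. 0 \<le> i \<Longrightarrow> i + 2 \<le> j \<Longrightarrow> j < int D \<Longrightarrow> x \<in> M \<Longrightarrow>
                   r i (r j x) = r j (r i x)"
    and connected: "\<And>x y. x \<in> M \<Longrightarrow> y \<in> M \<Longrightarrow> conn r {0..<int D} x y"
    and inter: "\<And>x y k m. x \<in> M \<Longrightarrow> y \<in> M \<Longrightarrow> 0 \<le> k \<Longrightarrow> m \<le> int D \<Longrightarrow>
                   conn r {0..<m} x y \<Longrightarrow> conn r {k..<int D} x y \<Longrightarrow> conn r {k..<m} x y"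
begin

abbreviation "C \<equiv> {0..<int D}"

lemma conn_closed: "conn r I x y \<Longrightarrow> I \<subseteq> C \<Longrightarrow> x \<in> M \<Longrightarrow> y \<in> M"
  by (rule conn_in) (use closed in blast)+

lemma conn_sym: "conn r I x y \<Longrightarrow> I \<subseteq> C \<Longrightarrow> x \<in> M \<Longrightarrow> conn r I y x"
  by (rule conn_reverse) (use closed invol in blast)+

lemma commute': "i \<in> C \<Longrightarrow> j \<in> C \<Longrightarrow> i + 2 \<le> j \<or> j + 2 \<le> i \<Longrightarrow> x \<in> M \<Longrightarrow> r i (r j x) = r j (r i x)"
  using commute[of i j x] commute[of j i x] by auto

lemma conn_far:
  assumes "conn r B z y" "B \<subseteq> C" "i \<in> C" "\<And>b. b \<in> B \<Longrightarrow> i + 2 \<le> b \<or> b + 2 \<le> i" "z \<in> M"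
  shows "conn r B (r i z) (r i y)"
  using assms(1)
proof (induction rule: conn_induct)
  case (step u j)
  then have "u \<in> M" using conn_closed assms by blast
  then have "r i (r j u) = r j (r i u)" using commute' step assms by blast
  with step show ?case by (simp add: conn_step)
qed simp

text \<open>Steps with colours in \<open>A\<close> commute with steps in \<open>B\<close>, so a
  mixed path can be sorted: a new \<open>A\<close>-step at the end is pulled back through the
  \<open>B\<close>-part by \<open>conn_far\<close>.\<close>

lemma conn_split:
  assumes "conn r (A \<union> B) x y" "A \<subseteq> C" "B \<subseteq> C" "x \<in> M"
    and far: "\<And>a b. a \<in> A \<Longrightarrow> b \<in> B \<Longrightarrow> a + 2 \<le> b \<or> b + 2 \<le> a"
  shows "\<exists>z\<in>M. conn r A x z \<and> conn r B z y"
  using assms(1)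
proof (induction rule: conn_induct)
  case refl
  then show ?case using assms(4) by (intro bexI[of _ x]) auto
next
  case (step u i)
  then obtain z where z: "z \<in> M" "conn r A x z" "conn r B z u" by blast
  show ?case
  proof (cases "i \<in> B")
    case True
    then show ?thesis using z by (meson conn_step)
  next
    case False
    then have iA: "i \<in> A" using step by blast
    have "conn r B (r i z) (r i u)"
      by (rule conn_far) (use z assms iA in auto)
    moreover have "conn r A x (r i z)" using z iA conn_step by metis
    moreover have "r i z \<in> M" using z iA closed assms(2) by blast
    ultimately show ?thesis by blast
  qed
qed

lemma conn_split_rank:
  assumes "conn r (C - {i}) x y" "x \<in> M"
  obtains z where "z \<in> M" "conn r ({0..<i} \<inter> C) x z" "conn r ({i+1..<int D} \<inter> C) z y"
proof -
  have "C - {i} = ({0..<i} \<inter> C) \<union> ({i+1..<int D} \<inter> C)" by auto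
  then have "conn r (({0..<i} \<inter> C) \<union> ({i+1..<int D} \<inter> C)) x y" using assms by simp
  then have "\<exists>z\<in>M. conn r ({0..<i} \<inter> C) x z \<and> conn r ({i+1..<int D} \<inter> C) z y"
    by (rule conn_split) (use assms in auto)
  then show ?thesis using that by blast
qed

lemma conn_split_rank':
  assumes "conn r (C - {i}) x y" "x \<in> M"
  obtains z where "z \<in> M" "conn r ({i+1..<int D} \<inter> C) x z" "conn r ({0..<i} \<inter> C) z y"
proof -
  have y: "y \<in> M" using assms conn_closed by blast
  have "conn r (C - {i}) y x" using conn_sym[OF assms(1)] assms by blast
  then obtain z where "z \<in> M" "conn r ({0..<i} \<inter> C) y z" "conn r ({i+1..<int D} \<inter> C) z x"
    using conn_split_rank y by metis
  then show ?thesis using that conn_sym y by (metis Int_lower2)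
qed

text \<open>Path intersection for arbitrary colour sets follows from the one for intervals because
  distant colours commute.\<close>

lemma conn_Diff:
  assumes "finite S" "S \<subseteq> C" "x \<in> M" "y \<in> M" "\<And>i. i \<in> S \<Longrightarrow> conn r (C - {i}) x y"
  shows "conn r (C - S) x y"
  using assms(1,2,5)
proof (induction S rule: finite_linorder_max_induct)
  case empty
  then show ?case using connected assms by simp
next
  case (insert b A)
  show ?case
  proof (cases "A = {}")
    case True
    then show ?thesis using insert by simp
  next
    case False
    \<comment> \<open>The largest removed colour is \<open>b\<close>, and \<open>a\<close> is the
      next one. Without the colours of \<open>A\<close> the path from \<open>x\<close> to
      \<open>y\<close> sorts at \<open>a\<close>, and only its upper part can still use
      \<open>b\<close>.\<close>
    define a where "a = Max A"
    have a: "a \<in> A" "\<And>a'. a' \<in> A \<Longrightarrow> a' \<le> a" using False insert by (auto simp: a_def)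
    then have ab: "a < b" "0 \<le> a" "b < int D" using insert by auto
    have "conn r (C - A) x y" using insert by auto
    moreover have "C - A = ({0..<a} - A) \<union> {a+1..<int D}" using a ab insert(4)
    proof -
      have "i \<notin> A" if "a + 1 \<le> i" for i using a(2)[of i] that by auto
      then show ?thesis using a(1) ab insert(4) by auto (metis not_less_iff_gr_or_eq zless_add1_eq not_le)+
    qed
    ultimately have "conn r (({0..<a} - A) \<union> {a+1..<int D}) x y" by simp
    then have "\<exists>z\<in>M. conn r ({0..<a} - A) x z \<and> conn r {a+1..<int D} z y"
      by (rule conn_split) (use assms ab in auto)
    then obtain z where z: "z \<in> M" "conn r ({0..<a} - A) x z" "conn r {a+1..<int D} z y" by blast
    \<comment> \<open>The part from \<open>x\<close> to \<open>z\<close> avoids \<open>b\<close>,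
      hence \<open>z\<close> and \<open>y\<close> are also joined avoiding \<open>b\<close>. Sorting
      that path at \<open>b\<close> yields \<open>w\<close>, which is joined to \<open>z\<close>
      both by colours above \<open>a\<close> and by colours below \<open>b\<close>; this is the
      situation of \<open>inter\<close>.\<close>
    have "conn r (C - {b}) x z" using z(2) ab by (rule_tac conn_mono) auto
    then have "conn r (C - {b}) z x" using conn_sym assms by blast
    then have "conn r (C - {b}) z y" using conn_trans[OF _ insert(5)[of b]] by blast
    then obtain w where w: "w \<in> M" "conn r ({0..<b} \<inter> C) z w" "conn r ({b+1..<int D} \<inter> C) w y"
      using conn_split_rank z by metis
    have "conn r {a+1..<int D} y w"
    proof (rule conn_mono)
      show "conn r ({b+1..<int D} \<inter> C) y w" using conn_sym[OF w(3)] w(1) by blast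
    qed (use ab in auto)
    then have "conn r {a+1..<int D} z w" using z conn_trans by metis
    moreover have "conn r {0..<b} z w" using conn_mono[OF w(2)] by simp
    ultimately have zw: "conn r {a+1..<b} z w" using inter[of z w "a+1" b] z w ab by simp
    have "conn r (C - insert b A) x z" using z(2) ab by (rule_tac conn_mono) auto
    moreover have "conn r (C - insert b A) z w" using zw
      by (rule conn_mono) (use ab a in fastforce)
    moreover have "conn r (C - insert b A) w y" using w(3)
      by (rule conn_mono) (use ab a in fastforce)
    ultimately show ?thesis using conn_trans by metis
  qed
qed

end

section \<open>Faces as connected components of the coloured graph\<close>

locale labelled_maniplex = maniplex M r D for M :: "'m set" and r D +
  fixes lab :: "int \<Rightarrow> 'm \<Rightarrow> 'f" and rk :: "'f \<Rightarrow> int"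
  assumes rk_lab: "\<And>i x. i \<in> {-1..int D} \<Longrightarrow> x \<in> M \<Longrightarrow> rk (lab i x) = i"
    and lab_eq_iff: "\<And>i x y. i \<in> {-1..int D} \<Longrightarrow> x \<in> M \<Longrightarrow> y \<in> M \<Longrightarrow>
          lab i x = lab i y \<longleftrightarrow> conn r ({0..<int D} - {i}) x y"
begin

abbreviation "ranks \<equiv> {-1..int D}"

text \<open>The names \<open>lab i x\<close> of the components are left abstract, which allows the
  faces to be natural numbers in the end. Incidence means that the two components share a
  flag.\<close>

definition P :: "'f rel" where
  "P = {(lab i x, lab j x) | i j x. i \<in> ranks \<and> j \<in> ranks \<and> i \<le> j \<and> x \<in> M}"

definition fl :: "'m \<Rightarrow> 'f set" where "fl x = (\<lambda>i. lab i x) ` ranks"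

lemma lab_inj: "i \<in> ranks \<Longrightarrow> j \<in> ranks \<Longrightarrow> x \<in> M \<Longrightarrow> y \<in> M \<Longrightarrow> lab i x = lab j y \<Longrightarrow> i = j"
  by (metis rk_lab)

lemma lab_conn: "x \<in> M \<Longrightarrow> i \<in> ranks \<Longrightarrow> conn r I x y \<Longrightarrow> I \<subseteq> C - {i} \<Longrightarrow> lab i x = lab i y"
  by (metis lab_eq_iff conn_mono conn_closed Diff_subset subset_trans)

lemma lab_step: "x \<in> M \<Longrightarrow> i \<in> ranks \<Longrightarrow> j \<in> C \<Longrightarrow> i \<noteq> j \<Longrightarrow> lab i (r j x) = lab i x"
  using lab_conn[of x i "{j}" "r j x"] conn_single[of j "{j}" r x] by auto

lemma Field_P: "Field P = {lab i x | i x. i \<in> ranks \<and> x \<in> M}"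
  unfolding Field_def P_def by fastforce

lemma P_I: "i \<in> ranks \<Longrightarrow> j \<in> ranks \<Longrightarrow> i \<le> j \<Longrightarrow> x \<in> M \<Longrightarrow> (lab i x, lab j x) \<in> P"
  unfolding P_def by blast

lemma P_D:
  assumes "(F, G) \<in> P"
  obtains x where "x \<in> M" "rk F \<in> ranks" "rk G \<in> ranks" "rk F \<le> rk G" "F = lab (rk F) x" "G = lab (rk G) x"
  using assms unfolding P_def by (auto simp: rk_lab)

lemma P_same_rank: "(F, G) \<in> P \<Longrightarrow> rk F = rk G \<Longrightarrow> F = G"
  by (metis P_D)

text \<open>A path from \<open>x\<close> to \<open>y\<close> avoiding colour \<open>j\<close> sorts
  into an upper part, which keeps all faces of rank at most \<open>j\<close>, and a lower part,
  which keeps all faces of rank at least \<open>j\<close>. The turning point is the mixed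
  flag.\<close>

lemma glue:
  assumes x: "x \<in> M" and y: "y \<in> M" and j: "j \<in> ranks" and e: "lab j x = lab j y"
  obtains z where "z \<in> M" "\<And>i. i \<in> ranks \<Longrightarrow> i \<le> j \<Longrightarrow> lab i z = lab i x"
    "\<And>i. i \<in> ranks \<Longrightarrow> j \<le> i \<Longrightarrow> lab i z = lab i y"
proof -
  have "conn r (C - {j}) x y" using e lab_eq_iff x y j by simp
  then obtain z where z: "z \<in> M" "conn r ({j+1..<int D} \<inter> C) x z" "conn r ({0..<j} \<inter> C) z y"
    using conn_split_rank' x by metis
  show ?thesis
  proof
    show "z \<in> M" by fact
    fix i assume i: "i \<in> ranks"
    show "lab i z = lab i x" if "i \<le> j"
      by (rule sym, rule lab_conn[OF x i z(2)]) (use that in auto)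
    show "lab i z = lab i y" if "j \<le> i"
      by (rule lab_conn[OF z(1) i z(3)]) (use that in auto)
  qed
qed

lemma P_trans: assumes "(F, G) \<in> P" "(G, H) \<in> P"
  shows "\<exists>z\<in>M. F = lab (rk F) z \<and> G = lab (rk G) z \<and> H = lab (rk H) z"
proof -
  obtain x where x: "x \<in> M" "rk F \<in> ranks" "rk G \<in> ranks" "rk F \<le> rk G" "F = lab (rk F) x" "G = lab (rk G) x"
    using P_D[OF assms(1)] .
  obtain y where y: "y \<in> M" "rk G \<in> ranks" "rk H \<in> ranks" "rk G \<le> rk H" "G = lab (rk G) y" "H = lab (rk H) y"
    using P_D[OF assms(2)] .
  obtain z where z: "z \<in> M" "\<And>i. i \<in> ranks \<Longrightarrow> i \<le> rk G \<Longrightarrow> lab i z = lab i x"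
    "\<And>i. i \<in> ranks \<Longrightarrow> rk G \<le> i \<Longrightarrow> lab i z = lab i y"
    using glue[OF x(1) y(1) x(3)] x(6) y(5) by metis
  show ?thesis using z x y by (metis order_refl)
qed

lemma partial_order_P: "Partial_order P"
proof -
  have "refl_on (Field P) P" unfolding refl_on_def Field_P using P_I by auto
  moreover have "P \<subseteq> Field P \<times> Field P" unfolding Field_def by auto
  moreover have "trans P"
  proof (rule transI)
    fix F G H assume a: "(F, G) \<in> P" "(G, H) \<in> P"
    then obtain z where "z \<in> M" "F = lab (rk F) z" "H = lab (rk H) z" using P_trans by blast
    moreover have "rk F \<in> ranks" "rk H \<in> ranks" "rk F \<le> rk H" using a by (metis P_D order_trans)+
    ultimately show "(F, H) \<in> P" using P_I by metis
  qed
  moreover have "antisym P"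
    by (rule antisymI) (metis P_D P_same_rank order_antisym)
  ultimately show ?thesis by (simp add: partial_order_on_def preorder_on_def)
qed

text \<open>Flags are glued from the lowest rank upwards: the flag built so far and a flag through
  the last treated face and the next one agree in the last treated face.\<close>

lemma chain_flag:
  assumes "finite S" "S \<subseteq> Field P" "\<And>F G. F \<in> S \<Longrightarrow> G \<in> S \<Longrightarrow> (F, G) \<in> P \<or> (G, F) \<in> P"
  shows "\<exists>x\<in>M. \<forall>F\<in>S. F = lab (rk F) x"
proof -
  have *: "finite N \<Longrightarrow> N \<subseteq> rk ` S \<Longrightarrow> \<exists>x\<in>M. \<forall>F\<in>S. rk F \<in> N \<longrightarrow> F = lab (rk F) x" for N
  proof (induction N rule: finite_linorder_max_induct)
    case empty
    then show ?case using nonempty by auto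
  next
    case (insert b N)
    then obtain x where x: "x \<in> M" "\<forall>F\<in>S. rk F \<in> N \<longrightarrow> F = lab (rk F) x" by auto
    obtain G where G: "G \<in> S" "rk G = b" using insert by auto
    have GF: "G \<in> Field P" using G assms by blast
    then obtain y0 where y0: "y0 \<in> M" "G = lab b y0" "b \<in> ranks" using G unfolding Field_P by (auto simp: rk_lab)
    have uniq: "F = G" if "F \<in> S" "rk F = b" for F using assms(3)[of F G] that G P_same_rank by metis
    show ?case
    proof (cases "N = {}")
      case True
      then show ?thesis using y0 uniq by auto
    next
      case False
      define a where "a = Max N"
      have a: "a \<in> N" "\<And>a'. a' \<in> N \<Longrightarrow> a' \<le> a" using False insert by (auto simp: a_def)
      obtain H where H: "H \<in> S" "rk H = a" using insert a by auto
      have ab: "a < b" using a insert by auto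
      have Hx: "H = lab a x" using x H a by auto
      have "(H, G) \<in> P" using assms(3)[of H G] H G ab by (metis P_D not_le)
      then obtain y where y: "y \<in> M" "H = lab a y" "G = lab b y" "a \<in> ranks" using H G by (metis P_D)
      obtain z where z: "z \<in> M" "\<And>i. i \<in> ranks \<Longrightarrow> i \<le> a \<Longrightarrow> lab i z = lab i x"
        "\<And>i. i \<in> ranks \<Longrightarrow> a \<le> i \<Longrightarrow> lab i z = lab i y"
        using glue[OF x(1) y(1) y(4)] Hx y by metis
      have "F = lab (rk F) z" if "F \<in> S" "rk F \<in> insert b N" for F
      proof (cases "rk F = b")
        case True
        then show ?thesis using uniq that y z y0 ab by auto
      next
        case False
        then have "rk F \<in> N" using that by auto
        moreover have "rk F \<in> ranks" using that(1) assms(2) unfolding Field_P by (auto simp: rk_lab)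
        ultimately show ?thesis using x z a that by metis
      qed
      then show ?thesis using z by blast
    qed
  qed
  show ?thesis using *[of "rk ` S"] assms(1) by auto
qed

lemma rk_inj_fl: "x \<in> M \<Longrightarrow> inj_on (\<lambda>i. lab i x) ranks"
  by (rule inj_onI) (metis lab_inj)

lemma card_fl: "x \<in> M \<Longrightarrow> card (fl x) = D + 2"
  unfolding fl_def by (simp add: card_image rk_inj_fl)

lemma finite_chain:
  assumes "S \<subseteq> Field P" "\<And>F G. F \<in> S \<Longrightarrow> G \<in> S \<Longrightarrow> (F, G) \<in> P \<or> (G, F) \<in> P"
  shows "finite S"
proof (rule inj_on_finite[of rk _ ranks])
  show "inj_on rk S" using assms P_same_rank by (metis inj_onI)
  show "rk ` S \<subseteq> ranks" using assms unfolding Field_P by (auto simp: rk_lab)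
qed simp

lemma chain_iff: "pred_on.chain (Field P) (\<lambda>F G. (F, G) \<in> P) S \<longleftrightarrow>
   S \<subseteq> Field P \<and> (\<forall>F\<in>S. \<forall>G\<in>S. (F, G) \<in> P \<or> (G, F) \<in> P)"
proof -
  have "(F, F) \<in> P" if "F \<in> Field P" for F using that P_I unfolding Field_P by auto
  then show ?thesis unfolding pred_on.chain_def by auto
qed

text \<open>Every chain lies in some \<open>fl x\<close>, and all the \<open>fl x\<close> have the
  same number of faces, so none of them can be enlarged.\<close>

lemma flags_P: "flags P = fl ` M"
proof (intro equalityI subsetI)
  have fl_chain: "pred_on.chain (Field P) (\<lambda>F G. (F, G) \<in> P) (fl x)" if "x \<in> M" for x
  proof -
    have "fl x \<subseteq> Field P" unfolding fl_def Field_P using that by blast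
    moreover have "(lab i x, lab j x) \<in> P \<or> (lab j x, lab i x) \<in> P" if "i \<in> ranks" "j \<in> ranks" for i j
      using P_I[of i j x] P_I[of j i x] that \<open>x \<in> M\<close> by linarith
    ultimately show ?thesis unfolding chain_iff fl_def by blast
  qed
  have sub: "\<exists>x\<in>M. S \<subseteq> fl x" if "pred_on.chain (Field P) (\<lambda>F G. (F, G) \<in> P) S" for S
  proof -
    have S: "S \<subseteq> Field P" "\<And>F G. F \<in> S \<Longrightarrow> G \<in> S \<Longrightarrow> (F, G) \<in> P \<or> (G, F) \<in> P" using that chain_iff by auto
    obtain x where "x \<in> M" "\<forall>F\<in>S. F = lab (rk F) x" using chain_flag[OF finite_chain S] S by blast
    moreover have "\<forall>F\<in>S. rk F \<in> ranks" using S(1) unfolding Field_P by (auto simp: rk_lab)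
    ultimately show ?thesis unfolding fl_def by blast
  qed
  fix \<Phi>
  show "\<Phi> \<in> fl ` M" if "\<Phi> \<in> flags P"
  proof -
    have m: "pred_on.maxchain (Field P) (\<lambda>F G. (F, G) \<in> P) \<Phi>" using that by (simp add: flags_def)
    then have c: "pred_on.chain (Field P) (\<lambda>F G. (F, G) \<in> P) \<Phi>"
      and max: "\<And>S. pred_on.chain (Field P) (\<lambda>F G. (F, G) \<in> P) S \<Longrightarrow> \<not> \<Phi> \<subset> S"
      by (auto simp: pred_on.maxchain_def)
    from sub[OF c] obtain x where x: "x \<in> M" "\<Phi> \<subseteq> fl x" by blast
    with max[OF fl_chain[OF x(1)]] show ?thesis by blast
  qed
  show "\<Phi> \<in> flags P" if img: "\<Phi> \<in> fl ` M"
  proof -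
    obtain x where x: "x \<in> M" "\<Phi> = fl x" using img by blast
    have "\<not> fl x \<subset> S" if S: "pred_on.chain (Field P) (\<lambda>F G. (F, G) \<in> P) S" for S
    proof
      assume a: "fl x \<subset> S"
      obtain y where y: "y \<in> M" "S \<subseteq> fl y" using sub[OF S] by blast
      then have "fl x \<subset> fl y" using a by blast
      then have "card (fl x) < card (fl y)" by (simp add: fl_def psubset_card_mono)
      then show False using card_fl x y by simp
    qed
    then have "pred_on.maxchain (Field P) (\<lambda>F G. (F, G) \<in> P) (fl x)"
      using fl_chain[OF x(1)] by (simp add: pred_on.maxchain_def)
    then show ?thesis using x by (simp add: flags_def)
  qed
qed
lemma fl_mem: "x \<in> M \<Longrightarrow> F \<in> fl x \<Longrightarrow> F = lab (rk F) x \<and> rk F \<in> ranks"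
  unfolding fl_def by (auto simp: rk_lab)

lemma fl_inter:
  assumes "x \<in> M" "y \<in> M" "i \<in> ranks"
  shows "lab i x \<in> fl y \<longleftrightarrow> lab i x = lab i y"
  unfolding fl_def using lab_inj[OF assms(3) _ assms(1,2)] assms(3) by fastforce

text \<open>The intersection property enters here. Sharing the \<open>i\<close>-face means being
  joined without colour \<open>i\<close>, for one colour at a time; \<open>conn_Diff\<close> removes
  all these colours simultaneously. With \<open>I\<close> empty it shows that a flag is determined
  by its faces.\<close>

lemma conn_if_lab:
  assumes "x \<in> M" "y \<in> M" "\<And>i. i \<in> C - I \<Longrightarrow> lab i x = lab i y"
  shows "conn r (C \<inter> I) x y"
proof -
  have "conn r (C - (C - I)) x y"
    by (rule conn_Diff) (use assms lab_eq_iff in auto)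
  moreover have "C - (C - I) = C \<inter> I" by auto
  ultimately show ?thesis by simp
qed

lemma inj_fl: "inj_on fl M"
proof (rule inj_onI)
  fix x y assume a: "x \<in> M" "y \<in> M" "fl x = fl y"
  have "lab i x = lab i y" if "i \<in> C" for i
    using fl_inter[of x y i] a that by (auto simp: fl_def)
  then have "conn r (C \<inter> {}) x y" using a by (intro conn_if_lab) auto
  then show "x = y" by (simp add: conn_def)
qed

lemma lab_step_neq: assumes "x \<in> M" "i \<in> C" shows "lab i (r i x) \<noteq> lab i x"
proof
  assume e: "lab i (r i x) = lab i x"
  have "lab j (r i x) = lab j x" if "j \<in> C" for j
    using lab_step[of x j i] assms that e by (cases "i = j") auto
  then have "conn r (C \<inter> {}) (r i x) x" using assms closed by (intro conn_if_lab) auto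
  then show False using nofix[OF assms(2,1)] by (simp add: conn_def)
qed

lemma step_if_lab:
  assumes "x \<in> M" "y \<in> M" "i \<in> C" "\<And>j. j \<in> C \<Longrightarrow> j \<noteq> i \<Longrightarrow> lab j x = lab j y"
  shows "y = x \<or> y = r i x"
proof -
  have "conn r (C \<inter> {i}) x y" using assms by (intro conn_if_lab) auto
  then show ?thesis
    by (induction rule: conn_induct) (use assms invol in auto)
qed

lemma fl_step_faces:
  assumes "x \<in> M" "i \<in> C" shows "{F \<in> fl (r i x). rk F \<noteq> i} = {F \<in> fl x. rk F \<noteq> i}"
proof -
  have "{F \<in> fl y. rk F \<noteq> i} = (\<lambda>j. lab j y) ` (ranks - {i})" if "y \<in> M" for y
    unfolding fl_def using that by (auto simp: rk_lab)
  moreover have "(\<lambda>j. lab j (r i x)) ` (ranks - {i}) = (\<lambda>j. lab j x) ` (ranks - {i})"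
    by (rule image_cong) (use lab_step assms in auto)
  ultimately show ?thesis using assms closed by simp
qed

lemma i_adjacent_iff:
  assumes "x \<in> M" "y \<in> M" "i \<in> C"
  shows "i_adjacent P rk i (fl x) (fl y) \<longleftrightarrow> y = r i x"
proof
  assume y: "y = r i x"
  have "fl x \<noteq> fl (r i x)" using inj_fl assms nofix closed by (metis inj_onD)
  then show "i_adjacent P rk i (fl x) (fl y)"
    unfolding i_adjacent_def flags_P using assms y fl_step_faces by simp
next
  assume a: "i_adjacent P rk i (fl x) (fl y)"
  have "lab j x = lab j y" if "j \<in> C" "j \<noteq> i" for j
  proof -
    have "lab j x \<in> {F \<in> fl x. rk F \<noteq> i}" using that assms by (auto simp: fl_def rk_lab)
    then have "lab j x \<in> fl y" using a unfolding i_adjacent_def by blast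
    then show ?thesis using fl_inter assms that by auto
  qed
  then have "y = x \<or> y = r i x" using step_if_lab assms by blast
  then show "y = r i x" using a unfolding i_adjacent_def by auto
qed

lemma adjacent_iff:
  assumes "x \<in> M" "y \<in> M"
  shows "adjacent D P rk (fl x) (fl y) \<longleftrightarrow> (\<exists>i\<in>C. y = r i x)"
  unfolding adjacent_def using i_adjacent_iff assms by auto

lemma connected_P: "strongly_flag_connected D P rk"
  unfolding strongly_flag_connected_def
proof (intro ballI)
  fix \<Phi> \<Psi> assume "\<Phi> \<in> flags P" "\<Psi> \<in> flags P"
  then obtain x y where x: "x \<in> M" "\<Phi> = fl x" and y: "y \<in> M" "\<Psi> = fl y" using flags_P by auto
  \<comment> \<open>Only the ranks in which \<open>x\<close> and \<open>y\<close> differ are used as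
    colours, so no flag on the path loses a face common to both.\<close>
  define I where "I = {i \<in> C. lab i x \<noteq> lab i y}"
  let ?R = "\<lambda>X Y. adjacent D P rk X Y \<and> \<Phi> \<inter> \<Psi> \<subseteq> X \<and> \<Phi> \<inter> \<Psi> \<subseteq> Y"
  have "conn r (C \<inter> I) x y" by (rule conn_if_lab) (use x y in \<open>auto simp: I_def\<close>)
  moreover have "C \<inter> I = I" by (auto simp: I_def)
  ultimately have "conn r I x y" by simp
  then have "?R\<^sup>*\<^sup>* (fl x) (fl y) \<and> y \<in> M \<and> \<Phi> \<inter> \<Psi> \<subseteq> fl y"
  proof (induction rule: conn_induct)
    case refl
    then show ?case using x by auto
  next
    case (step z i)
    have z: "z \<in> M" "i \<in> C" "lab i x \<noteq> lab i y" using step by (auto simp: I_def)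
    have "\<Phi> \<inter> \<Psi> \<subseteq> fl (r i z)"
    proof
      fix F assume F: "F \<in> \<Phi> \<inter> \<Psi>"
      have "rk F \<noteq> i"
      proof
        assume "rk F = i"
        then have "F = lab i x" "F = lab i y" using F x y fl_mem by auto
        then show False using z by simp
      qed
      moreover have "F \<in> fl z" using F step by blast
      ultimately show "F \<in> fl (r i z)" using fl_step_faces z by blast
    qed
    moreover have "adjacent D P rk (fl z) (fl (r i z))" using adjacent_iff z closed by blast
    ultimately have "?R (fl z) (fl (r i z))" using step by blast
    then have "?R\<^sup>*\<^sup>* (fl x) (fl (r i z))" by (rule rtranclp.rtrancl_into_rtrancl[rotated]) (use step in blast)
    then show ?case using z closed[of i z] \<open>\<Phi> \<inter> \<Psi> \<subseteq> fl (r i z)\<close> by blast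
  qed
  then show "?R\<^sup>*\<^sup>* \<Phi> \<Psi>" using x y by simp
qed

lemma interval_lab:
  assumes "x \<in> M" "i \<in> ranks" "j \<in> ranks" "H \<in> interval P (lab i x) (lab j x)"
  obtains z where "z \<in> M" "lab i z = lab i x" "lab j z = lab j x" "H = lab (rk H) z" "rk H \<in> {i..j}"
proof -
  have a: "(lab i x, H) \<in> P" "(H, lab j x) \<in> P" using assms by (auto simp: interval_def)
  then obtain z where z: "z \<in> M" "lab i x = lab i z" "H = lab (rk H) z" "lab j x = lab j z"
    using P_trans[OF a] rk_lab assms by metis
  moreover have "rk H \<in> {i..j}" using a assms rk_lab by (metis P_D atLeastAtMost_iff)
  ultimately show ?thesis using that by metis
qed

lemma diamond_P:
  assumes "(F, G) \<in> P" "rk G - rk F = 2"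
  shows "card (interval P F G - {F, G}) = 2"
proof -
  obtain x where x: "x \<in> M" "rk F \<in> ranks" "rk G \<in> ranks" "F = lab (rk F) x" "G = lab (rk G) x"
    using assms(1) P_D by metis
  define i where "i = rk F + 1"
  have i: "rk F = i - 1" "rk G = i + 1" "i \<in> C" using assms x by (auto simp: i_def)
  have FG: "F = lab (i - 1) x" "G = lab (i + 1) x" using x i by auto
  have rx: "r i x \<in> M" using closed x i by blast
  have "interval P F G - {F, G} = {lab i x, lab i (r i x)}"
  proof (intro equalityI subsetI)
    fix H assume H: "H \<in> interval P F G - {F, G}"
    then obtain z where z: "z \<in> M" "lab (i-1) z = lab (i-1) x" "lab (i+1) z = lab (i+1) x" "H = lab (rk H) z" "rk H \<in> {i-1..i+1}"
      using interval_lab[of x "i-1" "i+1" H] FG x i by auto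
    have "H \<noteq> F" "H \<noteq> G" using H by auto
    then have "rk H \<noteq> i - 1" "rk H \<noteq> i + 1" using z FG by metis+
    then have rH: "rk H = i" using z by auto
    \<comment> \<open>The faces of \<open>z\<close> between ranks \<open>i - 1\<close> and
      \<open>i + 1\<close> are spliced into \<open>x\<close>. The resulting flag \<open>v\<close>
      contains \<open>H\<close> and differs from \<open>x\<close> at most in rank \<open>i\<close>,
      so it is \<open>x\<close> or \<open>r i x\<close>.\<close>
    obtain u where u: "u \<in> M" "\<And>j. j \<in> ranks \<Longrightarrow> j \<le> i - 1 \<Longrightarrow> lab j u = lab j x"
      "\<And>j. j \<in> ranks \<Longrightarrow> i - 1 \<le> j \<Longrightarrow> lab j u = lab j z"
      by (rule glue[of x z "i - 1"]) (use z x i in auto)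
    obtain v where v: "v \<in> M" "\<And>j. j \<in> ranks \<Longrightarrow> j \<le> i + 1 \<Longrightarrow> lab j v = lab j u"
      "\<And>j. j \<in> ranks \<Longrightarrow> i + 1 \<le> j \<Longrightarrow> lab j v = lab j x"
      by (rule glue[of u x "i + 1"]) (use z u x i in auto)
    have "v = x \<or> v = r i x"
    proof (rule step_if_lab)
      fix j assume j: "j \<in> C" "j \<noteq> i"
      show "lab j x = lab j v"
        by (cases "j \<le> i - 1") (use u v j in auto)
    qed (use x v i in auto)
    moreover have "lab i v = H" using v u z rH i by auto
    ultimately show "H \<in> {lab i x, lab i (r i x)}" by auto
  next
    have c: "lab (i-1) (r i x) = lab (i-1) x" "lab (i+1) (r i x) = lab (i+1) x"
      using lab_step x i by auto
    have "lab i y \<in> interval P F G - {F, G}" if "y \<in> M" "lab (i-1) y = lab (i-1) x" "lab (i+1) y = lab (i+1) x" for y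
    proof -
      have "(F, lab i y) \<in> P" using P_I[of "i-1" i y] that i FG by auto
      moreover have "(lab i y, G) \<in> P" using P_I[of i "i+1" y] that i FG by auto
      moreover have "rk (lab i y) = i" using that i by (simp add: rk_lab)
      ultimately show ?thesis using i by (auto simp: interval_def)
    qed
    then show "H \<in> interval P F G - {F, G}" if "H \<in> {lab i x, lab i (r i x)}" for H
      using that x rx c by auto
  qed
  moreover have "lab i x \<noteq> lab i (r i x)" using lab_step_neq[of x i] x i by metis
  ultimately show ?thesis by simp
qed

theorem abstract_polytope_P: "abstract_polytope D P rk"
proof
  show "Partial_order P" by (rule partial_order_P)
  show "rk F < rk G" if "(F, G) \<in> P" "F \<noteq> G" for F G
    using that P_D P_same_rank by (metis order_le_less)
  show "rk G = rk F + 1" if a: "(F, G) \<in> P" "F \<noteq> G" "interval P F G = {F, G}" for F G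
  proof (rule ccontr)
    assume ne: "rk G \<noteq> rk F + 1"
    obtain x where x: "x \<in> M" "rk F \<in> ranks" "rk G \<in> ranks" "rk F \<le> rk G" "F = lab (rk F) x" "G = lab (rk G) x"
      using a(1) P_D by metis
    have "rk F \<noteq> rk G" using a P_same_rank by blast
    then have lt: "rk F + 1 < rk G" using x ne by auto
    then have "(F, lab (rk F + 1) x) \<in> P" "(lab (rk F + 1) x, G) \<in> P"
      using P_I[of "rk F" "rk F + 1" x] P_I[of "rk F + 1" "rk G" x] x by auto
    then have "lab (rk F + 1) x \<in> {F, G}" using a by (auto simp: interval_def)
    moreover have "rk (lab (rk F + 1) x) = rk F + 1" using x lt by (intro rk_lab) auto
    ultimately show False using lt by auto
  qed
  obtain x where x: "x \<in> M" using nonempty by blast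
  \<comment> \<open>Removing colour -1 or \<open>D\<close> removes nothing, so connectedness leaves
    a single face in each of these ranks.\<close>
  have all: "lab i x = lab i y" if "i = -1 \<or> i = int D" "y \<in> M" for i y
    using that x connected[of x y] lab_conn[of x i C y] by auto
  show "\<exists>E\<in>Field P. rk E = -1 \<and> (\<forall>F\<in>Field P. (E, F) \<in> P)"
  proof (intro bexI conjI ballI)
    show "lab (-1) x \<in> Field P" "rk (lab (-1) x) = -1"
      using x P_I[of "-1" "-1" x] by (auto simp: Field_def rk_lab)
    fix F assume "F \<in> Field P"
    then obtain i y where "i \<in> ranks" "y \<in> M" "F = lab i y" unfolding Field_P by blast
    then show "(lab (-1) x, F) \<in> P" using all[of "-1" y] P_I[of "-1" i y] by auto
  qed
  show "\<exists>E\<in>Field P. rk E = int D \<and> (\<forall>F\<in>Field P. (F, E) \<in> P)"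
  proof (intro bexI conjI ballI)
    show "lab (int D) x \<in> Field P" "rk (lab (int D) x) = int D"
      using x P_I[of "int D" "int D" x] by (auto simp: Field_def rk_lab)
    fix F assume "F \<in> Field P"
    then obtain i y where "i \<in> ranks" "y \<in> M" "F = lab i y" unfolding Field_P by blast
    then show "(F, lab (int D) x) \<in> P" using all[of "int D" y] P_I[of i "int D" y] by auto
  qed
  show "card \<Phi> = D + 2" if "\<Phi> \<in> flags P" for \<Phi> using that flags_P card_fl by auto
  show "card (interval P F G - {F, G}) = 2" if "(F, G) \<in> P" "rk G - rk F = 2" for F G
    using diamond_P that by blast
  show "strongly_flag_connected D P rk" by (rule connected_P)
qed

end

section \<open>Flags and automorphisms of abstract polytopes\<close>

lemma poset_iso_comp:
  assumes "poset_iso r s f" "poset_iso s t g"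
  shows "poset_iso r t (g \<circ> f)"
proof -
  have f: "bij_betw f (Field r) (Field s)" and g: "bij_betw g (Field s) (Field t)"
    using assms by (auto simp: poset_iso_def)
  have "f F \<in> Field s" if "F \<in> Field r" for F using f that by (rule bij_betw_apply)
  then show ?thesis using assms bij_betw_trans[OF f g] by (simp add: poset_iso_def)
qed

lemma poset_iso_inv:
  assumes "poset_iso r s f"
  shows "poset_iso s r (inv_into (Field r) f)"
proof -
  let ?g = "inv_into (Field r) f"
  have f: "bij_betw f (Field r) (Field s)" using assms by (auto simp: poset_iso_def)
  then have g: "bij_betw ?g (Field s) (Field r)" by (rule bij_betw_inv_into)
  have "f (?g F) = F" "?g F \<in> Field r" if "F \<in> Field s" for F
    using f g that by (simp_all add: bij_betw_inv_into_right bij_betw_apply)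
  then show ?thesis using assms g by (simp add: poset_iso_def)
qed

lemma automorphism_id: "automorphism r id"
  by (simp add: poset_iso_def)

lemma flag_orbit_self: "\<Phi> \<in> flag_orbit r \<Phi>"
  unfolding flag_orbit_def using automorphism_id[of r] by (metis (mono_tags, lifting) image_id mem_Collect_eq id_apply)

lemma flag_orbit_subset:
  assumes "\<Psi> \<in> flag_orbit r \<Phi>" shows "flag_orbit r \<Psi> \<subseteq> flag_orbit r \<Phi>"
proof
  fix X assume "X \<in> flag_orbit r \<Psi>"
  then obtain g where g: "automorphism r g" "X = g ` \<Psi>" unfolding flag_orbit_def by blast
  obtain f where f: "automorphism r f" "\<Psi> = f ` \<Phi>" using assms unfolding flag_orbit_def by blast
  have "X = (g \<circ> f) ` \<Phi>" using f g by (simp add: image_comp)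
  then show "X \<in> flag_orbit r \<Phi>" unfolding flag_orbit_def using poset_iso_comp[OF f(1) g(1)] by blast
qed

lemma flag_orbit_sym:
  assumes "\<Psi> \<in> flag_orbit r \<Phi>" "\<Phi> \<subseteq> Field r" shows "\<Phi> \<in> flag_orbit r \<Psi>"
proof -
  obtain f where f: "automorphism r f" "\<Psi> = f ` \<Phi>" using assms unfolding flag_orbit_def by blast
  have "inj_on f (Field r)" using f by (auto simp: poset_iso_def bij_betw_def)
  then have "inv_into (Field r) f ` \<Psi> = \<Phi>" using f(2) assms(2) by simp
  then show ?thesis unfolding flag_orbit_def using poset_iso_inv[OF f(1)] by blast
qed

lemma flag_orbit_eq:
  assumes "\<Psi> \<in> flag_orbit r \<Phi>" "\<Phi> \<subseteq> Field r" shows "flag_orbit r \<Psi> = flag_orbit r \<Phi>"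
  using flag_orbit_subset[OF assms(1)] flag_orbit_subset[OF flag_orbit_sym[OF assms]] by blast

section \<open>Faces of a flag by rank, and the adjacency involutions\<close>

context abstract_polytope
begin

abbreviation "ranks \<equiv> {-1..int d}"

definition chain :: "'a set \<Rightarrow> bool" where
  "chain S \<longleftrightarrow> S \<subseteq> Field r \<and> (\<forall>F\<in>S. \<forall>G\<in>S. (F, G) \<in> r \<or> (G, F) \<in> r)"

lemma r_refl: "F \<in> Field r \<Longrightarrow> (F, F) \<in> r"
  using partial_order by (simp add: partial_order_on_def preorder_on_def refl_on_def)

lemma r_trans: "(F, G) \<in> r \<Longrightarrow> (G, H) \<in> r \<Longrightarrow> (F, H) \<in> r"
  using partial_order unfolding partial_order_on_def preorder_on_def by (meson transD)

lemma r_Field: "(F, G) \<in> r \<Longrightarrow> F \<in> Field r \<and> G \<in> Field r"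
  by (auto simp: Field_def)

lemma r_rk: "(F, G) \<in> r \<Longrightarrow> rk F \<le> rk G"
  using rank_strict_mono by force

lemma r_rk_eq: "(F, G) \<in> r \<Longrightarrow> rk F = rk G \<Longrightarrow> F = G"
  using rank_strict_mono by force

lemma rk_range: assumes "F \<in> Field r" shows "rk F \<in> ranks"
proof -
  obtain E G where "rk E = -1" "(E, F) \<in> r" "rk G = int d" "(F, G) \<in> r"
    using least_face greatest_face assms by blast
  then show ?thesis using r_rk by fastforce
qed

lemma least_unique: "F \<in> Field r \<Longrightarrow> G \<in> Field r \<Longrightarrow> rk F = -1 \<Longrightarrow> rk G = -1 \<Longrightarrow> F = G"
  using least_face r_rk_eq by metis

lemma greatest_unique: "F \<in> Field r \<Longrightarrow> G \<in> Field r \<Longrightarrow> rk F = int d \<Longrightarrow> rk G = int d \<Longrightarrow> F = G"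
  using greatest_face r_rk_eq by metis

lemma rk_least: "F \<in> Field r \<Longrightarrow> G \<in> Field r \<Longrightarrow> rk F = -1 \<Longrightarrow> (F, G) \<in> r"
  using least_face least_unique by metis

lemma rk_greatest: "F \<in> Field r \<Longrightarrow> G \<in> Field r \<Longrightarrow> rk G = int d \<Longrightarrow> (F, G) \<in> r"
  using greatest_face greatest_unique by metis

lemma pred_chain_iff: "pred_on.chain (Field r) (\<lambda>F G. (F, G) \<in> r) S \<longleftrightarrow> chain S"
  unfolding chain_def pred_on.chain_def using r_refl by auto

lemma flags_iff: "\<Phi> \<in> flags r \<longleftrightarrow> chain \<Phi> \<and> (\<forall>S. chain S \<longrightarrow> \<not> \<Phi> \<subset> S)"
  unfolding flags_def pred_on.maxchain_def by (auto simp: pred_chain_iff)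

lemma chain_inj: "chain S \<Longrightarrow> inj_on rk S"
  unfolding chain_def by (rule inj_onI) (metis r_rk_eq)

lemma chain_rk: "chain S \<Longrightarrow> rk ` S \<subseteq> ranks"
  unfolding chain_def using rk_range by blast

lemma chain_finite: "chain S \<Longrightarrow> finite S"
  using inj_on_finite[OF chain_inj chain_rk] by simp

lemma chain_card: "chain S \<Longrightarrow> card S \<le> d + 2"
  using card_inj_on_le[OF chain_inj chain_rk, of S] by simp

lemma chain_card_flag: assumes "chain S" "card S = d + 2" shows "S \<in> flags r"
  unfolding flags_iff
proof (intro conjI allI impI notI)
  fix T assume T: "chain T" "S \<subset> T"
  then have "card S < card T" using chain_finite psubset_card_mono by blast
  then show False using chain_card[OF T(1)] assms by simp
qed (rule assms)

lemma ex_flag: assumes "chain S" shows "\<exists>\<Phi>\<in>flags r. S \<subseteq> \<Phi>"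
proof -
  have "\<exists>T. (chain T \<and> S \<subseteq> T) \<and> (\<forall>U. chain U \<and> S \<subseteq> U \<longrightarrow> card U \<le> card T)"
    by (rule ex_has_greatest_nat[of _ S _ "d + 3"]) (use assms chain_card in force)+
  then obtain T where T: "chain T" "S \<subseteq> T" "\<And>U. chain U \<Longrightarrow> S \<subseteq> U \<Longrightarrow> card U \<le> card T" by blast
  have "\<not> T \<subset> U" if "chain U" for U
    using T(2) T(3)[OF that] psubset_card_mono[OF chain_finite[OF that], of T] by force
  then show ?thesis using T flags_iff by blast
qed

lemma flag_chain: "\<Phi> \<in> flags r \<Longrightarrow> chain \<Phi>"
  by (simp add: flags_iff)

lemma flag_Field: "\<Phi> \<in> flags r \<Longrightarrow> \<Phi> \<subseteq> Field r"
  using flag_chain chain_def by blast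

lemma flag_rk: assumes "\<Phi> \<in> flags r" shows "bij_betw rk \<Phi> ranks"
proof -
  have c: "chain \<Phi>" using assms flag_chain by blast
  have "card (rk ` \<Phi>) = card ranks" using card_flag[OF assms] chain_inj[OF c] by (simp add: card_image)
  then have "rk ` \<Phi> = ranks" using card_subset_eq[OF _ chain_rk[OF c]] by simp
  then show ?thesis using chain_inj[OF c] by (simp add: bij_betw_def)
qed

definition fc :: "'a set \<Rightarrow> int \<Rightarrow> 'a" where "fc \<Phi> i = inv_into \<Phi> rk i"

lemma fc_mem: "\<Phi> \<in> flags r \<Longrightarrow> i \<in> ranks \<Longrightarrow> fc \<Phi> i \<in> \<Phi>"
  unfolding fc_def using flag_rk by (metis bij_betw_def inv_into_into)

lemma fc_Field: "\<Phi> \<in> flags r \<Longrightarrow> i \<in> ranks \<Longrightarrow> fc \<Phi> i \<in> Field r"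
  using fc_mem flag_Field by blast

lemma rk_fc: "\<Phi> \<in> flags r \<Longrightarrow> i \<in> ranks \<Longrightarrow> rk (fc \<Phi> i) = i"
  unfolding fc_def using flag_rk by (metis bij_betw_inv_into_right)

lemma fc_rk: "\<Phi> \<in> flags r \<Longrightarrow> F \<in> \<Phi> \<Longrightarrow> fc \<Phi> (rk F) = F"
  unfolding fc_def using flag_rk by (metis bij_betw_inv_into_left)

lemma fc_eqI: "\<Phi> \<in> flags r \<Longrightarrow> F \<in> \<Phi> \<Longrightarrow> rk F = i \<Longrightarrow> fc \<Phi> i = F"
  using fc_rk by blast

lemma flag_eq_fc: "\<Phi> \<in> flags r \<Longrightarrow> \<Phi> = fc \<Phi> ` ranks"
  using fc_mem fc_rk flag_Field rk_range by (auto simp: image_iff) (metis subsetD atLeastAtMost_iff)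

lemma fc_le: assumes "\<Phi> \<in> flags r" "i \<in> ranks" "j \<in> ranks" "i \<le> j" shows "(fc \<Phi> i, fc \<Phi> j) \<in> r"
proof -
  have "(fc \<Phi> i, fc \<Phi> j) \<in> r \<or> (fc \<Phi> j, fc \<Phi> i) \<in> r"
    using flag_chain[OF assms(1)] fc_mem assms unfolding chain_def by blast
  moreover have "i = j" if "(fc \<Phi> j, fc \<Phi> i) \<in> r" using r_rk[OF that] rk_fc assms by simp
  ultimately show ?thesis by blast
qed

lemma flag_eqI:
  assumes "\<Phi> \<in> flags r" "\<Psi> \<in> flags r" "\<And>i. i \<in> {0..<int d} \<Longrightarrow> fc \<Phi> i = fc \<Psi> i"
  shows "\<Phi> = \<Psi>"
proof -
  have "fc \<Phi> i = fc \<Psi> i" if i: "i \<in> ranks" for i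
  proof -
    consider "i = -1" | "i = int d" | "i \<in> {0..<int d}" using i by fastforce
    then show ?thesis
      using assms rk_fc[OF _ i] fc_Field[OF _ i] least_unique greatest_unique by cases auto
  qed
  then have "fc \<Phi> ` ranks = fc \<Psi> ` ranks" by (rule image_cong[OF refl])
  then show ?thesis using flag_eq_fc assms by metis
qed

text \<open>The tool for building flags: only consecutive incidences need checking, and a chain with
  one face in each rank already has the size of a flag.\<close>

lemma flagI:
  assumes "\<And>i. i \<in> ranks \<Longrightarrow> rk (s i) = i"
    and le: "\<And>i. -1 \<le> i \<Longrightarrow> i < int d \<Longrightarrow> (s i, s (i + 1)) \<in> r"
    and fld: "\<And>i. i \<in> ranks \<Longrightarrow> s i \<in> Field r"
  shows "s ` ranks \<in> flags r" and "\<And>i. i \<in> ranks \<Longrightarrow> fc (s ` ranks) i = s i"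
proof -
  have mono: "(s i, s j) \<in> r" if "i \<le> j" "-1 \<le> i" "j \<le> int d" for i j
    using that
  proof (induction j rule: int_ge_induct)
    case base
    then show ?case using fld r_refl by simp
  next
    case (step j)
    then show ?case using le[of j] r_trans[of "s i" "s j" "s (j + 1)"] by simp
  qed
  have "(s i, s j) \<in> r \<or> (s j, s i) \<in> r" if "i \<in> ranks" "j \<in> ranks" for i j
    using mono[of i j] mono[of j i] that by (cases "i \<le> j") auto
  then have "chain (s ` ranks)" unfolding chain_def using fld by blast
  moreover have "inj_on s ranks" by (rule inj_onI) (metis assms(1))
  then have "card (s ` ranks) = d + 2" by (simp add: card_image)
  ultimately show fl: "s ` ranks \<in> flags r" by (rule chain_card_flag)
  show "fc (s ` ranks) i = s i" if "i \<in> ranks" for i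
    by (rule fc_eqI[OF fl]) (use that assms in auto)
qed

lemma fc_between:
  assumes "\<Phi> \<in> flags r" "i \<in> {0..<int d}" 
  shows "fc \<Phi> i \<in> interval r (fc \<Phi> (i - 1)) (fc \<Phi> (i + 1)) - {fc \<Phi> (i - 1), fc \<Phi> (i + 1)}"
proof -
  have "rk (fc \<Phi> (i - 1)) = i - 1" "rk (fc \<Phi> i) = i" "rk (fc \<Phi> (i + 1)) = i + 1"
    using rk_fc assms by auto
  then have "fc \<Phi> i \<noteq> fc \<Phi> (i - 1)" "fc \<Phi> i \<noteq> fc \<Phi> (i + 1)" by fastforce+
  moreover have "(fc \<Phi> (i - 1), fc \<Phi> i) \<in> r" "(fc \<Phi> i, fc \<Phi> (i + 1)) \<in> r" using fc_le assms by auto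
  ultimately show ?thesis by (simp add: interval_def)
qed

lemma card_between:
  assumes "\<Phi> \<in> flags r" "i \<in> {0..<int d}" 
  shows "card (interval r (fc \<Phi> (i - 1)) (fc \<Phi> (i + 1)) - {fc \<Phi> (i - 1), fc \<Phi> (i + 1)}) = 2"
  by (rule diamond) (use assms fc_le rk_fc in auto)

lemma i_adjacent_fc:
  assumes "\<Phi> \<in> flags r" "\<Psi> \<in> flags r"
  shows "i_adjacent r rk i \<Phi> \<Psi> \<longleftrightarrow> \<Phi> \<noteq> \<Psi> \<and> (\<forall>j\<in>{0..<int d} - {i}. fc \<Phi> j = fc \<Psi> j)"
proof
  assume a: "i_adjacent r rk i \<Phi> \<Psi>"
  have "fc \<Phi> j = fc \<Psi> j" if j: "j \<in> {0..<int d} - {i}" for j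
  proof -
    have "fc \<Phi> j \<in> {F \<in> \<Phi>. rk F \<noteq> i}" using fc_mem rk_fc assms j by auto
    then have "fc \<Phi> j \<in> \<Psi>" using a unfolding i_adjacent_def by blast
    then show ?thesis using fc_eqI[of \<Psi> "fc \<Phi> j" j] assms j rk_fc by auto
  qed
  then show "\<Phi> \<noteq> \<Psi> \<and> (\<forall>j\<in>{0..<int d} - {i}. fc \<Phi> j = fc \<Psi> j)" using a i_adjacent_def by blast
next
  assume a: "\<Phi> \<noteq> \<Psi> \<and> (\<forall>j\<in>{0..<int d} - {i}. fc \<Phi> j = fc \<Psi> j)"
  have eq: "fc \<Phi> j = fc \<Psi> j" if j: "j \<in> ranks" "j \<noteq> i" for j
  proof -
    consider "j = -1" | "j = int d" | "j \<in> {0..<int d}" using j by fastforce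
    then show ?thesis
      using assms rk_fc[OF _ j(1)] fc_Field[OF _ j(1)] least_unique greatest_unique a j by cases auto
  qed
  have sub: "{F \<in> \<Phi>. rk F \<noteq> i} \<subseteq> {F \<in> \<Psi>. rk F \<noteq> i}"
    if "\<Phi> \<in> flags r" "\<Psi> \<in> flags r" "\<And>j. j \<in> ranks \<Longrightarrow> j \<noteq> i \<Longrightarrow> fc \<Phi> j = fc \<Psi> j" for \<Phi> \<Psi>
  proof
    fix F assume F: "F \<in> {F \<in> \<Phi>. rk F \<noteq> i}"
    then have "rk F \<in> ranks" using flag_Field that rk_range by blast
    then have "fc \<Psi> (rk F) = F" "fc \<Psi> (rk F) \<in> \<Psi>" using F that fc_rk[of \<Phi> F] fc_mem[of \<Psi> "rk F"] by auto
    then show "F \<in> {F \<in> \<Psi>. rk F \<noteq> i}" using F by auto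
  qed
  show "i_adjacent r rk i \<Phi> \<Psi>" unfolding i_adjacent_def
    using assms a sub[of \<Phi> \<Psi>] sub[of \<Psi> \<Phi>] eq by auto
qed

definition nb :: "int \<Rightarrow> 'a set \<Rightarrow> 'a set" where "nb i \<Phi> = (THE \<Psi>. i_adjacent r rk i \<Phi> \<Psi>)"

lemma ex1_adjacent:
  assumes \<Phi>: "\<Phi> \<in> flags r" and i: "i \<in> {0..<int d}"
  shows "\<exists>!\<Psi>. i_adjacent r rk i \<Phi> \<Psi>"
proof -
  \<comment> \<open>By the diamond condition \<open>B\<close> has two members, the
    \<open>i\<close>-face of \<open>\<Phi>\<close> and one other, \<open>H\<close>. The latter must
    be the \<open>i\<close>-face of any neighbour.\<close>
  define B where "B = interval r (fc \<Phi> (i - 1)) (fc \<Phi> (i + 1)) - {fc \<Phi> (i - 1), fc \<Phi> (i + 1)}"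
  have B: "card B = 2" using card_between assms unfolding B_def by blast
  have "fc \<Phi> i \<in> B" using fc_between assms unfolding B_def by blast
  then obtain H where H: "B = {fc \<Phi> i, H}" "H \<noteq> fc \<Phi> i" using B by (auto simp: card_2_iff)
  then have HB: "(fc \<Phi> (i - 1), H) \<in> r" "(H, fc \<Phi> (i + 1)) \<in> r" "H \<noteq> fc \<Phi> (i - 1)" "H \<noteq> fc \<Phi> (i + 1)"
    by (auto simp: B_def interval_def)
  then have rH: "rk H = i" using rank_strict_mono[OF HB(1)] rank_strict_mono[OF HB(2)] rk_fc \<Phi> i by fastforce
  let ?s = "(fc \<Phi>)(i := H)"
  have 1: "rk (?s j) = j" if "j \<in> ranks" for j using that rH rk_fc \<Phi> by simp
  have 2: "(?s j, ?s (j + 1)) \<in> r" if "-1 \<le> j" "j < int d" for j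
    using that HB fc_le[OF \<Phi>, of j "j + 1"] by auto
  have 3: "?s j \<in> Field r" if "j \<in> ranks" for j using that HB(1) r_Field fc_Field \<Phi> by simp
  note s = flagI[of ?s, OF 1 2 3]
  have "fc (?s ` ranks) i = H" using s(2)[of i] i by simp
  then have "i_adjacent r rk i \<Phi> (?s ` ranks)"
    using s H(2) i_adjacent_fc[OF \<Phi> s(1), of i] by auto
  moreover have "\<Psi> = \<Psi>'" if "i_adjacent r rk i \<Phi> \<Psi>" "i_adjacent r rk i \<Phi> \<Psi>'" for \<Psi> \<Psi>'
  proof -
    have f: "\<Psi> \<in> flags r" "\<Psi>' \<in> flags r" using that by (auto simp: i_adjacent_def)
    have H': "fc X i = H" if X: "X \<in> flags r" "i_adjacent r rk i \<Phi> X" for X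
    proof -
      have e: "fc \<Phi> j = fc X j" if "j \<in> {0..<int d} - {i}" for j using X i_adjacent_fc \<Phi> that by blast
      have e': "fc \<Phi> j = fc X j" if "j = i - 1 \<or> j = i + 1" for j
      proof -
        have j: "j \<in> ranks" "j \<noteq> i" using that i by auto
        consider "j = -1" | "j = int d" | "j \<in> {0..<int d}" using j by fastforce
        then show ?thesis
          using X \<Phi> rk_fc[OF _ j(1)] fc_Field[OF _ j(1)] least_unique greatest_unique e j by cases auto
      qed
      then have "fc X i \<in> B" using fc_between[OF X(1) i] unfolding B_def by auto
      moreover have "fc X i \<noteq> fc \<Phi> i"
      proof
        assume "fc X i = fc \<Phi> i"
        then have "\<Phi> = X" using flag_eqI[OF \<Phi> X(1)] e by (metis DiffI singletonD)
        then show False using X by (simp add: i_adjacent_def)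
      qed
      ultimately show ?thesis using H by auto
    qed
    show ?thesis
    proof (rule flag_eqI[OF f])
      fix j assume j: "j \<in> {0..<int d}"
      show "fc \<Psi> j = fc \<Psi>' j"
      proof (cases "j = i")
        case True
        then show ?thesis using H'[OF f(1) that(1)] H'[OF f(2) that(2)] by simp
      next
        case False
        then show ?thesis
          using that[unfolded i_adjacent_fc[OF \<Phi> f(1)] i_adjacent_fc[OF \<Phi> f(2)]] j by (metis DiffI singletonD)
      qed
    qed
  qed
  ultimately show ?thesis by blast
qed

lemma nb_adjacent: "\<Phi> \<in> flags r \<Longrightarrow> i \<in> {0..<int d} \<Longrightarrow> i_adjacent r rk i \<Phi> (nb i \<Phi>)"
  unfolding nb_def by (rule theI') (rule ex1_adjacent)

lemma nb_flag: "i \<in> {0..<int d} \<Longrightarrow> \<Phi> \<in> flags r \<Longrightarrow> nb i \<Phi> \<in> flags r"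
  using nb_adjacent by (simp add: i_adjacent_def)

lemma nb_neq: "i \<in> {0..<int d} \<Longrightarrow> \<Phi> \<in> flags r \<Longrightarrow> nb i \<Phi> \<noteq> \<Phi>"
  using nb_adjacent unfolding i_adjacent_def by metis

lemma nb_unique: "\<Phi> \<in> flags r \<Longrightarrow> i \<in> {0..<int d} \<Longrightarrow> i_adjacent r rk i \<Phi> \<Psi> \<Longrightarrow> \<Psi> = nb i \<Phi>"
  using ex1_adjacent nb_adjacent by blast

lemma fc_nb: "\<Phi> \<in> flags r \<Longrightarrow> i \<in> {0..<int d} \<Longrightarrow> j \<in> {0..<int d} \<Longrightarrow> j \<noteq> i \<Longrightarrow> fc (nb i \<Phi>) j = fc \<Phi> j"
  using nb_adjacent i_adjacent_fc nb_flag by (metis DiffI singletonD)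

lemma fc_nb_neq: assumes "\<Phi> \<in> flags r" "i \<in> {0..<int d}" shows "fc (nb i \<Phi>) i \<noteq> fc \<Phi> i"
proof
  assume e: "fc (nb i \<Phi>) i = fc \<Phi> i"
  have "nb i \<Phi> = \<Phi>"
  proof (rule flag_eqI)
    fix j assume "j \<in> {0..<int d}"
    then show "fc (nb i \<Phi>) j = fc \<Phi> j" using e fc_nb assms by (cases "j = i") auto
  qed (use assms nb_flag in auto)
  then show False using nb_neq assms by blast
qed

lemma nb_eqI:
  assumes "\<Phi> \<in> flags r" "i \<in> {0..<int d}" "\<Psi> \<in> flags r" "\<Psi> \<noteq> \<Phi>"
    "\<And>j. j \<in> {0..<int d} \<Longrightarrow> j \<noteq> i \<Longrightarrow> fc \<Psi> j = fc \<Phi> j"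
  shows "\<Psi> = nb i \<Phi>"
proof -
  have "i_adjacent r rk i \<Phi> \<Psi>" using assms i_adjacent_fc[OF assms(1,3)] by auto
  then show ?thesis using nb_unique assms by blast
qed

lemma nb_invol: assumes "i \<in> {0..<int d}" "\<Phi> \<in> flags r" shows "nb i (nb i \<Phi>) = \<Phi>"
proof -
  have "\<Phi> = nb i (nb i \<Phi>)"
    by (rule nb_eqI) (use assms nb_flag nb_neq[of i \<Phi>] fc_nb in auto)
  then show ?thesis by simp
qed

lemma nb_commute:
  assumes "0 \<le> i" "i + 2 \<le> j" "j < int d" "\<Phi> \<in> flags r"
  shows "nb i (nb j \<Phi>) = nb j (nb i \<Phi>)"
proof -
  have ij: "i \<in> {0..<int d}" "j \<in> {0..<int d}" using assms by auto
  define T where "T = nb j (nb i \<Phi>)"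
  have nT: "T \<in> flags r" "nb i \<Phi> \<in> flags r" "nb j \<Phi> \<in> flags r" using T_def nb_flag ij assms by auto
  have T: "fc T l = fc \<Phi> l" if l: "l \<in> ranks" "l \<noteq> i" "l \<noteq> j" for l
  proof -
    consider "l = -1" | "l = int d" | "l \<in> {0..<int d}" using l by fastforce
    then show ?thesis
    proof cases
      case 3
      then show ?thesis using l fc_nb nT ij assms(4) by (simp add: T_def)
    qed (use nT assms(4) rk_fc[OF _ l(1)] fc_Field[OF _ l(1)] least_unique greatest_unique in auto)
  qed
  \<comment> \<open>Neither \<open>j - 1\<close> nor \<open>j + 1\<close> is \<open>i\<close>, so
    \<open>T\<close> agrees with \<open>\<Phi>\<close> on both sides of rank \<open>j\<close>, and
    its \<open>j\<close>-face can replace that of \<open>\<Phi>\<close>. The flag obtained is the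
    \<open>j\<close>-neighbour of \<open>\<Phi>\<close>, and \<open>T\<close> is its
    \<open>i\<close>-neighbour.\<close>
  let ?s = "(fc \<Phi>)(j := fc T j)"
  have 1: "rk (?s l) = l" if "l \<in> ranks" for l using that rk_fc nT assms by simp
  have 2: "(?s l, ?s (l + 1)) \<in> r" if l: "-1 \<le> l" "l < int d" for l
    using l fc_le[OF assms(4), of l "l + 1"] fc_le[OF nT(1), of l "l + 1"] T[of "j - 1"] T[of "j + 1"] assms by auto
  have 3: "?s l \<in> Field r" if "l \<in> ranks" for l using that fc_Field nT assms by simp
  note s = flagI[of ?s, OF 1 2 3]
  have "fc T j \<noteq> fc (nb i \<Phi>) j" unfolding T_def using fc_nb_neq nT ij by blast
  then have "fc T j \<noteq> fc \<Phi> j" using fc_nb[of \<Phi> i j] ij assms by simp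
  then have "?s ` ranks \<noteq> \<Phi>" using s(2)[of j] assms by auto
  then have sj: "?s ` ranks = nb j \<Phi>"
    by (intro nb_eqI) (use assms s ij in auto)
  have "T = nb i (?s ` ranks)"
  proof (rule nb_eqI)
    have "fc T i = fc (nb i \<Phi>) i" unfolding T_def using fc_nb nT ij assms by simp
    then have "fc T i \<noteq> fc \<Phi> i" using fc_nb_neq ij assms by metis
    then show "T \<noteq> ?s ` ranks" using s(2)[of i] ij assms by auto
    show "fc T l = fc (?s ` ranks) l" if "l \<in> {0..<int d}" "l \<noteq> i" for l
      using s(2)[of l] that T[of l] by auto
  qed (use s ij nT in auto)
  then have "T = nb i (nb j \<Phi>)" by (simp only: sj)
  then show ?thesis by (simp add: T_def)
qed

lemma conn_fc:
  assumes "conn nb I \<Phi> \<Psi>" "I \<subseteq> {0..<int d}" "\<Phi> \<in> flags r"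
  shows "\<Psi> \<in> flags r" and "\<And>j. j \<in> {0..<int d} - I \<Longrightarrow> fc \<Psi> j = fc \<Phi> j"
proof -
  have "\<Psi> \<in> flags r \<and> (\<forall>j\<in>{0..<int d} - I. fc \<Psi> j = fc \<Phi> j)" using assms(1)
  proof (induction rule: conn_induct)
    case (step z i)
    then have i: "i \<in> {0..<int d}" using assms by blast
    have "fc (nb i z) j = fc z j" if "j \<in> {0..<int d} - I" for j
      using that step by (intro fc_nb) (use i in auto)
    then show ?case using step nb_flag i by auto
  qed (use assms in simp)
  then show "\<Psi> \<in> flags r" and "\<And>j. j \<in> {0..<int d} - I \<Longrightarrow> fc \<Psi> j = fc \<Phi> j" by auto
qed

lemma fc_conn:
  assumes "\<Phi> \<in> flags r" "\<Psi> \<in> flags r" "I \<subseteq> {0..<int d}" "\<And>j. j \<in> {0..<int d} - I \<Longrightarrow> fc \<Phi> j = fc \<Psi> j"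
  shows "conn nb I \<Phi> \<Psi>"
proof -
  have "(\<lambda>X Y. adjacent d r rk X Y \<and> \<Phi> \<inter> \<Psi> \<subseteq> X \<and> \<Phi> \<inter> \<Psi> \<subseteq> Y)\<^sup>*\<^sup>* \<Phi> \<Psi>"
    using strongly_flag_connected assms unfolding strongly_flag_connected_def by blast
  then show ?thesis
  proof (induction rule: rtranclp_induct)
    case (step Y Z)
    then obtain i where i: "i \<in> {0..<int d}" "i_adjacent r rk i Y Z" unfolding adjacent_def by blast
    then have f: "Y \<in> flags r" "Z \<in> flags r" by (auto simp: i_adjacent_def)
    then have Z: "Z = nb i Y" using nb_unique i by blast
    \<comment> \<open>A step of colour outside \<open>I\<close> would change a face common to
      \<open>\<Phi>\<close> and \<open>\<Psi>\<close>, but such faces are kept along the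
      path.\<close>
    have "i \<in> I"
    proof (rule ccontr)
      assume "i \<notin> I"
      then have "fc \<Phi> i \<in> \<Phi> \<inter> \<Psi>" using assms i fc_mem[of \<Phi> i] fc_mem[of \<Psi> i] by auto
      then have "fc \<Phi> i \<in> Y" "fc \<Phi> i \<in> Z" using step by auto
      then have "fc Y i = fc Z i" using fc_eqI[OF f(1)] fc_eqI[OF f(2)] rk_fc[OF assms(1)] i by simp
      then show False using fc_nb_neq f(1) i Z by metis
    qed
    then show ?case using step Z conn_step by metis
  qed simp
qed

section \<open>Automorphisms acting on flags\<close>

lemma iso_rk:
  assumes f: "automorphism r f" and F: "F \<in> Field r"
  shows "rk (f F) = rk F"
    and "\<And>\<Phi>. \<Phi> \<in> flags r \<Longrightarrow> f ` \<Phi> \<in> flags r"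
proof -
  have inj: "inj_on f (Field r)" and im: "\<And>F. F \<in> Field r \<Longrightarrow> f F \<in> Field r"
    and ord: "\<And>F G. F \<in> Field r \<Longrightarrow> G \<in> Field r \<Longrightarrow> (F, G) \<in> r \<longleftrightarrow> (f F, f G) \<in> r"
    using f bij_betw_apply by (auto simp: poset_iso_def bij_betw_def)
  show flag: "f ` \<Phi> \<in> flags r" if \<Phi>: "\<Phi> \<in> flags r" for \<Phi>
  proof (rule chain_card_flag)
    show "chain (f ` \<Phi>)" using flag_chain[OF \<Phi>] im ord unfolding chain_def by blast
    show "card (f ` \<Phi>) = d + 2"
      using card_flag[OF \<Phi>] inj_on_subset[OF inj flag_Field[OF \<Phi>]] by (simp add: card_image)
  qed
  \<comment> \<open>This reads the rank off the order alone: the faces of a flag weakly below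
    \<open>F\<close> have the ranks from -1 to \<open>rk F\<close>. Automorphisms preserve their
    number.\<close>
  have below: "card {G \<in> \<Phi>. (G, F) \<in> r} = nat (rk F + 2)" if \<Phi>: "\<Phi> \<in> flags r" "F \<in> \<Phi>" for \<Phi> F
  proof -
    have F: "F = fc \<Phi> (rk F)" "rk F \<in> ranks" using fc_rk \<Phi> rk_range flag_Field by (auto simp: subset_iff)
    have "{G \<in> \<Phi>. (G, F) \<in> r} = fc \<Phi> ` {-1..rk F}"
    proof (intro equalityI subsetI)
      fix G assume "G \<in> {G \<in> \<Phi>. (G, F) \<in> r}"
      then have "G = fc \<Phi> (rk G)" "rk G \<in> {-1..rk F}"
        using fc_rk \<Phi> r_rk rk_range flag_Field by (auto simp: subset_iff)
      then show "G \<in> fc \<Phi> ` {-1..rk F}" by blast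
    next
      fix G assume "G \<in> fc \<Phi> ` {-1..rk F}"
      then obtain j where "j \<in> {-1..rk F}" "G = fc \<Phi> j" by blast
      then show "G \<in> {G \<in> \<Phi>. (G, F) \<in> r}" using fc_le[OF \<Phi>(1), of j "rk F"] fc_mem[OF \<Phi>(1), of j] F by auto
    qed
    moreover have "inj_on (fc \<Phi>) {-1..rk F}"
      by (rule inj_on_inverseI[of _ rk]) (use rk_fc \<Phi> F in auto)
    ultimately show ?thesis by (simp add: card_image)
  qed
  have "chain {F}" using F r_refl by (simp add: chain_def)
  then obtain \<Phi> where \<Phi>: "\<Phi> \<in> flags r" "F \<in> \<Phi>" using ex_flag by blast
  have "{G \<in> f ` \<Phi>. (G, f F) \<in> r} = f ` {G \<in> \<Phi>. (G, F) \<in> r}"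
    using ord F flag_Field[OF \<Phi>(1)] by blast
  moreover have "card (f ` {G \<in> \<Phi>. (G, F) \<in> r}) = card {G \<in> \<Phi>. (G, F) \<in> r}"
    by (rule card_image[OF inj_on_subset[OF inj]]) (use flag_Field[OF \<Phi>(1)] in blast)
  ultimately have "nat (rk (f F) + 2) = nat (rk F + 2)"
    using below[OF \<Phi>] below[OF flag[OF \<Phi>(1)], of "f F"] \<Phi>(2) by simp
  then show "rk (f F) = rk F" using rk_range[OF F] rk_range[OF im[OF F]] by auto
qed

lemma iso_flag: assumes "automorphism r f" "\<Phi> \<in> flags r" shows "f ` \<Phi> \<in> flags r"
proof -
  have "fc \<Phi> (-1) \<in> Field r" using fc_Field assms by simp
  then show ?thesis using iso_rk(2) assms by blast
qed

lemma iso_fc: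
  assumes "automorphism r f" "\<Phi> \<in> flags r" "i \<in> ranks"
  shows "fc (f ` \<Phi>) i = f (fc \<Phi> i)"
  by (rule fc_eqI[OF iso_flag])
     (use assms fc_mem iso_rk(1)[OF assms(1) fc_Field[OF assms(2,3)]] rk_fc in auto)

lemma iso_inj: "automorphism r f \<Longrightarrow> inj_on f (Field r)"
  by (simp add: poset_iso_def bij_betw_def)

lemma iso_nb:
  assumes "automorphism r f" "\<Phi> \<in> flags r" "i \<in> {0..<int d}"
  shows "f ` nb i \<Phi> = nb i (f ` \<Phi>)"
proof (rule nb_eqI)
  have "fc (f ` nb i \<Phi>) i = f (fc (nb i \<Phi>) i)" "fc (f ` \<Phi>) i = f (fc \<Phi> i)"
    using iso_fc assms nb_flag by auto
  moreover have "f (fc (nb i \<Phi>) i) \<noteq> f (fc \<Phi> i)"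
    using inj_on_contraD[OF iso_inj[OF assms(1)] fc_nb_neq[OF assms(2,3)]] fc_Field[of _ i] assms nb_flag by auto
  ultimately show "f ` nb i \<Phi> \<noteq> f ` \<Phi>" by metis
  show "fc (f ` nb i \<Phi>) j = fc (f ` \<Phi>) j" if "j \<in> {0..<int d}" "j \<noteq> i" for j
    using iso_fc[OF assms(1), of _ j] fc_nb nb_flag assms that by auto
qed (use assms iso_flag nb_flag in auto)

lemma iso_words:
  assumes "automorphism r f" "\<Phi> \<in> flags r" "set w \<subseteq> {0..<int d}"
  shows "f ` foldr nb w \<Phi> = foldr nb w (f ` \<Phi>) \<and> foldr nb w \<Phi> \<in> flags r"
  using assms(3) by (induction w) (use assms iso_nb nb_flag in auto)

lemma finite_flags: "finite (Field r) \<Longrightarrow> finite (flags r)"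
  by (rule finite_subset[of _ "Pow (Field r)"]) (use flag_Field in auto)

end

section \<open>Twisted extensions\<close>

text \<open>Only the action on flags is kept. \<open>transfer\<close> is what remains of the
  transitivity of the automorphism group on each colour, \<open>rho_nb\<close> lets the new
  involution commute with those of distant rank, and \<open>rho_fix\<close> serves the intersection
  property. The bound \<open>k \<le> d - 2\<close> leaves room for a reflection that moves a
  \<open>(d - 2)\<close>-face.\<close>

locale twisted_extension =
  fixes W :: "'w set" and nb :: "int \<Rightarrow> 'w \<Rightarrow> 'w" and d :: nat and col :: "'w \<Rightarrow> bool"
    and fc :: "'w \<Rightarrow> int \<Rightarrow> 'a" and rho :: "'w \<Rightarrow> int \<Rightarrow> 'w \<Rightarrow> 'w"
  assumes d2: "2 \<le> d" and W_nonempty: "W \<noteq> {}" and W_finite: "finite W"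
    and nb_closed: "\<And>i \<Phi>. i \<in> {0..<int d} \<Longrightarrow> \<Phi> \<in> W \<Longrightarrow> nb i \<Phi> \<in> W"
    and nb_invol: "\<And>i \<Phi>. i \<in> {0..<int d} \<Longrightarrow> \<Phi> \<in> W \<Longrightarrow> nb i (nb i \<Phi>) = \<Phi>"
    and nb_col: "\<And>i \<Phi>. i \<in> {0..<int d} \<Longrightarrow> \<Phi> \<in> W \<Longrightarrow> col (nb i \<Phi>) \<noteq> col \<Phi>"
    and nb_commute: "\<And>i j \<Phi>. 0 \<le> i \<Longrightarrow> i + 2 \<le> j \<Longrightarrow> j < int d \<Longrightarrow> \<Phi> \<in> W \<Longrightarrow> nb i (nb j \<Phi>) = nb j (nb i \<Phi>)"
    and conn_iff: "\<And>I \<Phi> \<Psi>. I \<subseteq> {0..<int d} \<Longrightarrow> \<Phi> \<in> W \<Longrightarrow> \<Psi> \<in> W \<Longrightarrow>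
        conn nb I \<Phi> \<Psi> \<longleftrightarrow> (\<forall>j\<in>{0..<int d} - I. fc \<Phi> j = fc \<Psi> j)"
    and transfer: "\<And>\<Phi> \<Psi> w w'. \<Phi> \<in> W \<Longrightarrow> \<Psi> \<in> W \<Longrightarrow> col \<Phi> = col \<Psi> \<Longrightarrow>
        set w \<subseteq> {0..<int d} \<Longrightarrow> set w' \<subseteq> {0..<int d} \<Longrightarrow>
        foldr nb w \<Phi> = foldr nb w' \<Phi> \<Longrightarrow> foldr nb w \<Psi> = foldr nb w' \<Psi>"
    and rho_closed: "\<And>\<phi> k \<Phi>. \<phi> \<in> W \<Longrightarrow> k \<in> {0..int d - 2} \<Longrightarrow> \<Phi> \<in> W \<Longrightarrow> rho \<phi> k \<Phi> \<in> W"
    and rho_invol: "\<And>\<phi> k \<Phi>. \<phi> \<in> W \<Longrightarrow> k \<in> {0..int d - 2} \<Longrightarrow> \<Phi> \<in> W \<Longrightarrow> rho \<phi> k (rho \<phi> k \<Phi>) = \<Phi>"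
    and rho_col: "\<And>\<phi> k \<Phi>. \<phi> \<in> W \<Longrightarrow> k \<in> {0..int d - 2} \<Longrightarrow> \<Phi> \<in> W \<Longrightarrow> col (rho \<phi> k \<Phi>) \<noteq> col \<Phi>"
    and rho_nb: "\<And>\<phi> k \<Phi> i. \<phi> \<in> W \<Longrightarrow> k \<in> {0..int d - 2} \<Longrightarrow> \<Phi> \<in> W \<Longrightarrow> i \<in> {0..<int d - 1} \<Longrightarrow>
        rho \<phi> k (nb i \<Phi>) = nb i (rho \<phi> k \<Phi>)"
    and rho_facet: "\<And>\<phi> k \<Phi>. \<phi> \<in> W \<Longrightarrow> k \<in> {0..int d - 2} \<Longrightarrow> \<Phi> \<in> W \<Longrightarrow>
        fc (rho \<phi> k \<Phi>) (int d - 1) = fc \<Phi> (int d - 1)"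
    and rho_fix: "\<And>\<phi> k \<Phi> j. \<phi> \<in> W \<Longrightarrow> k \<in> {0..int d - 2} \<Longrightarrow> \<Phi> \<in> W \<Longrightarrow>
        \<forall>j\<in>{0..<k}. fc \<Phi> j = fc \<phi> j \<Longrightarrow> j \<in> {0..<k} \<Longrightarrow> fc (rho \<phi> k \<Phi>) j = fc \<phi> j"
begin

lemma fc_nb: "\<Phi> \<in> W \<Longrightarrow> i \<in> {0..<int d} \<Longrightarrow> j \<in> {0..<int d} \<Longrightarrow> j \<noteq> i \<Longrightarrow> fc (nb i \<Phi>) j = fc \<Phi> j"
  using conn_iff[of "{i}" \<Phi> "nb i \<Phi>"] conn_single[of i "{i}" nb \<Phi>] nb_closed by auto

text \<open>The sheets over \<open>W\<close>, indexed by a base flag \<open>\<phi>\<close> and a rank \<open>k\<close>: the new involution acts by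
  the reflections \<open>rho \<phi> k\<close> and changes the sheet exactly over the facet of \<open>\<phi>\<close>.\<close>

definition Y :: "('w \<times> int \<times> 'w \<times> bool) set" where "Y = W \<times> {0..int d - 2} \<times> W \<times> UNIV"

fun ry :: "int \<Rightarrow> 'w \<times> int \<times> 'w \<times> bool \<Rightarrow> 'w \<times> int \<times> 'w \<times> bool" where
  "ry i (\<phi>, k, \<Phi>, n) = (if i = int d
     then (\<phi>, k, rho \<phi> k \<Phi>, n \<noteq> (fc \<Phi> (int d - 1) = fc \<phi> (int d - 1)))
     else (\<phi>, k, nb i \<Phi>, n))"

fun ycol :: "'w \<times> int \<times> 'w \<times> bool \<Rightarrow> bool" where "ycol (\<phi>, k, \<Phi>, n) = col \<Phi>"

abbreviation "Cols \<equiv> {0..<int (Suc d)}"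

lemma ry_closed: "i \<in> Cols \<Longrightarrow> y \<in> Y \<Longrightarrow> ry i y \<in> Y"
  by (cases y) (auto simp: Y_def rho_closed nb_closed)

lemma ry_invol: "i \<in> Cols \<Longrightarrow> y \<in> Y \<Longrightarrow> ry i (ry i y) = y"
  by (cases y) (auto simp: Y_def rho_closed nb_closed rho_invol nb_invol rho_facet)

lemma ry_col: "i \<in> Cols \<Longrightarrow> y \<in> Y \<Longrightarrow> ycol (ry i y) = (\<not> ycol y)"
  using rho_col nb_col by (cases y) (simp add: Y_def)

lemma ry_commute: "0 \<le> i \<Longrightarrow> i + 2 \<le> j \<Longrightarrow> j < int (Suc d) \<Longrightarrow> y \<in> Y \<Longrightarrow> ry i (ry j y) = ry j (ry i y)"
  using nb_commute[of i j] by (cases y; cases "j = int d") (auto simp: Y_def rho_nb fc_nb)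

lemma foldr_ry:
  assumes "set w \<subseteq> {0..<int d}"
  shows "foldr ry w (\<phi>, k, \<Phi>, n) = (\<phi>, k, foldr nb w \<Phi>, n)"
  using assms by (induction w) auto

lemma foldr_nb_closed: "set w \<subseteq> {0..<int d} \<Longrightarrow> \<Phi> \<in> W \<Longrightarrow> foldr nb w \<Phi> \<in> W"
  by (induction w) (auto simp: nb_closed)

lemma foldr_ry_closed: "set w \<subseteq> Cols \<Longrightarrow> y \<in> Y \<Longrightarrow> foldr ry w y \<in> Y"
  by (induction w) (auto simp: ry_closed)

text \<open>Every generator exchanges the colours, so a colour reveals the parity of the word
  leading to it. This becomes the invariant that separates the two flag orbits of the
  extension.\<close>

lemma foldr_ry_col: "set w \<subseteq> Cols \<Longrightarrow> y \<in> Y \<Longrightarrow> ycol (foldr ry w y) = (ycol y = even (length w))"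
  by (induction w) (auto simp: ry_col foldr_ry_closed)

lemma foldr_ry_rev: "set w \<subseteq> Cols \<Longrightarrow> y \<in> Y \<Longrightarrow> foldr ry (rev w) (foldr ry w y) = y"
  by (induction w arbitrary: y) (auto simp: ry_invol foldr_ry_closed)

lemma foldr_ry_rev': "set w \<subseteq> Cols \<Longrightarrow> y \<in> Y \<Longrightarrow> foldr ry w (foldr ry (rev w) y) = y"
  using foldr_ry_rev[of "rev w" y] by simp

definition Y0 where "Y0 = {y \<in> Y. ycol y}"

lemma ex_col: obtains \<Phi> where "\<Phi> \<in> W" "col \<Phi> = c"
proof -
  obtain \<Phi> where "\<Phi> \<in> W" using W_nonempty by blast
  then show ?thesis using that[of \<Phi>] that[of "nb 0 \<Phi>"] nb_col[of 0 \<Phi>] nb_closed[of 0 \<Phi>] d2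
    by (cases "col \<Phi> = c") auto
qed

lemma Y0_nonempty: "Y0 \<noteq> {}"
proof -
  obtain \<Phi> where "\<Phi> \<in> W" "col \<Phi> = True" by (rule ex_col)
  then have "(\<Phi>, 0, \<Phi>, True) \<in> Y0" using d2 by (simp add: Y0_def Y_def)
  then show ?thesis by blast
qed

definition e where "e y = (if y \<in> Y0 then y else (SOME y. y \<in> Y0))"

lemma e_Y0: "e y \<in> Y0"
  using Y0_nonempty some_in_eq[of Y0] by (auto simp: e_def)

lemma e_Y: "e y \<in> Y" and e_col: "ycol (e y)"
  using e_Y0 by (auto simp: Y0_def)

lemma e_id: "y \<in> Y0 \<Longrightarrow> e y = y"
  by (simp add: e_def)

text \<open>Restricting to one colour class is essential: a word that fixes one flag of \<open>K\<close> fixes all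
  flags of the same colour, but in general not those of the other. Precomposing with \<open>e\<close> encodes the
  restriction by total functions.\<close>

definition M where "M = {\<lambda>y. foldr ry w (e y) | w. set w \<subseteq> Cols}"

definition rM where "rM i x = (\<lambda>y. ry i (x y))"

text \<open>The argument \<open>undefined\<close> is arbitrary: \<open>e\<close> sends everything
  into one colour class, so all values of an element of \<open>M\<close> have the same
  colour.\<close>

definition mcol where "mcol x = ycol (x undefined)"

lemma foldr_rM: "foldr rM w x = (\<lambda>y. foldr ry w (x y))"
  by (induction w) (auto simp: rM_def)

lemma M_iff: "x \<in> M \<longleftrightarrow> (\<exists>w. set w \<subseteq> Cols \<and> x = foldr rM w e)"
  by (auto simp: M_def foldr_rM)

lemma M_Y: "x \<in> M \<Longrightarrow> x y \<in> Y"
  by (auto simp: M_def foldr_ry_closed e_Y)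

lemma M_col: "x \<in> M \<Longrightarrow> ycol (x y) = mcol x"
  by (auto simp: M_def foldr_ry_col e_Y e_col mcol_def)

lemma M_onto: assumes "x \<in> M" "z \<in> Y" "ycol z = mcol x" shows "\<exists>y. x y = z"
proof -
  obtain w where w: "set w \<subseteq> Cols" "x = (\<lambda>y. foldr ry w (e y))" using assms by (auto simp: M_def)
  have c: "mcol x = even (length w)" using w by (simp add: mcol_def foldr_ry_col e_Y e_col)
  have "foldr ry (rev w) z \<in> Y0" using assms c w foldr_ry_closed[of "rev w" z] foldr_ry_col[of "rev w" z]
    by (simp add: Y0_def)
  then have "x (foldr ry (rev w) z) = z" using w assms by (simp add: e_id foldr_ry_rev')
  then show ?thesis by blast
qed

lemma rM_closed: "i \<in> Cols \<Longrightarrow> x \<in> M \<Longrightarrow> rM i x \<in> M"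
proof -
  assume i: "i \<in> Cols" and "x \<in> M"
  then obtain w where "set w \<subseteq> Cols" "x = foldr rM w e" using M_iff by blast
  then show ?thesis unfolding M_iff using i by (intro exI[of _ "i # w"]) simp
qed

lemma M_closed_words: "set w \<subseteq> Cols \<Longrightarrow> x \<in> M \<Longrightarrow> foldr rM w x \<in> M"
  by (induction w) (auto simp: rM_closed)

lemma rM_invol: "i \<in> Cols \<Longrightarrow> x \<in> M \<Longrightarrow> rM i (rM i x) = x"
  by (simp add: rM_def ry_invol M_Y)

lemma rM_col: "i \<in> Cols \<Longrightarrow> x \<in> M \<Longrightarrow> mcol (rM i x) = (\<not> mcol x)"
  by (simp add: rM_def mcol_def ry_col M_Y)

section \<open>Relations between words, and the intersection property\<close>

lemma conn_eval: "conn rM I x y \<Longrightarrow> conn ry I (x a) (y a)"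
  by (induction rule: conn_induct) (auto simp: rM_def intro: conn_step)

text \<open>An element of \<open>M\<close> takes every value in its colour class, so applying two
  words to it compares them as maps on that class.\<close>

lemma foldr_rM_eq_iff:
  assumes "x \<in> M"
  shows "foldr rM w x = foldr rM w' x \<longleftrightarrow> (\<forall>z\<in>Y. ycol z = mcol x \<longrightarrow> foldr ry w z = foldr ry w' z)"
proof
  assume "foldr rM w x = foldr rM w' x"
  then have "(\<lambda>y. foldr ry w (x y)) = (\<lambda>y. foldr ry w' (x y))" by (simp only: foldr_rM)
  then have *: "foldr ry w (x y) = foldr ry w' (x y)" for y by (rule fun_cong)
  show "\<forall>z\<in>Y. ycol z = mcol x \<longrightarrow> foldr ry w z = foldr ry w' z"
    using M_onto[OF assms] * by metis
next
  assume "\<forall>z\<in>Y. ycol z = mcol x \<longrightarrow> foldr ry w z = foldr ry w' z"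
  then show "foldr rM w x = foldr rM w' x" using M_Y[OF assms] M_col[OF assms] by (simp add: foldr_rM)
qed

text \<open>The old generators change neither the base flag, nor the rank, nor the sheet, and a
  relation between old words at one flag of \<open>K\<close> passes to all flags of that colour by
  \<open>transfer\<close>. This is the source of the facets: old words generate on \<open>M\<close>
  copies of the flag graph of \<open>K\<close>.\<close>

lemma free_iff:
  assumes "x \<in> M" "\<Phi> \<in> W" "col \<Phi> = mcol x" "set w \<subseteq> {0..<int d}" "set w' \<subseteq> {0..<int d}"
  shows "foldr rM w x = foldr rM w' x \<longleftrightarrow> foldr nb w \<Phi> = foldr nb w' \<Phi>"
proof
  assume "foldr rM w x = foldr rM w' x"
  then have "\<forall>z\<in>Y. ycol z = mcol x \<longrightarrow> foldr ry w z = foldr ry w' z" using foldr_rM_eq_iff[OF assms(1)] by simp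
  moreover have "(\<Phi>, 0, \<Phi>, True) \<in> Y" using assms d2 by (simp add: Y_def)
  ultimately have "foldr ry w (\<Phi>, 0, \<Phi>, True) = foldr ry w' (\<Phi>, 0, \<Phi>, True)" using assms by fastforce
  then show "foldr nb w \<Phi> = foldr nb w' \<Phi>" using foldr_ry assms by simp
next
  assume eq: "foldr nb w \<Phi> = foldr nb w' \<Phi>"
  have "foldr ry w z = foldr ry w' z" if z: "z \<in> Y" "ycol z = mcol x" for z
  proof -
    obtain \<phi> k \<Psi> n where zz: "z = (\<phi>, k, \<Psi>, n)" by (cases z)
    then have "\<Psi> \<in> W" "col \<Phi> = col \<Psi>" using z assms by (auto simp: Y_def)
    then have "foldr nb w \<Psi> = foldr nb w' \<Psi>" using transfer[OF assms(2) _ _ assms(4,5) eq] by blast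
    then show ?thesis using zz foldr_ry assms by simp
  qed
  then show "foldr rM w x = foldr rM w' x" using foldr_rM_eq_iff[OF assms(1)] by simp
qed

text \<open>Old colours from \<open>k\<close> on leave the faces of rank below \<open>k\<close>
  alone, and \<open>rho \<phi> k\<close> keeps their agreement with \<open>\<phi>\<close> by
  \<open>rho_fix\<close>. This is the purpose of having separate sheets for each
  \<open>k\<close>.\<close>

lemma sheet_faces:
  assumes "conn ry {k..<int (Suc d)} (\<phi>, k, \<Phi>, n) z" "\<phi> \<in> W" "k \<in> {0..int d - 2}" "\<Phi> \<in> W"
    "\<forall>j\<in>{0..<k}. fc \<Phi> j = fc \<phi> j"
  shows "\<exists>\<Psi>\<in>W. \<exists>m. z = (\<phi>, k, \<Psi>, m) \<and> (\<forall>j\<in>{0..<k}. fc \<Psi> j = fc \<phi> j)"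
  using assms(1)
proof (induction rule: conn_induct)
  case refl
  then show ?case using assms by blast
next
  case (step z i)
  then obtain \<Psi> m where z: "\<Psi> \<in> W" "z = (\<phi>, k, \<Psi>, m)" "\<forall>j\<in>{0..<k}. fc \<Psi> j = fc \<phi> j" by blast
  show ?case
  proof (cases "i = int d")
    case True
    then show ?thesis using z rho_closed rho_fix assms by auto
  next
    case False
    then have "fc (nb i \<Psi>) j = fc \<phi> j" if "j \<in> {0..<k}" for j
      using z fc_nb[of \<Psi> i j] that step assms by auto
    then show ?thesis using z False nb_closed[of i \<Psi>] step assms by auto
  qed
qed

text \<open>Two involutions generate a dihedral group, whose elements are rotations or a fixed
  reflection times a rotation. The rotations are powers of \<open>R\<close> or of its inverse, hence
  even words that commute with \<open>R\<close>.\<close>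

lemma dihedral:
  fixes R defines "R \<equiv> \<lambda>z. ry (int d) (ry (int d - 1) z)"
  assumes "conn rM {int d - 1, int d} x y" "x \<in> M"
  shows "\<exists>u. set u \<subseteq> {int d - 1, int d} \<and> even (length u) \<and> (\<forall>z\<in>Y. foldr ry u (R z) = R (foldr ry u z)) \<and>
    (y = foldr rM u x \<or> y = rM (int d - 1) (foldr rM u x))"
  using assms(2)
proof (induction rule: conn_induct)
  case refl
  then show ?case by (intro exI[of _ "[]"]) simp
next
  case (step y i)
  let ?a = "int d - 1" let ?b = "int d"
  have ab: "?a \<in> Cols" "?b \<in> Cols" "{?a, ?b} \<subseteq> Cols" using d2 by auto
  obtain u where u: "set u \<subseteq> {?a, ?b}" "even (length u)" "\<forall>z\<in>Y. foldr ry u (R z) = R (foldr ry u z)"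
    and y: "y = foldr rM u x \<or> y = rM ?a (foldr rM u x)" using step by blast
  have uY: "foldr ry u z \<in> Y" if "z \<in> Y" for z using that u ab by (intro foldr_ry_closed) auto
  have uM: "foldr rM u x \<in> M"
    by (rule M_closed_words[OF subset_trans[OF u(1) ab(3)] assms(3)])
  consider "i = ?a" "y = foldr rM u x" | "i = ?a" "y = rM ?a (foldr rM u x)"
    | "i = ?b" "y = foldr rM u x" | "i = ?b" "y = rM ?a (foldr rM u x)" using y step by auto
  then show ?case
  proof cases
    case 1
    then show ?thesis using u by blast
  next
    case 2
    then have "rM i y = foldr rM u x" using rM_invol[OF ab(1) uM] by simp
    then show ?thesis using u by blast
  next
    case 3
    have "foldr ry (?a # ?b # u) (R z) = R (foldr ry (?a # ?b # u) z)" if "z \<in> Y" for z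
    proof -
      have "foldr ry (?a # ?b # u) (R z) = ry ?a (ry ?b (R (foldr ry u z)))" using u that by simp
      also have "\<dots> = foldr ry u z" using uY[OF that] ab by (simp add: R_def ry_closed ry_invol)
      also have "\<dots> = R (foldr ry (?a # ?b # u) z)" using uY[OF that] ab by (simp add: R_def ry_closed ry_invol)
      finally show ?thesis .
    qed
    moreover have "rM i y = rM ?a (foldr rM (?a # ?b # u) x)"
      using 3 rM_invol[OF ab(1)] rM_closed[OF ab(2)] uM by simp
    ultimately show ?thesis using u(1,2) by (intro exI[of _ "?a # ?b # u"]) simp
  next
    case 4
    have "foldr ry (?b # ?a # u) (R z) = R (foldr ry (?b # ?a # u) z)" if "z \<in> Y" for z
      using u that by (simp add: R_def)
    moreover have "rM i y = foldr rM (?b # ?a # u) x" using 4 by simp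
    ultimately show ?thesis using u(1,2) by (intro exI[of _ "?b # ?a # u"]) simp
  qed
qed

text \<open>For \<open>k = d - 1\<close> a word \<open>w\<close> in the old generators that agrees with a rotation about a
  \<open>(d - 2)\<close>-face commutes with the generator of these rotations. Comparing the sheets of both
  sides shows that \<open>w\<close> preserves the facet over which the sheet changes.\<close>

lemma faces_preserved:
  assumes x: "x \<in> M" and w: "set w \<subseteq> {0..<int d}" and k: "0 \<le> k" "k \<le> int d"
    and c: "conn rM {k..<int (Suc d)} x (foldr rM w x)" and \<phi>: "\<phi> \<in> W" "col \<phi> = mcol x"
  shows "\<forall>j\<in>{0..<k}. fc (foldr nb w \<phi>) j = fc \<phi> j"
proof -
  consider "k \<le> int d - 2" | "k = int d - 1" | "k = int d" using k by linarith
  then show ?thesis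
  proof cases
    case 1
    have "(\<phi>, k, \<phi>, True) \<in> Y" using 1 k \<phi> by (simp add: Y_def)
    then obtain a where a: "x a = (\<phi>, k, \<phi>, True)" using M_onto[OF x] \<phi> by fastforce
    have "conn ry {k..<int (Suc d)} (x a) (foldr rM w x a)" by (rule conn_eval[OF c])
    then have "conn ry {k..<int (Suc d)} (\<phi>, k, \<phi>, True) (\<phi>, k, foldr nb w \<phi>, True)"
      using a foldr_ry[OF w] by (simp add: foldr_rM)
    from sheet_faces[OF this] 1 k \<phi> show ?thesis by auto
  next
    case 3
    have "{k..<int (Suc d)} = {int d}" using 3 by auto
    then have "conn rM {int d} x (foldr rM w x)" using c by simp
    then have "foldr rM w x = x \<or> foldr rM w x = rM (int d) x"
      by (induction rule: conn_induct) (use rM_invol[of "int d" x] x in auto)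
    \<comment> \<open>Evaluated at \<open>\<phi>\<close> on a sheet with base \<open>\<phi>\<close>,
      the new involution changes the sheet and \<open>w\<close> does not.\<close>
    moreover have "foldr rM w x \<noteq> rM (int d) x"
    proof
      assume eq: "foldr rM w x = rM (int d) x"
      have "(\<phi>, 0, \<phi>, True) \<in> Y" using \<phi> d2 by (simp add: Y_def)
      then obtain a where a: "x a = (\<phi>, 0, \<phi>, True)" using M_onto[OF x] \<phi> by fastforce
      then have "foldr ry w (\<phi>, 0, \<phi>, True) = ry (int d) (\<phi>, 0, \<phi>, True)"
        using fun_cong[OF eq, of a] by (simp add: foldr_rM rM_def)
      then show False using foldr_ry[OF w] by simp
    qed
    ultimately have "foldr rM w x = foldr rM [] x" by simp
    then have "foldr nb w \<phi> = foldr nb [] \<phi>" using free_iff[OF x \<phi> w, of "[]"] by simp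
    then show ?thesis by simp
  next
    case 2
    let ?a = "int d - 1" let ?b = "int d"
    define R where "R = (\<lambda>z. ry ?b (ry ?a z))"
    have ab: "?a \<in> Cols" "?b \<in> Cols" "{?a, ?b} \<subseteq> Cols" "?a \<in> {0..<int d}" using d2 by auto
    have "{k..<int (Suc d)} = {?a, ?b}" using 2 by auto
    then have "conn rM {?a, ?b} x (foldr rM w x)" using c by simp
    from dihedral[OF this x] obtain u where u: "set u \<subseteq> {?a, ?b}" "even (length u)"
      and uR: "\<forall>z\<in>Y. foldr ry u (R z) = R (foldr ry u z)"
      and wu: "foldr rM w x = foldr rM u x \<or> foldr rM w x = rM ?a (foldr rM u x)"
      unfolding R_def by blast
    have uM: "foldr rM u x \<in> M"
      by (rule M_closed_words[OF subset_trans[OF u(1) ab(3)] x])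
    \<comment> \<open>Up to one further letter \<open>r_{d-1}\<close>, itself an old generator,
      \<open>w\<close> acts on \<open>x\<close> as a rotation.\<close>
    define w1 where "w1 = (if foldr rM w x = foldr rM u x then w else ?a # w)"
    have w1: "set w1 \<subseteq> {0..<int d}" using w ab by (simp add: w1_def)
    have "foldr rM w1 x = foldr rM u x"
      using wu rM_invol[OF ab(1) uM] by (auto simp: w1_def)
    then have w1u: "foldr ry w1 z = foldr ry u z" if "z \<in> Y" "ycol z = mcol x" for z
      using foldr_rM_eq_iff[OF x] that by blast
    define \<phi>' where "\<phi>' = nb ?a \<phi>"
    have \<phi>': "\<phi>' \<in> W" "\<forall>j\<in>{0..<?a}. fc \<phi>' j = fc \<phi> j" "nb ?a \<phi>' = \<phi>"
      using \<phi> nb_closed ab fc_nb nb_invol by (auto simp: \<phi>'_def)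
    \<comment> \<open>The base \<open>\<phi>'\<close> is chosen so that \<open>r_{d-1}\<close> takes
      \<open>\<phi>\<close> to the base flag, over whose facet \<open>r_d\<close> changes the sheet.
      The index \<open>d - 2\<close> is the largest one available.\<close>
    let ?z = "(\<phi>', int d - 2, \<phi>, False)"
    have z: "?z \<in> Y" "ycol ?z = mcol x" using \<phi> \<phi>' d2 by (auto simp: Y_def)
    have Rz: "R ?z = (\<phi>', int d - 2, rho \<phi>' (int d - 2) \<phi>', True)" by (simp add: R_def \<phi>'_def)
    have RzY: "R ?z \<in> Y" "ycol (R ?z) = mcol x"
      using z ab ry_closed ry_col by (auto simp: R_def simp del: ry.simps)
    define \<psi> where "\<psi> = foldr nb w1 \<phi>"
    have uz: "foldr ry u ?z = (\<phi>', int d - 2, \<psi>, False)"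
      using w1u[OF z] foldr_ry[OF w1] by (simp add: \<psi>_def)
    have \<psi>: "\<psi> \<in> W" unfolding \<psi>_def by (rule foldr_nb_closed[OF w1 \<phi>(1)])
    have "conn ry {int d - 2..<int (Suc d)} ?z (foldr ry u ?z)"
      unfolding conn_def by (rule exI[of _ u]) (use u in auto)
    from sheet_faces[OF this \<phi>'(1) _ \<phi>(1)] have low: "\<forall>j\<in>{0..<int d - 2}. fc \<psi> j = fc \<phi>' j"
      using \<phi>'(2) uz d2 by auto
    have "ycol (foldr ry u ?z) = ycol ?z" 
      using foldr_ry_col[OF subset_trans[OF u(1) ab(3)] z(1)] u(2) by simp
    then have colpsi: "col \<psi> = col \<phi>" using uz by simp
    \<comment> \<open>\<open>R\<close> changes the sheet at \<open>?z\<close>, and \<open>w1\<close>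
      never changes it. As \<open>u\<close> commutes with \<open>R\<close>, the sheet must also
      change when \<open>R\<close> is applied at \<open>\<psi>\<close>, which puts the
      \<open>(d - 1)\<close>-neighbour of \<open>\<psi>\<close> over the facet of
      \<open>\<phi>'\<close>.\<close>
    have "R (\<phi>', int d - 2, \<psi>, False) = R (foldr ry u ?z)" using uz by simp
    also have "\<dots> = foldr ry u (R ?z)" using uR z by simp
    also have "\<dots> = foldr ry w1 (R ?z)" using w1u[OF RzY] by simp
    also have "\<dots> = (\<phi>', int d - 2, foldr nb w1 (rho \<phi>' (int d - 2) \<phi>'), True)"
      unfolding Rz by (rule foldr_ry[OF w1])
    finally have facet: "fc (nb ?a \<psi>) ?a = fc \<phi>' ?a" by (simp add: R_def)
    define \<chi> where "\<chi> = nb ?a \<psi>"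
    have \<chi>: "\<chi> \<in> W" using nb_closed ab \<psi> by (simp add: \<chi>_def)
    \<comment> \<open>All ranks except \<open>d - 2\<close> agree: the lower ones by
      \<open>sheet_faces\<close>, the top one by the comparison of sheets. The two flags are
      therefore equal or adjacent, and their equal colours exclude the latter.\<close>
    have "fc \<phi>' j = fc \<chi> j" if "j \<in> {0..<int d} - {int d - 2}" for j
    proof (cases "j = ?a")
      case True
      then show ?thesis using facet by (simp add: \<chi>_def)
    next
      case False
      then show ?thesis using that low fc_nb[OF \<psi> ab(4), of j] by (simp add: \<chi>_def)
    qed
    then have "conn nb {int d - 2} \<phi>' \<chi>" using conn_iff[of "{int d - 2}" \<phi>' \<chi>] \<phi>' \<chi> d2 by auto
    then have "\<chi> = \<phi>' \<or> \<chi> = nb (int d - 2) \<phi>'"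
      by (induction rule: conn_induct) (use nb_invol[of "int d - 2" \<phi>'] \<phi>' d2 in auto)
    moreover have "col \<chi> = col \<phi>'" using colpsi nb_col[OF ab(4) \<psi>] nb_col[OF ab(4) \<phi>(1)]
      by (simp add: \<chi>_def \<phi>'_def)
    then have "\<chi> \<noteq> nb (int d - 2) \<phi>'" using nb_col[of "int d - 2" \<phi>'] \<phi>' d2 by auto
    ultimately have "\<chi> = \<phi>'" by blast
    then have "nb ?a \<chi> = nb ?a \<phi>'" by simp
    then have "\<psi> = \<phi>" using nb_invol[OF ab(4) \<psi>] \<phi>'(3) by (simp add: \<chi>_def)
    then have "foldr nb w \<phi> = \<phi> \<or> nb ?a (foldr nb w \<phi>) = \<phi>" unfolding \<psi>_def w1_def
      by (cases "foldr rM w x = foldr rM u x") auto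
    then have "foldr nb w \<phi> = \<phi> \<or> foldr nb w \<phi> = nb ?a \<phi>"
      using nb_invol[OF ab(4) foldr_nb_closed[OF w \<phi>(1)]] by auto
    then show ?thesis using \<phi>'(2) 2 by (auto simp: \<phi>'_def)
  qed
qed

lemma e_M: "e \<in> M"
  unfolding M_iff by (intro exI[of _ "[]"]) simp

lemma M_conn: "x \<in> M \<Longrightarrow> conn rM Cols e x"
  unfolding M_iff conn_def by blast

sublocale maniplex M rM "Suc d"
proof
  show "M \<noteq> {}" using e_M by blast
  show cl: "rM i x \<in> M" if "i \<in> Cols" "x \<in> M" for i x using rM_closed that by blast
  show inv: "rM i (rM i x) = x" if "i \<in> Cols" "x \<in> M" for i x using rM_invol that by blast
  show "rM i x \<noteq> x" if "i \<in> Cols" "x \<in> M" for i x using rM_col that by metis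
  show "rM i (rM j x) = rM j (rM i x)" if "0 \<le> i" "i + 2 \<le> j" "j < int (Suc d)" "x \<in> M" for i j x
    using ry_commute[OF that(1-3)] M_Y[OF that(4)] by (simp add: rM_def)
  show "conn rM Cols x y" if "x \<in> M" "y \<in> M" for x y
    using conn_reverse[OF M_conn[OF that(1)] e_M cl inv] M_conn[OF that(2)] conn_trans by metis
  show "conn rM {k..<m} x y" if x: "x \<in> M" and y: "y \<in> M" and k: "0 \<le> k" and m: "m \<le> int (Suc d)"
    and a: "conn rM {0..<m} x y" "conn rM {k..<int (Suc d)} x y" for x y k m
  proof -
    consider "m = int (Suc d)" | "k > int d" | "m \<le> int d" "k \<le> int d" using m by linarith
    then show ?thesis
    proof cases
      case 1
      then show ?thesis using a by simp
    next
      case 2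
      then have "conn rM {} x y" using conn_mono[OF a(2), of "{}"] by simp
      then show ?thesis by (rule conn_mono) simp
    next
      case 3
      \<comment> \<open>In \<open>K\<close>, the flag \<open>\<phi>\<close> and its image under
        \<open>w\<close> share the faces below \<open>k\<close> by \<open>faces_preserved\<close>,
        and those from \<open>m\<close> on because \<open>w\<close> avoids these colours. Strong
        connectedness of \<open>K\<close> supplies a word \<open>v\<close> in the colours between,
        and \<open>free_iff\<close> carries the equality of \<open>w\<close> and \<open>v\<close>
        back to \<open>M\<close>.\<close>
      obtain w where w: "set w \<subseteq> {0..<m}" "y = foldr rM w x" using a(1) unfolding conn_def by blast
      then have w': "set w \<subseteq> {0..<int d}" using 3 by auto
      obtain \<phi> where \<phi>: "\<phi> \<in> W" "col \<phi> = mcol x" by (rule ex_col)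
      have *: "foldr nb w \<phi> \<in> W" by (rule foldr_nb_closed[OF w' \<phi>(1)])
      have low: "\<forall>j\<in>{0..<k}. fc (foldr nb w \<phi>) j = fc \<phi> j"
        using faces_preserved[OF x w' k 3(2) _ \<phi>] a(2) w(2) by simp
      have "conn nb {0..<m} \<phi> (foldr nb w \<phi>)" using w unfolding conn_def by blast
      then have high: "\<forall>j\<in>{0..<int d} - {0..<m}. fc \<phi> j = fc (foldr nb w \<phi>) j"
        using conn_iff[of "{0..<m}"] * \<phi> 3 by auto
      have "conn nb {k..<m} \<phi> (foldr nb w \<phi>)"
        using conn_iff[of "{k..<m}" \<phi> "foldr nb w \<phi>"] * \<phi> 3 low high k by force
      then obtain v where v: "set v \<subseteq> {k..<m}" "foldr nb w \<phi> = foldr nb v \<phi>" unfolding conn_def by blast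
      have v': "set v \<subseteq> {0..<int d}" using v 3 k by force
      have "foldr rM w x = foldr rM v x" using free_iff[OF x \<phi> w' v'] v(2) by simp
      then show ?thesis unfolding conn_def using v w by auto
    qed
  qed
qed

text \<open>Generators act by composition on the left and hence commute with composition on the
  right. Right composition is restricted to even words because these map \<open>Y0\<close> into
  itself, where \<open>e\<close> is the identity.\<close>

lemma homogeneous:
  assumes "x \<in> M" "y \<in> M" "mcol x = mcol y"
  shows "\<exists>T. bij_betw T M M \<and> T x = y \<and> (\<forall>z\<in>M. \<forall>i\<in>Cols. T (rM i z) = rM i (T z))"
proof -
  obtain w where w: "set w \<subseteq> Cols" "x = foldr rM w e" using assms M_iff by blast
  obtain w' where w': "set w' \<subseteq> Cols" "y = foldr rM w' e" using assms M_iff by blast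
  have par: "even (length w) = even (length w')" using assms w w'
    by (simp add: mcol_def foldr_rM foldr_ry_col e_Y e_col)
  define T where "T u z = (\<lambda>a. z (foldr ry u (e a)))" for u and z :: "_ \<Rightarrow> 'w \<times> int \<times> 'w \<times> bool"
  have T: "T u (foldr rM v e) = foldr rM (v @ u) e" if "set u \<subseteq> Cols" "even (length u)" for u v
  proof
    fix a
    have "foldr ry u (e a) \<in> Y0" using that by (simp add: Y0_def foldr_ry_col foldr_ry_closed e_Y e_col)
    then show "T u (foldr rM v e) a = foldr rM (v @ u) e a" by (simp add: T_def foldr_rM e_id)
  qed
  have TM: "T u z \<in> M" if "set u \<subseteq> Cols" "even (length u)" "z \<in> M" for u z
    using that(3) T[OF that(1,2)] that(1) unfolding M_iff by (metis le_sup_iff set_append)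
  have Tinv: "T (rev u) (T u z) = z" if u: "set u \<subseteq> Cols" "even (length u)" and "z \<in> M" for u z
  proof -
    obtain v where v: "set v \<subseteq> Cols" "z = foldr rM v e" using \<open>z \<in> M\<close> M_iff by blast
    have "T (rev u) (T u z) = foldr rM ((v @ u) @ rev u) e" 
      unfolding v(2) T[OF u] by (rule T) (use u in auto)
    also have "\<dots> = foldr rM v e" using u e_Y by (simp add: foldr_rM foldr_ry_rev')
    finally show ?thesis using v by simp
  qed
  \<comment> \<open>Here \<open>rev w\<close> cancels the word of \<open>x\<close> and
    \<open>w'\<close> replaces it by that of \<open>y\<close>. The length is even because
    \<open>x\<close> and \<open>y\<close> have the same colour.\<close>
  define u where "u = rev w @ w'"
  have u: "set u \<subseteq> Cols" "even (length u)" "set (rev u) \<subseteq> Cols" "even (length (rev u))"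
    using w w' par by (auto simp: u_def)
  have "bij_betw (T u) M M"
    by (rule bij_betw_byWitness[of _ "T (rev u)"]) (use TM u Tinv[OF u(1,2)] Tinv[OF u(3,4)] in auto)
  moreover have "T u x = y"
  proof -
    have "foldr ry w (foldr ry (rev w) (foldr ry w' (e a))) = foldr ry w' (e a)" for a
      using w w' e_Y by (simp add: foldr_ry_rev' foldr_ry_closed)
    then show ?thesis using T[OF u(1,2), of w] w w' by (simp add: u_def foldr_rM)
  qed
  moreover have "T u (rM i z) = rM i (T u z)" for i z by (simp add: T_def rM_def)
  ultimately show ?thesis by blast
qed

lemma finite_M: "finite M"
proof -
  have "finite Y" using W_finite by (simp add: Y_def)
  then have fin: "finite (Pow (Y \<times> Y))" by simp
  \<comment> \<open>Through the precomposition with \<open>e\<close>, an element of \<open>M\<close>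
    is determined by its graph over the finite set \<open>Y0\<close>.\<close>
  let ?g = "\<lambda>x. {(a, x a) | a. a \<in> Y0}"
  have "inj_on ?g M"
  proof (rule inj_onI)
    fix x y assume xy: "x \<in> M" "y \<in> M" and eq: "?g x = ?g y"
    have z: "z a = z (e a)" if "z \<in> M" for z a
      using that by (auto simp: M_def e_id[OF e_Y0])
    have "x a = y a" if "a \<in> Y0" for a using eq that by blast
    then have "x a = y a" for a using z[OF xy(1), of a] z[OF xy(2), of a] e_Y0[of a] by simp
    then show "x = y" by (rule ext)
  qed
  moreover have "?g ` M \<subseteq> Pow (Y \<times> Y)" using M_Y by (auto simp: Y0_def)
  ultimately show ?thesis using inj_on_finite fin by blast
qed

end

section \<open>Automorphisms and facets of the extension\<close>

lemma Field_face_section: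
  assumes "Refl r" shows "Field (face_section r E G) = interval r E G"
proof -
  have "(H, H) \<in> face_section r E G" if "H \<in> interval r E G" for H
    using that assms by (auto simp: face_section_def interval_def refl_on_def Field_def)
  then show ?thesis by (auto simp: face_section_def Field_def)
qed

lemma poset_iso_face_section:
  assumes h: "automorphism r h" and r: "Refl r" and E: "E \<in> Field r" "h E = E" and G: "G \<in> Field r" "h G = G"
  shows "poset_iso (face_section r E G) (face_section r E G) h"
proof -
  have b: "bij_betw h (Field r) (Field r)"
    and o: "\<And>F H. F \<in> Field r \<Longrightarrow> H \<in> Field r \<Longrightarrow> (F, H) \<in> r \<longleftrightarrow> (h F, h H) \<in> r"
    using h by (auto simp: poset_iso_def)
  have sub: "interval r E G \<subseteq> Field r" by (auto simp: interval_def Field_def)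
  note F = Field_face_section[OF r, of E G]
  have iff: "h H \<in> interval r E G \<longleftrightarrow> H \<in> interval r E G" if "H \<in> Field r" for H
    using o[OF E(1) that] o[OF that G(1)] E G by (simp add: interval_def)
  have "h ` interval r E G = interval r E G"
  proof (intro equalityI subsetI)
    fix H assume H: "H \<in> interval r E G"
    then obtain H' where "H' \<in> Field r" "H = h H'" using b sub by (auto simp: bij_betw_def)
    then show "H \<in> h ` interval r E G" using iff H by blast
  qed (use iff sub in auto)
  then have "bij_betw h (interval r E G) (interval r E G)"
    using b sub by (auto simp: bij_betw_def intro: inj_on_subset)
  moreover have "(F, H) \<in> face_section r E G \<longleftrightarrow> (h F, h H) \<in> face_section r E G"
    if "F \<in> interval r E G" "H \<in> interval r E G" for F H
    using o[of F H] iff[of F] iff[of H] that sub by (auto simp: face_section_def)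
  ultimately show ?thesis unfolding poset_iso_def F by blast
qed

context labelled_maniplex
begin

lemma P_iff:
  assumes "x \<in> M" "y \<in> M" "i \<in> ranks" "j \<in> ranks"
  shows "(lab i x, lab j y) \<in> P \<longleftrightarrow> i \<le> j \<and> (\<exists>z\<in>M. lab i z = lab i x \<and> lab j z = lab j y)"
proof
  assume "(lab i x, lab j y) \<in> P"
  then show "i \<le> j \<and> (\<exists>z\<in>M. lab i z = lab i x \<and> lab j z = lab j y)"
    by (rule P_D) (use assms rk_lab in force)
next
  assume "i \<le> j \<and> (\<exists>z\<in>M. lab i z = lab i x \<and> lab j z = lab j y)"
  then show "(lab i x, lab j y) \<in> P" using P_I assms by metis
qed

lemma conn_map:
  assumes "conn r I x y" "I \<subseteq> C" "x \<in> M" "\<And>i z. i \<in> C \<Longrightarrow> z \<in> M \<Longrightarrow> T (r i z) = r i (T z)"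
  shows "conn r I (T x) (T y)"
  using assms(1)
proof (induction rule: conn_induct)
  case (step z i)
  have "z \<in> M" using conn_closed step assms by blast
  then have "T (r i z) = r i (T z)" using assms step by blast
  then show ?case using conn_step[of r I "T x" "T z" i] step by simp
qed simp

text \<open>A bijection of the flags that commutes with all colours permutes the components left by
  removing any one colour, so it acts on faces; it also preserves the sharing of flags, which is
  incidence.\<close>

lemma induced_automorphism:
  assumes T: "bij_betw T M M" and c: "\<And>i z. i \<in> C \<Longrightarrow> z \<in> M \<Longrightarrow> T (r i z) = r i (T z)"
  shows "\<exists>f. automorphism P f \<and> (\<forall>x\<in>M. f ` fl x = fl (T x))"
proof -
  define S where "S = inv_into M T"
  have S: "bij_betw S M M" unfolding S_def by (rule bij_betw_inv_into[OF T])
  have TM: "T x \<in> M" "S x \<in> M" "S (T x) = x" "T (S x) = x" if "x \<in> M" for x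
    using that T S bij_betw_apply[OF T] bij_betw_apply[OF S] bij_betw_inv_into_left[OF T] bij_betw_inv_into_right[OF T]
    by (auto simp: S_def)
  have cS: "S (r i z) = r i (S z)" if "i \<in> C" "z \<in> M" for i z
  proof -
    have "T (r i (S z)) = r i z" using c[OF that(1) TM(2)[OF that(2)]] TM(4)[OF that(2)] by simp
    then show ?thesis using TM(3)[OF closed[OF that(1) TM(2)[OF that(2)]]] by simp
  qed
  \<comment> \<open>Stated for a general map \<open>U\<close>, since both \<open>T\<close> and its
    inverse \<open>S\<close> are needed.\<close>
  have le: "lab i (U x) = lab i (U y)"
    if "lab i x = lab i y" "i \<in> ranks" "x \<in> M" "y \<in> M" "\<And>z. z \<in> M \<Longrightarrow> U z \<in> M"
      "\<And>i z. i \<in> C \<Longrightarrow> z \<in> M \<Longrightarrow> U (r i z) = r i (U z)" for i x y U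
  proof -
    have "conn r (C - {i}) x y" using that lab_eq_iff by blast
    then have "conn r (C - {i}) (U x) (U y)" by (rule conn_map) (use that in auto)
    then show ?thesis using that lab_eq_iff by blast
  qed
  have eq: "lab i (T x) = lab i (T y) \<longleftrightarrow> lab i x = lab i y" if "i \<in> ranks" "x \<in> M" "y \<in> M" for i x y
    using le[of i x y T] le[of i "T x" "T y" S] that TM c cS by auto
  define f where "f F = lab (rk F) (T (SOME x. x \<in> M \<and> F = lab (rk F) x))" for F
  have f: "f (lab i x) = lab i (T x)" if "i \<in> ranks" "x \<in> M" for i x
  proof -
    let ?y = "SOME y. y \<in> M \<and> lab i x = lab i y"
    have "?y \<in> M \<and> lab i x = lab i ?y" by (rule someI[of _ x]) (use that in simp)
    then have "lab i (T ?y) = lab i (T x)" using eq[of i ?y x] that by simp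
    then show ?thesis using that by (simp add: f_def rk_lab)
  qed
  have "inj_on f (Field P)"
  proof (rule inj_onI)
    fix F G assume FG: "F \<in> Field P" "G \<in> Field P" "f F = f G"
    then obtain i x j y where *: "F = lab i x" "i \<in> ranks" "x \<in> M" "G = lab j y" "j \<in> ranks" "y \<in> M"
      unfolding Field_P by blast
    then have "lab i (T x) = lab j (T y)" using FG f by simp
    then have "i = j" using lab_inj[of i j "T x" "T y"] TM * by simp
    then show "F = G" using * eq \<open>lab i (T x) = lab j (T y)\<close> by simp
  qed
  moreover have "f ` Field P = Field P"
  proof (intro equalityI subsetI)
    fix G assume "G \<in> Field P"
    then obtain i x where *: "G = lab i x" "i \<in> ranks" "x \<in> M" unfolding Field_P by blast
    then have "G = f (lab i (S x))" using f TM by simp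
    then show "G \<in> f ` Field P" using * TM unfolding Field_P by blast
  next
    fix G assume "G \<in> f ` Field P"
    then obtain i x where "G = f (lab i x)" "i \<in> ranks" "x \<in> M" unfolding Field_P by blast
    then have "G = lab i (T x)" "i \<in> ranks" "T x \<in> M" using f TM by auto
    then show "G \<in> Field P" unfolding Field_P by blast
  qed
  moreover have "(F, G) \<in> P \<longleftrightarrow> (f F, f G) \<in> P" if FG: "F \<in> Field P" "G \<in> Field P" for F G
  proof -
    obtain i x j y where *: "F = lab i x" "i \<in> ranks" "x \<in> M" "G = lab j y" "j \<in> ranks" "y \<in> M"
      using FG unfolding Field_P by blast
    have "(\<exists>z\<in>M. lab i z = lab i x \<and> lab j z = lab j y) \<longleftrightarrow>
        (\<exists>z\<in>M. lab i z = lab i (T x) \<and> lab j z = lab j (T y))" (is "?L \<longleftrightarrow> ?R")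
    proof
      assume ?L
      then obtain z where "z \<in> M" "lab i z = lab i x" "lab j z = lab j y" by blast
      then show ?R using eq[of i z x] eq[of j z y] * TM by (intro bexI[of _ "T z"]) auto
    next
      assume ?R
      then obtain z where "z \<in> M" "lab i z = lab i (T x)" "lab j z = lab j (T y)" by blast
      then show ?L using eq[of i "S z" x] eq[of j "S z" y] * TM by (intro bexI[of _ "S z"]) auto
    qed
    then show ?thesis using P_iff[of x y i j] P_iff[of "T x" "T y" i j] * TM f by simp
  qed
  ultimately have "automorphism P f" by (simp add: poset_iso_def bij_betw_def)
  moreover have "f ` fl x = fl (T x)" if "x \<in> M" for x
    unfolding fl_def image_image using f that by (intro image_cong) auto
  ultimately show ?thesis by blast
qed

end

text \<open>\<open>J\<close> places a copy of the flag graph of \<open>K\<close> inside that of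
  \<open>P\<close>, using the colours below \<open>d\<close>. Its image turns out to consist of all
  flags through one facet.\<close>

locale facet_embedding = labelled_maniplex M r "Suc d" lab rkP + K: abstract_polytope d K rkK
  for M :: "'m set" and r d and lab :: "int \<Rightarrow> 'm \<Rightarrow> 'f" and rkP and K :: "'a rel" and rkK +
  fixes J :: "'a set \<Rightarrow> 'm"
  assumes J_M: "\<And>\<Phi>. \<Phi> \<in> flags K \<Longrightarrow> J \<Phi> \<in> M"
    and J_nb: "\<And>i \<Phi>. i \<in> {0..<int d} \<Longrightarrow> \<Phi> \<in> flags K \<Longrightarrow> J (K.nb i \<Phi>) = r i (J \<Phi>)"
    and J_inj: "inj_on J (flags K)"
begin

lemma J_conn:
  assumes "conn K.nb I \<Phi> \<Psi>" "I \<subseteq> {0..<int d}" "\<Phi> \<in> flags K"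
  shows "conn r I (J \<Phi>) (J \<Psi>)"
  using assms(1)
proof (induction rule: conn_induct)
  case (step z i)
  then have "z \<in> flags K" using K.conn_fc(1) assms by blast
  moreover have "i \<in> {0..<int d}" using step assms by blast
  ultimately show ?case using J_nb[of i z] conn_step[of r I "J \<Phi>" "J z" i] step by simp
qed simp

lemma conn_J:
  assumes "conn r I (J \<Phi>) z" "I \<subseteq> {0..<int d}" "\<Phi> \<in> flags K"
  shows "\<exists>\<Psi>\<in>flags K. z = J \<Psi> \<and> conn K.nb I \<Phi> \<Psi>"
  using assms(1)
proof (induction rule: conn_induct)
  case refl
  then show ?case using assms by (intro bexI[of _ \<Phi>]) auto
next
  case (step z i)
  then obtain \<Psi> where \<Psi>: "\<Psi> \<in> flags K" "z = J \<Psi>" "conn K.nb I \<Phi> \<Psi>" by blast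
  have i: "i \<in> {0..<int d}" "i \<in> I" using step assms by blast+
  show ?case
  proof (intro bexI conjI)
    show "r i z = J (K.nb i \<Psi>)" using J_nb i \<Psi> by simp
    show "conn K.nb I \<Phi> (K.nb i \<Psi>)" using conn_step \<Psi>(3) i(2) by metis
  qed (use K.nb_flag i \<Psi> in auto)
qed

lemma lab_J_all:
  assumes "\<Phi> \<in> flags K" "\<Psi> \<in> flags K" "i = -1 \<or> i = int d"
  shows "lab i (J \<Phi>) = lab i (J \<Psi>)"
proof -
  have "conn K.nb {0..<int d} \<Phi> \<Psi>" by (rule K.fc_conn) (use assms in auto)
  then have "conn r {0..<int d} (J \<Phi>) (J \<Psi>)" by (rule J_conn) (use assms in auto)
  then show ?thesis using assms by (intro lab_conn[OF J_M]) auto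
qed

lemma lab_J_iff:
  assumes "\<Phi> \<in> flags K" "\<Psi> \<in> flags K" "i \<in> {-1..int d}"
  shows "lab i (J \<Phi>) = lab i (J \<Psi>) \<longleftrightarrow> K.fc \<Phi> i = K.fc \<Psi> i"
proof (cases "i \<in> {0..<int d}")
  case False
  then have i: "i = -1 \<or> i = int d" using assms by auto
  then have "K.fc \<Phi> i = K.fc \<Psi> i"
    using K.rk_fc[OF _ assms(3)] K.fc_Field[OF _ assms(3)] K.least_unique K.greatest_unique assms by metis
  then show ?thesis using lab_J_all[OF assms(1,2) i] by simp
next
  case True
  let ?I = "{0..<int d} - {i}"
  show ?thesis
  proof
    assume "K.fc \<Phi> i = K.fc \<Psi> i"
    then have "conn K.nb ?I \<Phi> \<Psi>" by (intro K.fc_conn) (use assms in auto)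
    then have "conn r ?I (J \<Phi>) (J \<Psi>)" by (rule J_conn) (use assms in auto)
    then show "lab i (J \<Phi>) = lab i (J \<Psi>)" using True assms by (intro lab_conn[OF J_M]) auto
  next
    assume eq: "lab i (J \<Phi>) = lab i (J \<Psi>)"
    \<comment> \<open>A common \<open>i\<close>-face alone would permit a path that leaves the facet
      by colour \<open>d\<close>. The images also share the face of rank \<open>d\<close>, and
      removing both colours at once keeps the path inside the image of \<open>J\<close>.\<close>
    have "conn r (C \<inter> ?I) (J \<Phi>) (J \<Psi>)"
    proof (rule conn_if_lab)
      fix j assume "j \<in> C - ?I"
      then have "j = i \<or> j = int d" by auto
      then show "lab j (J \<Phi>) = lab j (J \<Psi>)" using eq lab_J_all assms by blast
    qed (use J_M assms in auto)
    then have "conn r ?I (J \<Phi>) (J \<Psi>)" by (rule conn_mono) auto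
    then obtain \<Theta> where "\<Theta> \<in> flags K" "J \<Psi> = J \<Theta>" "conn K.nb ?I \<Phi> \<Theta>" using conn_J[of ?I] assms by blast
    then have "conn K.nb ?I \<Phi> \<Psi>" using J_inj assms by (metis inj_onD)
    then show "K.fc \<Phi> i = K.fc \<Psi> i" using K.conn_fc(2)[of ?I \<Phi> \<Psi> i] True assms by auto
  qed
qed

lemma in_facet:
  assumes "\<Phi> \<in> flags K" "z \<in> M" "lab (int d) z = lab (int d) (J \<Phi>)"
  shows "\<exists>\<Psi>\<in>flags K. z = J \<Psi>"
proof -
  have "conn r (C - {int d}) (J \<Phi>) z"
    using lab_eq_iff[of "int d" "J \<Phi>" z] assms(3)[symmetric] J_M[OF assms(1)] assms(2) by simp
  moreover have "C - {int d} = {0..<int d}" by auto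
  ultimately show ?thesis using conn_J[of "{0..<int d}" \<Phi> z] assms by auto
qed

text \<open>The choice of a flag through \<open>F\<close> is immaterial by
  \<open>lab_J_iff\<close>.\<close>

definition emb :: "'a \<Rightarrow> 'f" where
  "emb F = lab (rkK F) (J (SOME \<Phi>. \<Phi> \<in> flags K \<and> F \<in> \<Phi>))"

lemma emb_fc:
  assumes "\<Phi> \<in> flags K" "i \<in> {-1..int d}"
  shows "emb (K.fc \<Phi> i) = lab i (J \<Phi>)"
proof -
  let ?F = "K.fc \<Phi> i"
  let ?\<Psi> = "SOME \<Psi>. \<Psi> \<in> flags K \<and> ?F \<in> \<Psi>"
  have \<Psi>: "?\<Psi> \<in> flags K \<and> ?F \<in> ?\<Psi>"
    by (rule someI[of _ \<Phi>]) (use assms K.fc_mem in auto)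
  have rk: "rkK ?F = i" using K.rk_fc assms by simp
  then have "K.fc ?\<Psi> i = ?F" using K.fc_eqI \<Psi> by blast
  then have "lab i (J ?\<Psi>) = lab i (J \<Phi>)" using lab_J_iff[of ?\<Psi> \<Phi> i] \<Psi> assms by simp
  then show ?thesis by (simp add: emb_def rk)
qed

lemma face_fc:
  assumes "F \<in> Field K"
  obtains \<Phi> where "\<Phi> \<in> flags K" "F = K.fc \<Phi> (rkK F)" "rkK F \<in> {-1..int d}"
proof -
  have "K.chain {F}" using assms K.r_refl by (simp add: K.chain_def)
  then obtain \<Phi> where "\<Phi> \<in> flags K" "F \<in> \<Phi>" using K.ex_flag by blast
  then show ?thesis using that K.fc_rk K.rk_range assms by metis
qed

lemma facet_iso:
  assumes \<Phi>: "\<Phi> \<in> flags K"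
  shows "poset_iso K (face_section P (lab (-1) (J \<Phi>)) (lab (int d) (J \<Phi>))) emb"
proof -
  let ?E = "lab (-1) (J \<Phi>)" and ?G = "lab (int d) (J \<Phi>)"
  interpret P: abstract_polytope "Suc d" P rkP by (rule abstract_polytope_P)
  have sub: "interval P ?E ?G \<subseteq> Field P" by (auto simp: interval_def Field_def)
  have "Refl P" using P.partial_order by (simp add: partial_order_on_def preorder_on_def)
  then have F: "Field (face_section P ?E ?G) = interval P ?E ?G" by (rule Field_face_section)
  have int: "interval P ?E ?G = {lab i (J \<Psi>) | i \<Psi>. i \<in> {-1..int d} \<and> \<Psi> \<in> flags K}"
  proof (intro equalityI subsetI)
    fix H assume H: "H \<in> interval P ?E ?G"
    obtain z where z: "z \<in> M" "lab (int d) z = ?G" "H = lab (rkP H) z" "rkP H \<in> {-1..int d}"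
      by (rule interval_lab[OF J_M[OF \<Phi>] _ _ H]) auto
    then obtain \<Psi> where "\<Psi> \<in> flags K" "z = J \<Psi>" using in_facet \<Phi> by blast
    then show "H \<in> {lab i (J \<Psi>) | i \<Psi>. i \<in> {-1..int d} \<and> \<Psi> \<in> flags K}" using z by blast
  next
    fix H assume "H \<in> {lab i (J \<Psi>) | i \<Psi>. i \<in> {-1..int d} \<and> \<Psi> \<in> flags K}"
    then obtain i \<Psi> where *: "H = lab i (J \<Psi>)" "i \<in> {-1..int d}" "\<Psi> \<in> flags K" by blast
    have "(lab (-1) (J \<Psi>), H) \<in> P" "(H, lab (int d) (J \<Psi>)) \<in> P"
      using P_I[of "-1" i "J \<Psi>"] P_I[of i "int d" "J \<Psi>"] J_M * by auto
    then show "H \<in> interval P ?E ?G"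
      using lab_J_all[OF \<Phi> *(3)] by (simp add: interval_def)
  qed
  have "inj_on emb (Field K)"
  proof (rule inj_onI)
    fix F G assume FG: "F \<in> Field K" "G \<in> Field K" "emb F = emb G"
    obtain \<Theta> where \<Theta>: "\<Theta> \<in> flags K" "F = K.fc \<Theta> (rkK F)" "rkK F \<in> {-1..int d}" using FG face_fc by metis
    obtain \<Psi> where \<Psi>: "\<Psi> \<in> flags K" "G = K.fc \<Psi> (rkK G)" "rkK G \<in> {-1..int d}" using FG face_fc by metis
    have "emb F = lab (rkK F) (J \<Theta>)" "emb G = lab (rkK G) (J \<Psi>)" using emb_fc \<Theta> \<Psi> by metis+
    then have e: "lab (rkK F) (J \<Theta>) = lab (rkK G) (J \<Psi>)" using FG by simp
    then have "rkK F = rkK G" using lab_inj[of "rkK F" "rkK G"] J_M \<Theta> \<Psi> by auto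
    then show "F = G" using e lab_J_iff \<Theta> \<Psi> by metis
  qed
  moreover have im: "emb ` Field K = interval P ?E ?G"
  proof (intro equalityI subsetI)
    fix H assume "H \<in> emb ` Field K"
    then obtain F where F: "F \<in> Field K" "H = emb F" by blast
    obtain \<Theta> where \<Theta>: "\<Theta> \<in> flags K" "F = K.fc \<Theta> (rkK F)" "rkK F \<in> {-1..int d}" by (rule face_fc[OF F(1)])
    then have "H = lab (rkK F) (J \<Theta>)" using F(2) emb_fc[OF \<Theta>(1,3)] by metis
    then show "H \<in> interval P ?E ?G" unfolding int using \<Theta> by blast
  next
    fix H assume "H \<in> interval P ?E ?G"
    then obtain i \<Psi> where *: "H = lab i (J \<Psi>)" "i \<in> {-1..int d}" "\<Psi> \<in> flags K" unfolding int by blast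
    then have "H = emb (K.fc \<Psi> i)" using emb_fc by simp
    then show "H \<in> emb ` Field K" using K.fc_Field * by blast
  qed
  moreover have "(F, G) \<in> K \<longleftrightarrow> (emb F, emb G) \<in> face_section P ?E ?G" if FG: "F \<in> Field K" "G \<in> Field K" for F G
  proof -
    have *: "(emb F, emb G) \<in> face_section P ?E ?G \<longleftrightarrow> (emb F, emb G) \<in> P"
      using imageI[OF FG(1), of emb] imageI[OF FG(2), of emb] unfolding im face_section_def by simp
    obtain \<Theta> where \<Theta>: "\<Theta> \<in> flags K" "F = K.fc \<Theta> (rkK F)" "rkK F \<in> {-1..int d}" using FG face_fc by metis
    obtain \<Psi> where \<Psi>: "\<Psi> \<in> flags K" "G = K.fc \<Psi> (rkK G)" "rkK G \<in> {-1..int d}" using FG face_fc by metis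
    have e: "emb F = lab (rkK F) (J \<Theta>)" "emb G = lab (rkK G) (J \<Psi>)" using emb_fc \<Theta> \<Psi> by metis+
    have "(F, G) \<in> K \<longleftrightarrow> (emb F, emb G) \<in> P"
    proof
      assume r: "(F, G) \<in> K"
      then have "K.chain {F, G}" using FG K.r_refl by (auto simp: K.chain_def)
      then obtain X where X: "X \<in> flags K" "F \<in> X" "G \<in> X" using K.ex_flag by blast
      then have "F = K.fc X (rkK F)" "G = K.fc X (rkK G)" using K.fc_rk by simp_all
      then have "emb F = lab (rkK F) (J X)" "emb G = lab (rkK G) (J X)" using emb_fc[OF X(1)] \<Theta> \<Psi> by metis+
      then show "(emb F, emb G) \<in> P"
        using P_I[of "rkK F" "rkK G" "J X"] K.r_rk[OF r] J_M[OF X(1)] \<Theta>(3) \<Psi>(3) by simp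
    next
      assume r: "(emb F, emb G) \<in> P"
      have le: "rkK F \<le> rkK G"
        using P.r_rk[OF r] rk_lab[OF _ J_M] \<Theta>(1,3) \<Psi>(1,3) unfolding e by simp
      \<comment> \<open>Adding the facet on top of the chain forces the common flag \<open>z\<close>
        to pass through it, so that \<open>z\<close> comes from a flag of \<open>K\<close>.\<close>
      have r2: "(emb G, lab (int d) (J \<Psi>)) \<in> P" using P_I[of "rkK G" "int d" "J \<Psi>"] J_M \<Psi>(1,3) unfolding e by simp
      from P_trans[OF r r2] obtain z where z: "z \<in> M" "emb F = lab (rkK F) z" "emb G = lab (rkK G) z"
        "lab (int d) (J \<Psi>) = lab (int d) z"
        using rk_lab[OF _ J_M] \<Theta>(1,3) \<Psi>(1,3) unfolding e by auto
      then obtain X where X: "X \<in> flags K" "z = J X" using in_facet[OF \<Psi>(1) z(1)] by auto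
      have "K.fc X (rkK F) = F" using lab_J_iff[OF X(1) \<Theta>(1,3)] \<Theta>(2) X(2) z(2) e by simp
      moreover have "K.fc X (rkK G) = G" using lab_J_iff[OF X(1) \<Psi>(1,3)] \<Psi>(2) X(2) z(3) e by simp
      ultimately show "(F, G) \<in> K" using K.fc_le[OF X(1) \<Theta>(3) \<Psi>(3) le] by simp
    qed
    then show ?thesis using * by simp
  qed
  ultimately show ?thesis unfolding poset_iso_def F bij_betw_def by simp
qed

lemma emb_flag: "\<Phi> \<in> flags K \<Longrightarrow> emb ` \<Phi> = (\<lambda>i. lab i (J \<Phi>)) ` {-1..int d}"
  using emb_fc by (subst K.flag_eq_fc) (auto simp: image_image)

text \<open>Both flags contain the same facet and the same least face, so \<open>h\<close> fixes
  these and restricts to the facet; conjugation by \<open>emb\<close> moves the restriction to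
  \<open>K\<close>. In this way the chirality of \<open>K\<close> limits the automorphisms of
  \<open>P\<close>.\<close>

lemma restrict_automorphism:
  assumes h: "automorphism P h" and \<Phi>: "\<Phi> \<in> flags K" and \<Psi>: "\<Psi> \<in> flags K"
    and hf: "h ` fl (J \<Phi>) = fl (J \<Psi>)"
  shows "\<Psi> \<in> flag_orbit K \<Phi>"
proof -
  let ?E = "lab (-1) (J \<Phi>)" and ?G = "lab (int d) (J \<Phi>)"
  let ?S = "face_section P ?E ?G"
  interpret P: abstract_polytope "Suc d" P rkP by (rule abstract_polytope_P)
  have hl: "h (lab i (J \<Phi>)) = lab i (J \<Psi>)" if i: "i \<in> {-1..int d}" for i
  proof -
    have i': "i \<in> ranks" using i by auto
    have "h (lab i (J \<Phi>)) \<in> fl (J \<Psi>)" using hf i' by (auto simp: fl_def)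
    then have "h (lab i (J \<Phi>)) = lab (rkP (h (lab i (J \<Phi>)))) (J \<Psi>)" using fl_mem[OF J_M[OF \<Psi>]] by blast
    moreover have "lab i (J \<Phi>) \<in> Field P" using i' J_M[OF \<Phi>] unfolding Field_P by blast
    then have "rkP (h (lab i (J \<Phi>))) = i" using P.iso_rk(1)[OF h] rk_lab[OF i' J_M[OF \<Phi>]] by simp
    ultimately show ?thesis by simp
  qed
  have "h ?E = ?E" "h ?G = ?G" using hl lab_J_all[OF \<Psi> \<Phi>] by auto
  moreover have "?E \<in> Field P" "?G \<in> Field P" using J_M[OF \<Phi>] P_I[of "-1" "int d" "J \<Phi>"] by (auto simp: Field_def)
  moreover have "Refl P" using P.partial_order by (simp add: partial_order_on_def preorder_on_def)
  ultimately have hS: "poset_iso ?S ?S h" using poset_iso_face_section[OF h] by simp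
  note emb = facet_iso[OF \<Phi>]
  let ?g = "inv_into (Field K) emb \<circ> (h \<circ> emb)"
  have "automorphism K ?g" by (rule poset_iso_comp[OF poset_iso_comp[OF emb hS] poset_iso_inv[OF emb]])
  moreover have "?g ` \<Phi> = \<Psi>"
  proof -
    have "h ` emb ` \<Phi> = emb ` \<Psi>" unfolding emb_flag[OF \<Phi>] emb_flag[OF \<Psi>] image_image using hl by (intro image_cong) auto
    moreover have "?g ` \<Phi> = inv_into (Field K) emb ` h ` emb ` \<Phi>" by (simp only: image_comp comp_assoc)
    ultimately have "?g ` \<Phi> = inv_into (Field K) emb ` emb ` \<Psi>" by simp
    also have "\<dots> = \<Psi>"
      by (rule inv_into_image_cancel) (use emb K.flag_Field[OF \<Psi>] in \<open>auto simp: poset_iso_def bij_betw_def\<close>)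
    finally show ?thesis .
  qed
  ultimately show ?thesis unfolding flag_orbit_def by blast
qed

end

section \<open>Reflections of the facets of a chiral polytope\<close>

context abstract_polytope
begin

text \<open>The action on flags of a facet automorphism that takes \<open>\<psi>\<close> to its
  \<open>(d - 2)\<close>-neighbour. The last clause records that the action comes from a map of
  faces: the \<open>j\<close>-face of an image depends only on the \<open>j\<close>-face.\<close>

definition facet_reflection :: "'a set \<Rightarrow> ('a set \<Rightarrow> 'a set) \<Rightarrow> bool" where
  "facet_reflection \<psi> \<sigma> \<longleftrightarrow> \<sigma> \<psi> = nb (int d - 2) \<psi> \<and>
    (\<forall>\<Phi>\<in>flags r. fc \<Phi> (int d - 1) = fc \<psi> (int d - 1) \<longrightarrow>
       \<sigma> \<Phi> \<in> flags r \<and> fc (\<sigma> \<Phi>) (int d - 1) = fc \<psi> (int d - 1) \<and>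
       (\<forall>i\<in>{0..<int d - 1}. \<sigma> (nb i \<Phi>) = nb i (\<sigma> \<Phi>)) \<and>
       (\<forall>\<Psi>\<in>flags r. fc \<Psi> (int d - 1) = fc \<psi> (int d - 1) \<longrightarrow>
          (\<forall>j\<in>{0..<int d}. fc \<Phi> j = fc \<Psi> j \<longrightarrow> fc (\<sigma> \<Phi>) j = fc (\<sigma> \<Psi>) j)))"

lemma ex_facet_reflection:
  assumes d: "2 \<le> d" and \<psi>: "\<psi> \<in> flags r"
    and reg: "\<forall>Q\<in>facets d r rk. regular_polytope (d - 1) Q rk"
  shows "\<exists>\<sigma>. facet_reflection \<psi> \<sigma>"
proof -
  define F where "F = fc \<psi> (int d - 1)"
  define E where "E = fc \<psi> (-1)"
  define Q where "Q = face_section r E F"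
  have F: "F \<in> Field r" "rk F = int d - 1" and E: "E \<in> Field r" "rk E = -1"
    using \<psi> d fc_Field rk_fc by (auto simp: F_def E_def)
  then have "Q \<in> facets d r rk" unfolding facets_def Q_def by blast
  then interpret Q: regular_polytope "d - 1" Q rk using reg by blast
  have d1: "int (d - 1) = int d - 1" using d by simp
  have mem: "H \<in> interval r E F \<longleftrightarrow> (H, F) \<in> r" for H
    using rk_least[OF E(1) _ E(2)] r_Field by (auto simp: interval_def)
  have Qr: "(H, G) \<in> Q \<longleftrightarrow> (H, G) \<in> r \<and> (H, F) \<in> r \<and> (G, F) \<in> r" for H G
    by (auto simp: Q_def face_section_def mem)
  have FQ: "H \<in> Field Q \<longleftrightarrow> (H, F) \<in> r" for H
  proof
    assume "(H, F) \<in> r"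
    then have "(H, H) \<in> Q" using Qr r_refl r_Field by blast
    then show "H \<in> Field Q" by (auto simp: Field_def)
  qed (use Qr in \<open>auto simp: Field_def\<close>)
  define S where "S = {\<Phi> \<in> flags r. fc \<Phi> (int d - 1) = F}"
  \<comment> \<open>Dropping the greatest face turns a flag of \<open>K\<close> through
    \<open>F\<close> into a flag of the section, where regularity applies.\<close>
  define low where "low \<Phi> = fc \<Phi> ` {-1..int d - 1}" for \<Phi>
  have low: "low \<Phi> \<in> flags Q" and fclow: "\<And>i. i \<in> {-1..int d - 1} \<Longrightarrow> Q.fc (low \<Phi>) i = fc \<Phi> i"
    if "\<Phi> \<in> S" for \<Phi>
  proof -
    have \<Phi>: "\<Phi> \<in> flags r" "fc \<Phi> (int d - 1) = F" using that by (auto simp: S_def)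
    have *: "(fc \<Phi> i, F) \<in> r" if "i \<in> {-1..int d - 1}" for i
      using fc_le[OF \<Phi>(1), of i "int d - 1"] \<Phi>(2) that by auto
    have 1: "rk (fc \<Phi> i) = i" if "i \<in> Q.ranks" for i using rk_fc[OF \<Phi>(1)] that d by auto
    have 2: "(fc \<Phi> i, fc \<Phi> (i + 1)) \<in> Q" if "-1 \<le> i" "i < int (d - 1)" for i
      using fc_le[OF \<Phi>(1), of i "i + 1"] * Qr that d by auto
    have 3: "fc \<Phi> i \<in> Field Q" if "i \<in> Q.ranks" for i using * FQ that d1 by auto
    show "low \<Phi> \<in> flags Q" "\<And>i. i \<in> {-1..int d - 1} \<Longrightarrow> Q.fc (low \<Phi>) i = fc \<Phi> i"
      using Q.flagI[of "fc \<Phi>", OF 1 2 3] unfolding low_def d1 by auto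
  qed
  have i0: "int d - 2 \<in> {0..<int d}" "int d - 2 \<in> {0..<int d - 1}" using d by auto
  have nbS: "nb i \<Phi> \<in> S" if "\<Phi> \<in> S" "i \<in> {0..<int d - 1}" for \<Phi> i
    using that fc_nb[of \<Phi> i "int d - 1"] nb_flag[of i \<Phi>] d by (auto simp: S_def)
  have \<psi>S: "\<psi> \<in> S" using \<psi> by (simp add: S_def F_def)
  have "low (nb (int d - 2) \<psi>) \<in> flag_orbit Q (low \<psi>)"
    by (rule Q.flag_transitive) (use low \<psi>S nbS i0 in auto)
  then obtain g where g: "automorphism Q g" "low (nb (int d - 2) \<psi>) = g ` low \<psi>"
    unfolding flag_orbit_def by auto
  have gF: "g H \<in> Field Q" "rk (g H) = rk H" if "H \<in> Field Q" for H
    using Q.iso_rk(1)[OF g(1) that] bij_betw_apply[of g "Field Q" "Field Q", OF _ that] g(1)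
    by (auto simp: poset_iso_def)
  \<comment> \<open>The greatest face has rank \<open>d\<close> and lies outside the facet on which
    \<open>g\<close> acts, so it is kept.\<close>
  define s where "s \<Phi> i = (if i = int d then fc \<Phi> i else g (fc \<Phi> i))" for \<Phi> i
  define \<sigma> where "\<sigma> \<Phi> = s \<Phi> ` ranks" for \<Phi>
  have fcQ: "fc \<Phi> i \<in> Field Q" if "\<Phi> \<in> S" "i \<in> {-1..int d - 1}" for \<Phi> i
    using Q.fc_Field[OF low[OF that(1)], of i] fclow[OF that] that d1 by auto
  have \<sigma>: "\<sigma> \<Phi> \<in> flags r" and fc\<sigma>: "\<And>i. i \<in> ranks \<Longrightarrow> fc (\<sigma> \<Phi>) i = s \<Phi> i" if "\<Phi> \<in> S" for \<Phi>
  proof -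
    have \<Phi>: "\<Phi> \<in> flags r" using that by (auto simp: S_def)
    have 3: "s \<Phi> i \<in> Field r \<and> rk (s \<Phi> i) = i" if i: "i \<in> ranks" for i
    proof (cases "i = int d")
      case True
      then show ?thesis using fc_Field[OF \<Phi> i] rk_fc[OF \<Phi> i] by (auto simp: s_def)
    next
      case False
      then have "fc \<Phi> i \<in> Field Q" using fcQ[OF \<open>\<Phi> \<in> S\<close>, of i] i by auto
      then have "g (fc \<Phi> i) \<in> Field Q" "rk (g (fc \<Phi> i)) = i" using gF rk_fc[OF \<Phi> i] by auto
      then show ?thesis using False FQ r_Field by (auto simp: s_def)
    qed
    have 2: "(s \<Phi> i, s \<Phi> (i + 1)) \<in> r" if i: "-1 \<le> i" "i < int d" for i
    proof (cases "i + 1 = int d")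
      case True
      then show ?thesis using 3[of i] 3[of "i + 1"] rk_greatest[of "s \<Phi> i" "s \<Phi> (i + 1)"] i by auto
    next
      case False
      have a: "fc \<Phi> i \<in> Field Q" "fc \<Phi> (i + 1) \<in> Field Q" using fcQ[OF \<open>\<Phi> \<in> S\<close>] False i by auto
      have "(fc \<Phi> i, fc \<Phi> (i + 1)) \<in> r" using fc_le[OF \<Phi>] i by auto
      then have "(fc \<Phi> i, fc \<Phi> (i + 1)) \<in> Q" using Qr a FQ by auto
      then have "(g (fc \<Phi> i), g (fc \<Phi> (i + 1))) \<in> Q" using g(1) a by (auto simp: poset_iso_def)
      then show ?thesis using Qr False i by (auto simp: s_def)
    qed
    show "\<sigma> \<Phi> \<in> flags r" "\<And>i. i \<in> ranks \<Longrightarrow> fc (\<sigma> \<Phi>) i = s \<Phi> i"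
      unfolding \<sigma>_def
      by (rule flagI[of "s \<Phi>", OF conjunct2[OF 3] 2 conjunct1[OF 3]]; simp)+
  qed
  have gtop: "g F = F"
  proof -
    have "F \<in> Field Q" using FQ r_refl F by simp
    then show ?thesis using gF[of F] FQ r_rk_eq[of "g F" F] by auto
  qed
  have \<sigma>S: "\<sigma> \<Phi> \<in> S" if "\<Phi> \<in> S" for \<Phi>
    using \<sigma>[OF that] fc\<sigma>[OF that, of "int d - 1"] that gtop by (auto simp: S_def s_def)
  have \<sigma>fc: "fc (\<sigma> \<Phi>) i = g (fc \<Phi> i)" if "\<Phi> \<in> S" "i \<in> {-1..int d - 1}" for \<Phi> i
    using fc\<sigma>[OF that(1), of i] that by (auto simp: s_def)
  have ginj: "inj_on g (Field Q)" using Q.iso_inj[OF g(1)] .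
  have "\<sigma> (nb i \<Phi>) = nb i (\<sigma> \<Phi>)" if \<Phi>: "\<Phi> \<in> S" and i: "i \<in> {0..<int d - 1}" for i \<Phi>
  proof (rule nb_eqI)
    have \<Phi>f: "\<Phi> \<in> flags r" using \<Phi> by (simp add: S_def)
    have ii: "i \<in> {-1..int d - 1}" "i \<in> {0..<int d}" using i by auto
    have "g (fc (nb i \<Phi>) i) \<noteq> g (fc \<Phi> i)"
      using inj_on_contraD[OF ginj fc_nb_neq[OF \<Phi>f ii(2)] fcQ[OF nbS[OF \<Phi> i] ii(1)] fcQ[OF \<Phi> ii(1)]] .
    then show "\<sigma> (nb i \<Phi>) \<noteq> \<sigma> \<Phi>" using \<sigma>fc[OF nbS[OF \<Phi> i] ii(1)] \<sigma>fc[OF \<Phi> ii(1)] by auto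
    show "fc (\<sigma> (nb i \<Phi>)) j = fc (\<sigma> \<Phi>) j" if "j \<in> {0..<int d}" "j \<noteq> i" for j
      using \<sigma>fc[OF nbS[OF \<Phi> i], of j] \<sigma>fc[OF \<Phi>, of j] fc_nb[OF \<Phi>f ii(2) that] that by auto
  qed (use \<sigma>S[OF \<Phi>] \<sigma>S[OF nbS[OF \<Phi> i]] i in \<open>auto simp: S_def\<close>)
  moreover have "\<sigma> \<psi> = nb (int d - 2) \<psi>"
  proof (rule flag_eqI)
    fix i assume "i \<in> {0..<int d}"
    then have i: "i \<in> {-1..int d - 1}" by auto
    have "fc (\<sigma> \<psi>) i = g (Q.fc (low \<psi>) i)" using \<sigma>fc[OF \<psi>S i] fclow[OF \<psi>S i] by simp
    also have "\<dots> = Q.fc (g ` low \<psi>) i" using Q.iso_fc[OF g(1) low[OF \<psi>S], of i] i d1 by simp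
    also have "\<dots> = fc (nb (int d - 2) \<psi>) i" using fclow[OF nbS[OF \<psi>S i0(2)] i] g(2) by simp
    finally show "fc (\<sigma> \<psi>) i = fc (nb (int d - 2) \<psi>) i" .
  qed (use \<sigma>[OF \<psi>S] nb_flag i0 \<psi> in auto)
  moreover have "fc (\<sigma> \<Phi>) j = fc (\<sigma> \<Psi>) j" if "\<Phi> \<in> S" "\<Psi> \<in> S" "j \<in> {0..<int d}" "fc \<Phi> j = fc \<Psi> j" for \<Phi> \<Psi> j
    using \<sigma>fc[OF that(1), of j] \<sigma>fc[OF that(2), of j] that by auto
  moreover have "\<Phi> \<in> S \<longleftrightarrow> \<Phi> \<in> flags r \<and> fc \<Phi> (int d - 1) = F" for \<Phi> by (simp add: S_def)
  ultimately have "facet_reflection \<psi> \<sigma>"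
    unfolding facet_reflection_def F_def[symmetric] using \<sigma>S by meson
  then show ?thesis by blast
qed

end

section \<open>Orbit colours, and reflections assembled over all facets\<close>

context chiral_polytope
begin

definition col :: "'a set \<Rightarrow> bool" where
  "col \<Phi> \<longleftrightarrow> flag_orbit r \<Phi> = flag_orbit r (SOME \<Psi>. \<Psi> \<in> flags r)"

lemma flags_nonempty: "flags r \<noteq> {}"
  using two_flag_orbits by auto

lemma two_orbits:
  obtains a b where "flag_orbit r ` flags r = {a, b}" "a \<noteq> b" "a = flag_orbit r (SOME \<Psi>. \<Psi> \<in> flags r)"
proof -
  let ?a = "flag_orbit r (SOME \<Psi>. \<Psi> \<in> flags r)"
  have "(SOME \<Psi>. \<Psi> \<in> flags r) \<in> flags r" using flags_nonempty some_in_eq by blast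
  then have "?a \<in> flag_orbit r ` flags r" by blast
  moreover obtain x y where xy: "flag_orbit r ` flags r = {x, y}" "x \<noteq> y"
    using two_flag_orbits unfolding card_2_iff by blast
  ultimately have "?a = x \<or> ?a = y" by simp
  then show ?thesis
  proof
    assume "?a = x"
    then show ?thesis using that[OF xy] by simp
  next
    assume "?a = y"
    with xy show ?thesis by (intro that[of y x]) auto
  qed
qed

text \<open>There are only two orbits, so all flags outside the reference orbit belong to one and
  the same orbit.\<close>

lemma col_iff:
  assumes "\<Phi> \<in> flags r" "\<Psi> \<in> flags r"
  shows "col \<Phi> = col \<Psi> \<longleftrightarrow> flag_orbit r \<Phi> = flag_orbit r \<Psi>"
proof -
  obtain a b where ab: "flag_orbit r ` flags r = {a, b}" "a \<noteq> b" "a = flag_orbit r (SOME \<Psi>. \<Psi> \<in> flags r)"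
    by (rule two_orbits)
  have "flag_orbit r \<Phi> \<in> {a, b}" "flag_orbit r \<Psi> \<in> {a, b}" using assms ab(1) by blast+
  then show ?thesis using ab(2) unfolding col_def ab(3)[symmetric] by auto
qed

lemma col_nb: assumes "i \<in> {0..<int d}" "\<Phi> \<in> flags r" shows "col (nb i \<Phi>) \<noteq> col \<Phi>"
proof -
  have "adjacent d r rk \<Phi> (nb i \<Phi>)" unfolding adjacent_def using nb_adjacent assms by blast
  then have "flag_orbit r \<Phi> \<noteq> flag_orbit r (nb i \<Phi>)" by (rule adjacent_orbits)
  then show ?thesis using col_iff assms nb_flag by metis
qed

text \<open>Flags of equal colour are related by an automorphism, and automorphisms commute with
  taking neighbours.\<close>

lemma col_transfer:
  assumes "\<Phi> \<in> flags r" "\<Psi> \<in> flags r" "col \<Phi> = col \<Psi>" "set w \<subseteq> {0..<int d}" "set w' \<subseteq> {0..<int d}"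
    "foldr nb w \<Phi> = foldr nb w' \<Phi>"
  shows "foldr nb w \<Psi> = foldr nb w' \<Psi>"
proof -
  have "\<Psi> \<in> flag_orbit r \<Phi>" using col_iff assms flag_orbit_self by metis
  then obtain f where f: "automorphism r f" "\<Psi> = f ` \<Phi>" unfolding flag_orbit_def by blast
  then show ?thesis using iso_words[OF f(1) assms(1) assms(4)] iso_words[OF f(1) assms(1) assms(5)] assms(6) by metis
qed

lemma reflections:
  assumes d: "2 \<le> d" and reg: "\<forall>Q\<in>facets d r rk. regular_polytope (d - 1) Q rk"
    and \<phi>: "\<phi> \<in> flags r" and k: "k \<in> {0..int d - 2}"
  shows "\<exists>\<rho>. \<forall>\<Phi>\<in>flags r. \<rho> \<Phi> \<in> flags r \<and> \<rho> (\<rho> \<Phi>) = \<Phi> \<and> col (\<rho> \<Phi>) \<noteq> col \<Phi> \<and>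
    (\<forall>i\<in>{0..<int d - 1}. \<rho> (nb i \<Phi>) = nb i (\<rho> \<Phi>)) \<and>
    fc (\<rho> \<Phi>) (int d - 1) = fc \<Phi> (int d - 1) \<and>
    ((\<forall>j\<in>{0..<k}. fc \<Phi> j = fc \<phi> j) \<longrightarrow> (\<forall>j\<in>{0..<k}. fc (\<rho> \<Phi>) j = fc \<phi> j))"
proof -
  let ?f = "int d - 1"
  define Z where "Z = {\<Phi> \<in> flags r. \<forall>j\<in>{0..<k}. fc \<Phi> j = fc \<phi> j}"
  \<comment> \<open>A base flag in \<open>Z\<close> makes the reflection preserve \<open>Z\<close>, since it only moves the \<open>(d - 2)\<close>-face of the base flag.\<close>
  define base where "base F = (if \<exists>\<psi>\<in>Z. fc \<psi> ?f = F then SOME \<psi>. \<psi> \<in> Z \<and> fc \<psi> ?f = F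
    else SOME \<psi>. \<psi> \<in> flags r \<and> fc \<psi> ?f = F)" for F
  have baseZ: "base (fc \<Phi> ?f) \<in> Z \<and> fc (base (fc \<Phi> ?f)) ?f = fc \<Phi> ?f" if "\<Phi> \<in> Z" for \<Phi>
  proof -
    have "\<exists>\<psi>\<in>Z. fc \<psi> ?f = fc \<Phi> ?f" using that by blast
    moreover have "(SOME \<psi>. \<psi> \<in> Z \<and> fc \<psi> ?f = fc \<Phi> ?f) \<in> Z \<and> fc (SOME \<psi>. \<psi> \<in> Z \<and> fc \<psi> ?f = fc \<Phi> ?f) ?f = fc \<Phi> ?f"
      by (rule someI[of _ \<Phi>]) (use that in simp)
    ultimately show ?thesis unfolding base_def by simp
  qed
  have base: "base (fc \<Phi> ?f) \<in> flags r \<and> fc (base (fc \<Phi> ?f)) ?f = fc \<Phi> ?f" if "\<Phi> \<in> flags r" for \<Phi>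
  proof (cases "\<exists>\<psi>\<in>Z. fc \<psi> ?f = fc \<Phi> ?f")
    case True
    then obtain \<psi> where "\<psi> \<in> Z" "fc \<psi> ?f = fc \<Phi> ?f" by blast
    then show ?thesis using baseZ[of \<psi>] by (simp add: Z_def)
  next
    case False
    moreover have "(SOME \<psi>. \<psi> \<in> flags r \<and> fc \<psi> ?f = fc \<Phi> ?f) \<in> flags r \<and> fc (SOME \<psi>. \<psi> \<in> flags r \<and> fc \<psi> ?f = fc \<Phi> ?f) ?f = fc \<Phi> ?f"
      by (rule someI[of _ \<Phi>]) (use that in simp)
    ultimately show ?thesis unfolding base_def by simp
  qed
  define sig where "sig \<psi> = (SOME \<sigma>. facet_reflection \<psi> \<sigma>)" for \<psi>
  have sig: "facet_reflection \<psi> (sig \<psi>)" if "\<psi> \<in> flags r" for \<psi>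
    unfolding sig_def by (rule someI_ex[OF ex_facet_reflection[OF d that reg]])
  define \<rho> where "\<rho> \<Phi> = sig (base (fc \<Phi> ?f)) \<Phi>" for \<Phi>
  have i0: "int d - 2 \<in> {0..<int d}" "int d - 2 \<in> {0..<?f}" using d by auto
  show ?thesis
  proof (intro exI[of _ \<rho>] ballI)
    fix \<Phi> assume \<Phi>: "\<Phi> \<in> flags r"
    define \<psi> where "\<psi> = base (fc \<Phi> ?f)"
    define \<sigma> where "\<sigma> = sig \<psi>"
    have \<psi>: "\<psi> \<in> flags r" "fc \<psi> ?f = fc \<Phi> ?f" using base[OF \<Phi>] by (auto simp: \<psi>_def)
    have "facet_reflection \<psi> \<sigma>" unfolding \<sigma>_def by (rule sig[OF \<psi>(1)])
    then have g\<psi>: "\<sigma> \<psi> = nb (int d - 2) \<psi>"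
      and gfl: "\<And>X. X \<in> flags r \<Longrightarrow> fc X ?f = fc \<psi> ?f \<Longrightarrow> \<sigma> X \<in> flags r"
      and gfc: "\<And>X. X \<in> flags r \<Longrightarrow> fc X ?f = fc \<psi> ?f \<Longrightarrow> fc (\<sigma> X) ?f = fc \<psi> ?f"
      and gnb: "\<And>X i. X \<in> flags r \<Longrightarrow> fc X ?f = fc \<psi> ?f \<Longrightarrow> i \<in> {0..<?f} \<Longrightarrow> \<sigma> (nb i X) = nb i (\<sigma> X)"
      and geq: "\<And>X Y j. X \<in> flags r \<Longrightarrow> fc X ?f = fc \<psi> ?f \<Longrightarrow> Y \<in> flags r \<Longrightarrow> fc Y ?f = fc \<psi> ?f \<Longrightarrow>
         j \<in> {0..<int d} \<Longrightarrow> fc X j = fc Y j \<Longrightarrow> fc (\<sigma> X) j = fc (\<sigma> Y) j"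
      unfolding facet_reflection_def by blast+
    have \<rho>: "\<rho> X = \<sigma> X" if "fc X ?f = fc \<Phi> ?f" for X using that by (simp add: \<rho>_def \<sigma>_def \<psi>_def)
    have nbf: "fc (nb i X) ?f = fc X ?f" if "X \<in> flags r" "i \<in> {0..<?f}" for i X
      using fc_nb[of X i ?f] that by auto
    \<comment> \<open>The colours below \<open>d - 1\<close> commute with \<open>\<sigma>\<close>
      and connect all flags through the facet. Involutivity and the exchange of colours therefore
      need checking only at the base flag, where \<open>\<sigma>\<close> gives the
      \<open>(d - 2)\<close>-neighbour.\<close>
    have "conn nb {0..<?f} \<psi> \<Phi>"
    proof (rule fc_conn)
      fix j assume "j \<in> {0..<int d} - {0..<?f}"
      then have "j = ?f" by auto
      then show "fc \<psi> j = fc \<Phi> j" using \<psi> by simp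
    qed (use \<psi> \<Phi> in auto)
    then have "\<Phi> \<in> flags r \<and> fc \<Phi> ?f = fc \<psi> ?f \<and> \<sigma> (\<sigma> \<Phi>) = \<Phi> \<and> col (\<sigma> \<Phi>) \<noteq> col \<Phi>"
    proof (induction rule: conn_induct)
      case refl
      then show ?case using \<psi>(1) g\<psi> gnb[OF \<psi>(1) HOL.refl i0(2)] nb_invol[OF i0(1) \<psi>(1)] col_nb[OF i0(1) \<psi>(1)] by simp
    next
      case (step X i)
      then have X: "X \<in> flags r" "fc X ?f = fc \<psi> ?f" "\<sigma> (\<sigma> X) = X" "col (\<sigma> X) \<noteq> col X" by auto
      have i: "i \<in> {0..<int d}" using step by auto
      have s: "\<sigma> (nb i X) = nb i (\<sigma> X)" by (rule gnb[OF X(1,2) step(2)])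
      then have "\<sigma> (\<sigma> (nb i X)) = nb i X"
        using gnb[OF gfl[OF X(1,2)] gfc[OF X(1,2)] step(2)] X by simp
      moreover have "col (\<sigma> (nb i X)) \<noteq> col (nb i X)"
        using col_nb[OF i X(1)] col_nb[OF i gfl[OF X(1,2)]] X(4) s by auto
      ultimately show ?case using nb_flag[OF i X(1)] nbf[OF X(1) step(2)] X(2) by simp
    qed
    then have inv: "\<sigma> (\<sigma> \<Phi>) = \<Phi>" and c: "col (\<sigma> \<Phi>) \<noteq> col \<Phi>" by auto
    have \<rho>\<Phi>: "\<rho> \<Phi> = \<sigma> \<Phi>" by (rule \<rho>) simp
    have f: "fc (\<sigma> \<Phi>) ?f = fc \<Phi> ?f" using gfc[OF \<Phi>] \<psi> by simp
    have "\<rho> (\<rho> \<Phi>) = \<Phi>" using \<rho>\<Phi> \<rho>[OF f] inv by simp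
    moreover have "\<rho> (nb i \<Phi>) = nb i (\<rho> \<Phi>)" if "i \<in> {0..<?f}" for i
      using \<rho>\<Phi> \<rho>[OF nbf[OF \<Phi> that]] gnb[OF \<Phi> _ that] \<psi> by simp
    moreover have "fc (\<rho> \<Phi>) j = fc \<phi> j" if a: "\<forall>j\<in>{0..<k}. fc \<Phi> j = fc \<phi> j" and j: "j \<in> {0..<k}" for j
    proof -
      have "\<Phi> \<in> Z" using \<Phi> a by (simp add: Z_def)
      then have "\<psi> \<in> Z" using baseZ by (simp add: \<psi>_def)
      then have e: "fc \<psi> j = fc \<phi> j" using j by (simp add: Z_def)
      have jj: "j \<in> {0..<int d}" "j \<noteq> int d - 2" using j k by auto
      \<comment> \<open>The \<open>j\<close>-face of the image can be computed from the base flag,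
        which has the same \<open>j\<close>-face. Its image differs from it only in rank
        \<open>d - 2\<close>, and \<open>j < k \<le> d - 2\<close>.\<close>
      have "fc (\<sigma> \<Phi>) j = fc (\<sigma> \<psi>) j" using geq[OF \<Phi> _ \<psi>(1) refl jj(1)] \<psi> e a j by simp
      also have "\<dots> = fc \<psi> j" using g\<psi> fc_nb[OF \<psi>(1) i0(1) jj] by simp
      finally show ?thesis using e \<rho>\<Phi> by simp
    qed
    ultimately show "\<rho> \<Phi> \<in> flags r \<and> \<rho> (\<rho> \<Phi>) = \<Phi> \<and> col (\<rho> \<Phi>) \<noteq> col \<Phi> \<and>
    (\<forall>i\<in>{0..<int d - 1}. \<rho> (nb i \<Phi>) = nb i (\<rho> \<Phi>)) \<and>
    fc (\<rho> \<Phi>) (int d - 1) = fc \<Phi> (int d - 1) \<and>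
    ((\<forall>j\<in>{0..<k}. fc \<Phi> j = fc \<phi> j) \<longrightarrow> (\<forall>j\<in>{0..<k}. fc (\<rho> \<Phi>) j = fc \<phi> j))"
      using \<rho>\<Phi> gfl[OF \<Phi>] \<psi> c f by simp
  qed
qed

end

section \<open>Chiral extensions\<close>

text \<open>A word leading from \<open>\<Phi>\<close> to a flag of \<open>K\<close> is applied to
  \<open>x\<close> instead. By \<open>free_iff\<close> the result does not depend on the word, and
  distinct flags have distinct images.\<close>

lemma (in twisted_extension) ex_facet_map:
  assumes "x \<in> M" "\<Phi> \<in> W" "col \<Phi> = mcol x"
  shows "\<exists>J. J \<Phi> = x \<and> inj_on J W \<and> (\<forall>\<Psi>\<in>W. J \<Psi> \<in> M \<and> (\<forall>i\<in>{0..<int d}. J (nb i \<Psi>) = rM i (J \<Psi>)))"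
proof -
  define wd where "wd \<Psi> = (SOME w. set w \<subseteq> {0..<int d} \<and> foldr nb w \<Phi> = \<Psi>)" for \<Psi>
  have wd: "set (wd \<Psi>) \<subseteq> {0..<int d} \<and> foldr nb (wd \<Psi>) \<Phi> = \<Psi>" if "\<Psi> \<in> W" for \<Psi>
  proof -
    have "conn nb {0..<int d} \<Phi> \<Psi>" using conn_iff assms that by simp
    then obtain w where "set w \<subseteq> {0..<int d} \<and> foldr nb w \<Phi> = \<Psi>" unfolding conn_def by blast
    then show ?thesis unfolding wd_def by (rule someI)
  qed
  define J where "J \<Psi> = foldr rM (wd \<Psi>) x" for \<Psi>
  have J: "J (foldr nb w \<Phi>) = foldr rM w x" if w: "set w \<subseteq> {0..<int d}" for w
  proof -
    have "foldr nb w \<Phi> \<in> W" using foldr_nb_closed w assms by simp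
    from wd[OF this] show ?thesis unfolding J_def using free_iff[OF assms _ w] by simp
  qed
  have "J \<Phi> = x" using J[of "[]"] by simp
  moreover have "inj_on J W"
  proof (rule inj_onI)
    fix \<Psi> \<Theta> assume "\<Psi> \<in> W" "\<Theta> \<in> W" "J \<Psi> = J \<Theta>"
    then show "\<Psi> = \<Theta>" using wd[of \<Psi>] wd[of \<Theta>] free_iff[OF assms, of "wd \<Psi>" "wd \<Theta>"] by (simp add: J_def)
  qed
  moreover have "J \<Psi> \<in> M \<and> (\<forall>i\<in>{0..<int d}. J (nb i \<Psi>) = rM i (J \<Psi>))" if "\<Psi> \<in> W" for \<Psi>
  proof (intro conjI ballI)
    have "set (wd \<Psi>) \<subseteq> Cols" using wd[OF that] by auto
    then show "J \<Psi> \<in> M" unfolding J_def by (rule M_closed_words[OF _ assms(1)])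
    fix i assume "i \<in> {0..<int d}"
    then show "J (nb i \<Psi>) = rM i (J \<Psi>)" using J[of "i # wd \<Psi>"] wd[OF that] by (simp add: J_def)
  qed
  ultimately show ?thesis by blast
qed

text \<open>The finitely many pairs of a rank and a component are numbered injectively. The rank
  belongs to the pair because equal components can occur in different ranks: for -1 and
  \<open>D\<close> both are all of \<open>M\<close>.\<close>

lemma (in maniplex) ex_labelling:
  assumes "finite M"
  shows "\<exists>(lab :: int \<Rightarrow> 'm \<Rightarrow> nat) rk. labelled_maniplex M r D lab rk"
proof -
  have "finite ({-1..int D} \<times> Pow M)" using assms by simp
  then obtain h :: "int \<times> 'm set \<Rightarrow> nat" where h: "inj_on h ({-1..int D} \<times> Pow M)"
    using finite_imp_inj_to_nat_seg by metis
  define cls where "cls i x = {y \<in> M. conn r (C - {i}) x y}" for i x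
  define lab where "lab i x = h (i, cls i x)" for i x
  define rk where "rk F = fst (inv_into ({-1..int D} \<times> Pow M) h F)" for F
  have mem: "(i, cls i x) \<in> {-1..int D} \<times> Pow M" if "i \<in> {-1..int D}" for i x
    using that by (auto simp: cls_def)
  have "labelled_maniplex M r D lab rk"
  proof
    show "rk (lab i x) = i" if "i \<in> {-1..int D}" "x \<in> M" for i x
      unfolding rk_def lab_def inv_into_f_f[OF h mem[OF that(1)]] by simp
    show "lab i x = lab i y \<longleftrightarrow> conn r (C - {i}) x y" if "i \<in> {-1..int D}" "x \<in> M" "y \<in> M" for i x y
    proof -
      have "lab i x = lab i y \<longleftrightarrow> cls i x = cls i y"
        unfolding lab_def inj_on_eq_iff[OF h mem[OF that(1)] mem[OF that(1)]] by simp
      also have "\<dots> \<longleftrightarrow> conn r (C - {i}) x y"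
      proof
        assume "cls i x = cls i y"
        moreover have "y \<in> cls i y" using that by (simp add: cls_def)
        ultimately have "y \<in> cls i x" by simp
        then show "conn r (C - {i}) x y" by (simp add: cls_def)
      next
        assume c: "conn r (C - {i}) x y"
        then have c': "conn r (C - {i}) y x" using conn_sym that by blast
        show "cls i x = cls i y" unfolding cls_def
          using conn_trans[OF c] conn_trans[OF c'] by blast
      qed
      finally show ?thesis .
    qed
  qed
  then show ?thesis by blast
qed

theorem theorem1p1:
  fixes d :: nat and K :: "'a rel" and rk :: "'a \<Rightarrow> int"
  assumes "d \<ge> 3"
    and "chiral_polytope d K rk"
    and "finite (Field K)"
    and "\<forall>Q\<in>facets d K rk. regular_polytope (d - 1) Q rk"
  shows "\<exists>(P :: nat rel) (rk' :: nat \<Rightarrow> int).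
           chiral_polytope (d + 1) P rk' \<and>
           finite (Field P) \<and>
           (\<forall>Q\<in>facets (d + 1) P rk'. isomorphic Q K)"
proof -
  interpret K: chiral_polytope d K rk by fact
  have d: "2 \<le> d" using assms(1) by simp
  define rho where "rho \<phi> k = (SOME \<rho>. \<forall>\<Phi>\<in>flags K. \<rho> \<Phi> \<in> flags K \<and> \<rho> (\<rho> \<Phi>) = \<Phi> \<and> K.col (\<rho> \<Phi>) \<noteq> K.col \<Phi> \<and>
    (\<forall>i\<in>{0..<int d - 1}. \<rho> (K.nb i \<Phi>) = K.nb i (\<rho> \<Phi>)) \<and>
    K.fc (\<rho> \<Phi>) (int d - 1) = K.fc \<Phi> (int d - 1) \<and>
    ((\<forall>j\<in>{0..<k}. K.fc \<Phi> j = K.fc \<phi> j) \<longrightarrow> (\<forall>j\<in>{0..<k}. K.fc (\<rho> \<Phi>) j = K.fc \<phi> j)))" for \<phi> k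
  have rho: "\<forall>\<Phi>\<in>flags K. rho \<phi> k \<Phi> \<in> flags K \<and> rho \<phi> k (rho \<phi> k \<Phi>) = \<Phi> \<and> K.col (rho \<phi> k \<Phi>) \<noteq> K.col \<Phi> \<and>
    (\<forall>i\<in>{0..<int d - 1}. rho \<phi> k (K.nb i \<Phi>) = K.nb i (rho \<phi> k \<Phi>)) \<and>
    K.fc (rho \<phi> k \<Phi>) (int d - 1) = K.fc \<Phi> (int d - 1) \<and>
    ((\<forall>j\<in>{0..<k}. K.fc \<Phi> j = K.fc \<phi> j) \<longrightarrow> (\<forall>j\<in>{0..<k}. K.fc (rho \<phi> k \<Phi>) j = K.fc \<phi> j))"
    if "\<phi> \<in> flags K" "k \<in> {0..int d - 2}" for \<phi> k
    unfolding rho_def by (rule someI_ex[OF K.reflections[OF d assms(4) that]])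
  interpret T: twisted_extension "flags K" K.nb d K.col K.fc rho
  proof
    show "2 \<le> d" by (rule d)
    show "flags K \<noteq> {}" by (rule K.flags_nonempty)
    show "finite (flags K)" by (rule K.finite_flags[OF assms(3)])
    show "conn K.nb I \<Phi> \<Psi> \<longleftrightarrow> (\<forall>j\<in>{0..<int d} - I. K.fc \<Phi> j = K.fc \<Psi> j)"
      if "I \<subseteq> {0..<int d}" "\<Phi> \<in> flags K" "\<Psi> \<in> flags K" for I \<Phi> \<Psi>
      using K.conn_fc(2)[of I \<Phi> \<Psi>] K.fc_conn[of \<Phi> \<Psi> I] that by metis
    show "foldr K.nb w \<Psi> = foldr K.nb w' \<Psi>" if "\<Phi> \<in> flags K" "\<Psi> \<in> flags K" "K.col \<Phi> = K.col \<Psi>"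
      "set w \<subseteq> {0..<int d}" "set w' \<subseteq> {0..<int d}" "foldr K.nb w \<Phi> = foldr K.nb w' \<Phi>" for \<Phi> \<Psi> w w'
      by (rule K.col_transfer[OF that])
    fix \<phi> k \<Phi> assume a: "\<phi> \<in> flags K" "k \<in> {0..int d - 2}" "\<Phi> \<in> flags K"
    note r = bspec[OF rho[OF a(1,2)] a(3)]
    show "rho \<phi> k \<Phi> \<in> flags K" "rho \<phi> k (rho \<phi> k \<Phi>) = \<Phi>" "K.col (rho \<phi> k \<Phi>) \<noteq> K.col \<Phi>"
      "K.fc (rho \<phi> k \<Phi>) (int d - 1) = K.fc \<Phi> (int d - 1)" using r by blast+
    show "rho \<phi> k (K.nb i \<Phi>) = K.nb i (rho \<phi> k \<Phi>)" if "i \<in> {0..<int d - 1}" for i using r that by blast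
    show "K.fc (rho \<phi> k \<Phi>) j = K.fc \<phi> j" if "\<forall>j\<in>{0..<k}. K.fc \<Phi> j = K.fc \<phi> j" "j \<in> {0..<k}" for j
      using r that by blast
  qed (fact K.nb_flag K.nb_invol K.col_nb K.nb_commute)+
  obtain lab :: "int \<Rightarrow> _ \<Rightarrow> nat" and rkP where "labelled_maniplex T.M T.rM (Suc d) lab rkP"
    using T.ex_labelling[OF T.finite_M] by blast
  then interpret L: labelled_maniplex T.M T.rM "Suc d" lab rkP .
  interpret P: abstract_polytope "Suc d" L.P rkP by (rule L.abstract_polytope_P)
  have emb: "\<exists>\<Phi> J. \<Phi> \<in> flags K \<and> J \<Phi> = x \<and> facet_embedding T.M T.rM d lab rkP K rk J" if x: "x \<in> T.M" for x
  proof -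
    obtain \<Phi> where \<Phi>: "\<Phi> \<in> flags K" "K.col \<Phi> = T.mcol x" by (rule T.ex_col)
    obtain J where J: "J \<Phi> = x" "inj_on J (flags K)"
      "\<forall>\<Psi>\<in>flags K. J \<Psi> \<in> T.M \<and> (\<forall>i\<in>{0..<int d}. J (K.nb i \<Psi>) = T.rM i (J \<Psi>))"
      using T.ex_facet_map[OF x \<Phi>] by blast
    have "facet_embedding T.M T.rM d lab rkP K rk J"
      by (intro facet_embedding.intro facet_embedding_axioms.intro L.labelled_maniplex_axioms K.abstract_polytope_axioms)
         (use J in blast)+
    then show ?thesis using \<Phi> J by blast
  qed
  \<comment> \<open>The two flags share their facet. An automorphism relating them would restrict to
    \<open>K\<close> and relate a flag to its 0-neighbour, which chirality of \<open>K\<close>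
    forbids.\<close>
  have not_orbit: "L.fl (T.rM 0 x) \<notin> flag_orbit L.P (L.fl x)" if x: "x \<in> T.M" for x
  proof
    assume "L.fl (T.rM 0 x) \<in> flag_orbit L.P (L.fl x)"
    then obtain h where h: "automorphism L.P h" "L.fl (T.rM 0 x) = h ` L.fl x" unfolding flag_orbit_def by blast
    obtain \<Phi> J where \<Phi>: "\<Phi> \<in> flags K" "J \<Phi> = x" and "facet_embedding T.M T.rM d lab rkP K rk J"
      using emb[OF x] by blast
    then interpret F: facet_embedding T.M T.rM d lab rkP K rk J by blast
    have 0: "0 \<in> {0..<int d}" using d by simp
    have n: "K.nb 0 \<Phi> \<in> flags K" by (rule K.nb_flag[OF 0 \<Phi>(1)])
    have "h ` L.fl (J \<Phi>) = L.fl (J (K.nb 0 \<Phi>))" using h(2) F.J_nb[OF 0 \<Phi>(1)] \<Phi>(2) by simp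
    then have "K.nb 0 \<Phi> \<in> flag_orbit K \<Phi>" by (rule F.restrict_automorphism[OF h(1) \<Phi>(1) n])
    then have "flag_orbit K (K.nb 0 \<Phi>) = flag_orbit K \<Phi>" by (rule flag_orbit_eq[OF _ K.flag_Field[OF \<Phi>(1)]])
    then show False using K.col_iff[OF n \<Phi>(1)] K.col_nb[OF 0 \<Phi>(1)] by simp
  qed
  have fl_flag: "L.fl x \<in> flags L.P" if "x \<in> T.M" for x using L.flags_P that by blast
  have same: "flag_orbit L.P (L.fl y) = flag_orbit L.P (L.fl x)"
    if xy: "x \<in> T.M" "y \<in> T.M" "T.mcol x = T.mcol y" for x y
  proof -
    obtain S where S: "bij_betw S T.M T.M" "S x = y" "\<forall>z\<in>T.M. \<forall>i\<in>{0..<int (Suc d)}. S (T.rM i z) = T.rM i (S z)"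
      using T.homogeneous[OF xy] by blast
    have "\<exists>f. automorphism L.P f \<and> (\<forall>x\<in>T.M. f ` L.fl x = L.fl (S x))"
      by (rule L.induced_automorphism[OF S(1)]) (use S(3) in blast)
    then obtain f where f: "automorphism L.P f" "\<forall>x\<in>T.M. f ` L.fl x = L.fl (S x)" by blast
    then have "L.fl y = f ` L.fl x" using S(2) xy(1) by simp
    then have "L.fl y \<in> flag_orbit L.P (L.fl x)" unfolding flag_orbit_def using f(1) by blast
    then show ?thesis by (rule flag_orbit_eq) (rule P.flag_Field[OF fl_flag[OF xy(1)]])
  qed
  have 0: "0 \<in> {0..<int (Suc d)}" by simp
  \<comment> \<open>If the colours differed, \<open>y\<close> and the 0-neighbour of
    \<open>x\<close> would have the same colour and hence the same orbit. Then \<open>x\<close>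
    would share its orbit with its own 0-neighbour.\<close>
  have orbit_iff: "flag_orbit L.P (L.fl x) = flag_orbit L.P (L.fl y) \<longleftrightarrow> T.mcol x = T.mcol y"
    if x: "x \<in> T.M" and y: "y \<in> T.M" for x y
  proof
    assume eq: "flag_orbit L.P (L.fl x) = flag_orbit L.P (L.fl y)"
    show "T.mcol x = T.mcol y"
    proof (rule ccontr)
      assume "T.mcol x \<noteq> T.mcol y"
      then have "T.mcol y = T.mcol (T.rM 0 x)" using T.rM_col[OF 0 x] by auto
      then have "flag_orbit L.P (L.fl (T.rM 0 x)) = flag_orbit L.P (L.fl x)"
        using same[OF y T.rM_closed[OF 0 x]] eq by simp
      then show False using not_orbit[OF x] flag_orbit_self by metis
    qed
  qed (use same[OF x y] in simp)
  have "chiral_polytope (Suc d) L.P rkP"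
  proof
    obtain x where x: "x \<in> T.M" using T.e_M by blast
    let ?O = "\<lambda>x. flag_orbit L.P (L.fl x)"
    have "flag_orbit L.P ` flags L.P = {?O x, ?O (T.rM 0 x)}"
    proof (intro equalityI subsetI)
      fix X assume "X \<in> flag_orbit L.P ` flags L.P"
      then obtain y where y: "y \<in> T.M" "X = ?O y" unfolding L.flags_P by blast
      have "T.mcol y = T.mcol x \<or> T.mcol y = T.mcol (T.rM 0 x)" using T.rM_col[OF 0 x] by auto
      then show "X \<in> {?O x, ?O (T.rM 0 x)}"
        using y orbit_iff[OF y(1) x] orbit_iff[OF y(1) T.rM_closed[OF 0 x]] by auto
    qed (use fl_flag[OF x] fl_flag[OF T.rM_closed[OF 0 x]] in auto)
    moreover have "?O x \<noteq> ?O (T.rM 0 x)" using orbit_iff[OF x T.rM_closed[OF 0 x]] T.rM_col[OF 0 x] by simp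
    ultimately show "card (flag_orbit L.P ` flags L.P) = 2" by simp
    fix \<Phi> \<Psi> assume a: "adjacent (Suc d) L.P rkP \<Phi> \<Psi>"
    then have "\<Phi> \<in> flags L.P" "\<Psi> \<in> flags L.P" by (auto simp: adjacent_def i_adjacent_def)
    then obtain y z where yz: "y \<in> T.M" "z \<in> T.M" "\<Phi> = L.fl y" "\<Psi> = L.fl z" unfolding L.flags_P by blast
    then obtain i where "i \<in> {0..<int (Suc d)}" "z = T.rM i y" using a L.adjacent_iff by blast
    then have "T.mcol y \<noteq> T.mcol z" using T.rM_col yz by simp
    then show "flag_orbit L.P \<Phi> \<noteq> flag_orbit L.P \<Psi>" using orbit_iff yz by simp
  qed
  moreover have "finite (Field L.P)"
  proof -
    have "Field L.P = case_prod lab ` ({-1..int (Suc d)} \<times> T.M)" unfolding L.Field_P by force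
    then show ?thesis using T.finite_M by simp
  qed
  moreover have "isomorphic Q K" if Q: "Q \<in> facets (Suc d) L.P rkP" for Q
  proof -
    obtain E F where EF: "Q = face_section L.P E F" "E \<in> Field L.P" "F \<in> Field L.P" "rkP E = -1" "rkP F = int d"
      using Q unfolding facets_def by auto
    \<comment> \<open>Any facet \<open>F\<close> lies in some flag \<open>x\<close>, and the copy of
      \<open>K\<close> built around \<open>x\<close> is the section below \<open>F\<close>.\<close>
    obtain i x where x: "F = lab i x" "i \<in> {-1..int (Suc d)}" "x \<in> T.M" using EF(3) unfolding L.Field_P by blast
    then have F: "F = lab (int d) x" using EF(5) L.rk_lab by simp
    obtain \<Phi> J where \<Phi>: "\<Phi> \<in> flags K" "J \<Phi> = x" and "facet_embedding T.M T.rM d lab rkP K rk J"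
      using emb[OF x(3)] by blast
    then interpret F: facet_embedding T.M T.rM d lab rkP K rk J by blast
    have m: "-1 \<in> {-1..int (Suc d)}" by simp
    have "lab (-1) x \<in> Field L.P" unfolding L.Field_P using m x(3) by blast
    then have "E = lab (-1) x" using P.least_unique[OF EF(2)] EF(4) L.rk_lab[OF m x(3)] by blast
    then have "poset_iso K Q F.emb" using F.facet_iso[OF \<Phi>(1)] \<Phi>(2) F EF(1) by simp
    then show ?thesis unfolding isomorphic_def using poset_iso_inv by blast
  qed
  ultimately show ?thesis by auto
qed

end
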